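(* Given a tree $S\subseteq \mathrm{ds}(\infty)$ and a cardinal $\mu$, there is a tree $T\subseteq \mathrm{ds}(\infty)$ such that: $( * )_1$ for every $c:[T]^{<\aleph_0}\to\mu$ there is a subtree $T'\subseteq T$ isomorphic to $S$ such that $T'$ is end-uniform for $c$ (more precisely, for $c\restriction [T']^{<\aleph_0}$); $( * )_2$ $|T|<\beth_{|S|^+}(|S|+\mu)$.
   Context: $\mathrm{ds}(\infty)$ is the class of finite (strictly) decreasing sequences of ordinals. For a sequence $\eta$, $\mathrm{lg}(\eta)$ is its length; $\eta\triangleleft\nu$ means $\eta$ is a proper initial segment of $\nu$; $\eta\cap\nu$ is the longest common initial segment $\eta\restriction\ell$ ($\ell$ maximal with $\eta\restriction\ell=\nu\restriction\ell$). A tree is a non-empty $T\subseteq\mathrm{ds}(\infty)$ closed under initial segments; a subtree of $T$ is a tree contained in $T$. Orders on $\mathrm{ds}(\infty)$: $\eta<^1_{\ell x}\nu$ iff $\eta\triangleleft\nu$ or there is $\ell<\min(\mathrm{lg}(\eta),\mathrm{lg}(\nu))$ with $\eta\restriction\ell=\nu\restriction\ell$ and $\eta(\ell)<\nu(\ell)$. $\eta<^2_{\ell x}\nu$ iff $\nu\triangleleft\eta$ or there is such an $\ell$ with $\eta\restriction\ell=\nu\restriction\ell$ and $\eta(\ell)<\nu(\ell)$. Both are linear orders. An embedding of a tree $T_1$ into a tree $T_2$ is a map $f:T_1\to T_2$ preserving level (length), $\triangleleft$ and $<^1_{\ell x}$ (equivalently $<^2_{\ell x}$). Trees are isomorphic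 if there is an embedding of one onto the other. $[T]^{<\aleph_0}$ is the set of finite subsets of $T$; a finite $u\subseteq T$ is identified with the $<^2_{\ell x}$-increasing sequence listing it. For $c$ defined on $[T]^{<\aleph_0}$, a tree $T$ is end-uniform for $c$ if: whenever $\eta_1<^2_{\ell x}\eta_2<^2_{\ell x}\dots<^2_{\ell x}\eta_k$ and $\rho',\rho''$ are in $T$ with $\eta_k<^2_{\ell x}\rho'$, $\eta_k<^2_{\ell x}\rho''$, $\mathrm{lg}(\rho')=\mathrm{lg}(\rho'')$ and $\mathrm{lg}(\eta_k\cap\rho')=\mathrm{lg}(\eta_k\cap\rho'')$, then $c(\langle\eta_1,\dots,\eta_k,\rho'\rangle)=c(\langle\eta_1,\dots,\eta_k,\rho''\rangle)$. For a cardinal $\kappa$: $\beth_0(\kappa)=\kappa$, $\beth_{\alpha+1}(\kappa)=2^{\beth_\alpha(\kappa)}$, and $\beth_\delta(\kappa)=\sup_{\alpha<\delta}\beth_\alpha(\kappa)$ for limit $\delta$. *)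

theory Defs
  imports Main "HOL-Library.FuncSet" "HOL-Library.Sublist"
begin

unbundle cardinal_syntax

section \<open>Trees of decreasing sequences\<close>

text \<open>
  Ordinals are the elements of a type \<open>'o\<close> of class \<^class>\<open>wellorder\<close>. No HOL type contains all
  ordinals, so a theorem has to say how long \<open>'o\<close> must be.
\<close>

definition ds :: "'o::wellorder list set" where
  "ds = {\<eta>. sorted_wrt (>) \<eta>}"

definition lex_below :: "'o::wellorder list \<Rightarrow> 'o list \<Rightarrow> bool" where
  "lex_below \<eta> \<nu> \<longleftrightarrow>
     (\<exists>l < min (length \<eta>) (length \<nu>). take l \<eta> = take l \<nu> \<and> \<eta> ! l < \<nu> ! l)"

definition lx1 :: "'o::wellorder list \<Rightarrow> 'o list \<Rightarrow> bool" where
  "lx1 \<eta> \<nu> \<longleftrightarrow> strict_prefix \<eta> \<nu> \<or> lex_below \<eta> \<nu>"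

definition lx2 :: "'o::wellorder list \<Rightarrow> 'o list \<Rightarrow> bool" where
  "lx2 \<eta> \<nu> \<longleftrightarrow> strict_prefix \<nu> \<eta> \<or> lex_below \<eta> \<nu>"

definition tree :: "'o::wellorder list set \<Rightarrow> bool" where
  "tree T \<longleftrightarrow> T \<noteq> {} \<and> T \<subseteq> ds \<and> (\<forall>\<eta>\<in>T. \<forall>\<nu>. prefix \<nu> \<eta> \<longrightarrow> \<nu> \<in> T)"

definition subtree :: "'o::wellorder list set \<Rightarrow> 'o list set \<Rightarrow> bool" where
  "subtree T' T \<longleftrightarrow> tree T' \<and> T' \<subseteq> T"

definition tree_embedding ::
    "('o::wellorder list \<Rightarrow> 'o list) \<Rightarrow> 'o list set \<Rightarrow> 'o list set \<Rightarrow> bool" where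
  "tree_embedding f T1 T2 \<longleftrightarrow>
     f \<in> T1 \<rightarrow> T2 \<and>
     (\<forall>\<eta>\<in>T1. length (f \<eta>) = length \<eta>) \<and>
     (\<forall>\<eta>\<in>T1. \<forall>\<nu>\<in>T1. strict_prefix \<eta> \<nu> \<longrightarrow> strict_prefix (f \<eta>) (f \<nu>)) \<and>
     (\<forall>\<eta>\<in>T1. \<forall>\<nu>\<in>T1. lx1 \<eta> \<nu> \<longrightarrow> lx1 (f \<eta>) (f \<nu>))"

definition tree_isomorphic :: "'o::wellorder list set \<Rightarrow> 'o list set \<Rightarrow> bool" where
  "tree_isomorphic T1 T2 \<longleftrightarrow> (\<exists>f. tree_embedding f T1 T2 \<and> f ` T1 = T2)"

text \<open>
  The list \<open>\<eta>s\<close> is the sequence \<open>\<eta>\<^sub>1, \<dots>, \<eta>\<^sub>k\<close> with \<open>k \<ge> 1\<close>; the colouring is applied to the finite set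
  whose increasing enumeration is the sequence in question.
\<close>

definition end_uniform :: "'o::wellorder list set \<Rightarrow> ('o list set \<Rightarrow> 'm) \<Rightarrow> bool" where
  "end_uniform T c \<longleftrightarrow>
     (\<forall>\<eta>s \<rho>' \<rho>''.
        \<eta>s \<noteq> [] \<and> set \<eta>s \<subseteq> T \<and> sorted_wrt lx2 \<eta>s \<and> \<rho>' \<in> T \<and> \<rho>'' \<in> T \<and>
        lx2 (last \<eta>s) \<rho>' \<and> lx2 (last \<eta>s) \<rho>'' \<and>
        length \<rho>' = length \<rho>'' \<and>
        length (longest_common_prefix (last \<eta>s) \<rho>') =
          length (longest_common_prefix (last \<eta>s) \<rho>'')
        \<longrightarrow> c (set (\<eta>s @ [\<rho>'])) = c (set (\<eta>s @ [\<rho>''])))"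

section \<open>The beth hierarchy\<close>

text \<open>
  Cardinals are well-orders satisfying \<^const>\<open>Card_order\<close>, taken up to \<open>=o\<close>, and the ordinal index is a
  well-order \<open>\<alpha>\<close>, in which \<open>i \<in> Field \<alpha>\<close> stands for the ordinal of \<open>underS \<alpha> i\<close>.
  Beth is a predicate and not a function because, for given \<open>\<kappa>\<close> and \<open>\<alpha>\<close>, HOL does not prove that some
  type carries a cardinal \<open>\<theta> = \<beth>\<^sub>\<alpha>(\<kappa>)\<close>.

  In \<open>beth_step \<kappa> \<alpha> b A \<theta>\<close> the set \<open>A\<close> is an initial segment of \<open>\<alpha>\<close> and \<open>b\<close> gives the values of beth at
  the elements of \<open>A\<close>; the three cases are zero, successor and limit.
\<close>

definition beth_step ::
    "'k rel \<Rightarrow> 'i rel \<Rightarrow> ('i \<Rightarrow> 'b rel) \<Rightarrow> 'i set \<Rightarrow> 'b rel \<Rightarrow> bool" where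
  "beth_step \<kappa> \<alpha> b A \<theta> \<longleftrightarrow>
     Card_order \<theta> \<and>
     (A = {} \<longrightarrow> \<theta> =o \<kappa>) \<and>
     (\<forall>m\<in>A. (\<forall>i\<in>A. (i, m) \<in> \<alpha>) \<longrightarrow> \<theta> =o ctwo ^c b m) \<and>
     (A \<noteq> {} \<and> \<not> (\<exists>m\<in>A. \<forall>i\<in>A. (i, m) \<in> \<alpha>) \<longrightarrow>
        (\<forall>i\<in>A. b i \<le>o \<theta>) \<and>
        (\<forall>\<chi> :: 'b rel. Card_order \<chi> \<and> (\<forall>i\<in>A. b i \<le>o \<chi>) \<longrightarrow> \<theta> \<le>o \<chi>))"

definition is_beth :: "'k rel \<Rightarrow> 'i rel \<Rightarrow> 'b rel \<Rightarrow> bool" where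
  "is_beth \<kappa> \<alpha> \<theta> \<longleftrightarrow>
     (\<exists>b :: 'i \<Rightarrow> 'b rel.
        (\<forall>i\<in>Field \<alpha>. beth_step \<kappa> \<alpha> b (underS \<alpha> i) (b i)) \<and>
        beth_step \<kappa> \<alpha> b (Field \<alpha>) \<theta>)"

lemma beth_step_unique:
  fixes \<theta> \<theta>' :: "'b rel"
  assumes "beth_step \<kappa> \<alpha> b A \<theta>" "beth_step \<kappa> \<alpha> b' A \<theta>'"
    and eq: "\<And>i. i \<in> A \<Longrightarrow> b i =o b' i"
    and card: "\<And>i. i \<in> A \<Longrightarrow> Card_order (b i)"
  shows "\<theta> =o \<theta>'"
proof -
  have co: "Card_order \<theta>" "Card_order \<theta>'"
    using assms(1,2) unfolding beth_step_def by simp_all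
  consider "A = {}" | m where "m \<in> A" "\<forall>i\<in>A. (i, m) \<in> \<alpha>"
    | "A \<noteq> {}" "\<not> (\<exists>m\<in>A. \<forall>i\<in>A. (i, m) \<in> \<alpha>)" by blast
  then show ?thesis
  proof cases
    case 1
    then have "\<theta> =o \<kappa>" "\<theta>' =o \<kappa>"
      using assms(1,2) unfolding beth_step_def by simp_all
    then show ?thesis by (meson ordIso_symmetric ordIso_transitive)
  next
    case 2
    then have a: "\<theta> =o ctwo ^c b m" "\<theta>' =o ctwo ^c b' m"
      using assms(1,2) unfolding beth_step_def by (elim conjE; blast)+
    have "ctwo ^c b m =o ctwo ^c b' m"
      using 2 by (intro cexp_cong2 eq card Card_order_ctwo)
    then show ?thesis using a by (meson ordIso_symmetric ordIso_transitive)
  next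
    case 3
    then have u: "\<forall>i\<in>A. b i \<le>o \<theta>" "\<forall>i\<in>A. b' i \<le>o \<theta>'"
      and l: "\<forall>\<chi> :: 'b rel. Card_order \<chi> \<and> (\<forall>i\<in>A. b i \<le>o \<chi>) \<longrightarrow> \<theta> \<le>o \<chi>"
             "\<forall>\<chi> :: 'b rel. Card_order \<chi> \<and> (\<forall>i\<in>A. b' i \<le>o \<chi>) \<longrightarrow> \<theta>' \<le>o \<chi>"
      using assms(1,2) unfolding beth_step_def by simp_all
    have "b i \<le>o \<theta>'" if "i \<in> A" for i
      using ordIso_ordLeq_trans[OF eq[OF that] u(2)[rule_format, OF that]] .
    then have "\<theta> \<le>o \<theta>'" using l(1) co(2) by simp
    have "b' i \<le>o \<theta>" if "i \<in> A" for i
      using ordIso_ordLeq_trans[OF ordIso_symmetric[OF eq[OF that]] u(1)[rule_format, OF that]] .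
    then have "\<theta>' \<le>o \<theta>" using l(2) co(1) by simp
    with \<open>\<theta> \<le>o \<theta>'\<close> show ?thesis by (simp add: ordIso_iff_ordLeq)
  qed
qed

lemma is_beth_unique:
  fixes \<theta> \<theta>' :: "'b rel"
  assumes wo: "Well_order \<alpha>" and "is_beth \<kappa> \<alpha> \<theta>" "is_beth \<kappa> \<alpha> \<theta>'"
  shows "\<theta> =o \<theta>'"
proof -
  obtain b where b: "\<And>i. i \<in> Field \<alpha> \<Longrightarrow> beth_step \<kappa> \<alpha> b (underS \<alpha> i) (b i)"
    "beth_step \<kappa> \<alpha> b (Field \<alpha>) \<theta>" using assms(2) unfolding is_beth_def by blast
  obtain b' where b': "\<And>i. i \<in> Field \<alpha> \<Longrightarrow> beth_step \<kappa> \<alpha> b' (underS \<alpha> i) (b' i)"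
    "beth_step \<kappa> \<alpha> b' (Field \<alpha>) \<theta>'" using assms(3) unfolding is_beth_def by blast
  have card: "Card_order (b i)" if "i \<in> Field \<alpha>" for i
    using b(1)[OF that] unfolding beth_step_def by (rule conjunct1)
  have sub: "j \<in> Field \<alpha>" if "j \<in> underS \<alpha> i" for i j
    using that by (auto simp: underS_def Field_def)
  have "wf (\<alpha> - Id)" using wo unfolding well_order_on_def by blast
  then have eq: "i \<in> Field \<alpha> \<longrightarrow> b i =o b' i" for i
  proof (induction i rule: wf_induct_rule)
    case (less i)
    show ?case
    proof
      assume i: "i \<in> Field \<alpha>"
      show "b i =o b' i"
      proof (rule beth_step_unique[OF b(1)[OF i] b'(1)[OF i]])
        fix j assume j: "j \<in> underS \<alpha> i"
        then have "(j, i) \<in> \<alpha> - Id" by (auto simp: underS_def)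
        then show "b j =o b' j" using less sub[OF j] by blast
        show "Card_order (b j)" using card sub[OF j] .
      qed
    qed
  qed
  show ?thesis by (rule beth_step_unique[OF b(2) b'(2)]) (use eq card in auto)
qed

end

theory Submission
  imports Defs
begin

text \<open>
A copy of \<open>S\<close> in \<open>T\<close> is given by an embedding \<open>f\<close>. Instead of the image of \<open>f\<close> one may look at \<open>S\<close>
itself, coloured by \<open>u \<mapsto> c (f ` u)\<close>: the image is end-uniform for \<open>c\<close> once \<open>S\<close> is end-uniform for this
pulled-back colouring (\<open>end_uniform_image\<close>). The tree \<open>S\<close> consists of its root, which is last in
\<open>lx2\<close>, and of the trees \<open>sub S i\<close> above the children \<open>[i]\<close>, which follow one another in the order of the
\<open>i\<close>. Hence \<open>S\<close> is end-uniform as soon as each \<open>sub S i\<close> is end-uniform over every finite set \<open>u\<close> of nodes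
to its left, and the colour of \<open>u\<close> together with one further node to its right depends only on the
level of that node (\<open>end_uniform_children\<close>). As \<open>S\<close> has no infinite branch, this allows a
construction by recursion on \<open>S\<close>.

Let \<open>S\<close> be infinite and \<open>\<kappa> = 2\<^bsup>|S| + \<mu>\<^esup>\<close>. The tree \<open>T\<close> is the tree \<open>ds_below z\<close> of all decreasing
sequences of ordinals below some \<open>z\<close>. Two ingredients make up one step of the recursion. The first
is a theorem of Komjath and Shelah (\<open>ex_level_uniform\<close>): for every \<open>v\<close> there is a \<open>w\<close> such that each
colouring of the nodes of \<open>ds_below w\<close> with few colours depends only on the level on some copy of
\<open>ds_below v\<close>. The second is the argument of Erdos and Rado for end-homogeneous sets
(\<open>arrows_step\<close>). The trees \<open>sub S i\<close> are placed one after another above ordinals \<open>j\<^sub>i < z\<close>. What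
matters about a new one is its type over what has been placed, that is, a function with few
possible values; so there are few histories altogether, and some \<open>j < z\<close> is to the right of all of
them. The tree above \<open>j\<close> is thinned so that its type over all histories depends only on
the level. Now follow the history that always realises the type of the tree above \<open>j\<close>. It never
gets stuck, because that tree is itself a candidate at each stage, and everything that is
placed later has the same type over what was placed earlier.

Each step costs finitely many exponentiations. There are at most \<open>|S|\<close> children at
each node and \<open>|S|\<^sup>+\<close> is regular, so for each node of \<open>S\<close> the construction stays below some \<open>\<beth>\<^sub>\<gamma>\<close> with
\<open>\<gamma> < |S|\<^sup>+\<close> (\<open>uniform_copy_infinite\<close>).

If \<open>S\<close> has \<open>n\<close> nodes with \<open>n\<close> finite, the hierarchy ends after \<open>n + 1\<close> exponentiations and \<open>\<theta>\<close> may be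
finite, so sizes have to be counted. For \<open>n \<le> 2\<close> no two nodes of \<open>S\<close> have the same level and \<open>T = S\<close>
works. For \<open>n \<ge> 3\<close> take a tree of height \<open>n\<close> in which all nodes have large sets of children. The
children of \<open>S\<close> are treated one at a time: one child of the tree receives the copy of \<open>sub S i\<close>, and
the pigeonhole principle thins all that is to the right of it to a subtree with level-uniform types
over the nodes chosen so far (\<open>full_thin\<close>, \<open>finite_arrows\<close>). At most \<open>n\<close> such thinnings occur,
and a tree smaller than \<open>2\<close> to the \<open>2\<close> to the \<open>2\<close> to the \<open>2\<close> to the \<open>n + \<mu>\<close> suffices
(\<open>block_size_bound\<close>, \<open>uniform_copy_finite\<close>).
\<close>

section \<open>Decreasing sequences and tree embeddings\<close>

definition sub :: "'a list set \<Rightarrow> 'a \<Rightarrow> 'a list set" where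
  "sub S i = {\<nu>. i # \<nu> \<in> S}"

definition glue :: "('a \<Rightarrow> 'b) \<Rightarrow> ('a \<Rightarrow> 'a list \<Rightarrow> 'b list) \<Rightarrow> 'a list \<Rightarrow> 'b list" where
  "glue j f \<eta> = (case \<eta> of [] \<Rightarrow> [] | i # \<nu> \<Rightarrow> j i # f i \<nu>)"

definition nodes_below :: "'o::wellorder list set \<Rightarrow> 'o \<Rightarrow> 'o list set" where
  "nodes_below S i = {\<eta> \<in> S. \<eta> \<noteq> [] \<and> hd \<eta> < i}"

lemma glue_simps [simp]: "glue j f [] = []" "glue j f (i # \<nu>) = j i # f i \<nu>"
  by (simp_all add: glue_def)

lemma mem_sub [simp]: "\<nu> \<in> sub S i \<longleftrightarrow> i # \<nu> \<in> S"
  by (simp add: sub_def)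

lemma lex_below_Cons [simp]:
  "lex_below (a # \<eta>) (b # \<nu>) \<longleftrightarrow> a < b \<or> a = b \<and> lex_below \<eta> \<nu>"
proof
  assume "lex_below (a # \<eta>) (b # \<nu>)"
  then obtain l where "l < min (length (a # \<eta>)) (length (b # \<nu>))"
    "take l (a # \<eta>) = take l (b # \<nu>)" "(a # \<eta>) ! l < (b # \<nu>) ! l"
    unfolding lex_below_def by blast
  then show "a < b \<or> a = b \<and> lex_below \<eta> \<nu>"
    unfolding lex_below_def by (cases l) auto
next
  assume "a < b \<or> a = b \<and> lex_below \<eta> \<nu>"
  then show "lex_below (a # \<eta>) (b # \<nu>)"
  proof
    assume "a = b \<and> lex_below \<eta> \<nu>"
    then obtain l where "l < min (length \<eta>) (length \<nu>)" "take l \<eta> = take l \<nu>" "\<eta> ! l < \<nu> ! l" "a = b"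
      unfolding lex_below_def by blast
    then show ?thesis unfolding lex_below_def by (intro exI[of _ "Suc l"]) auto
  qed (auto simp: lex_below_def intro: exI[of _ 0])
qed

lemma lex_below_Nil [simp]: "\<not> lex_below [] \<nu>" "\<not> lex_below \<eta> []"
  by (simp_all add: lex_below_def)

lemma lx1_simps [simp]:
  "lx1 [] \<nu> \<longleftrightarrow> \<nu> \<noteq> []" "\<not> lx1 \<eta> []"
  "lx1 (a # \<eta>) (b # \<nu>) \<longleftrightarrow> a < b \<or> a = b \<and> lx1 \<eta> \<nu>"
  by (auto simp: lx1_def strict_prefix_def)

lemma lx2_simps [simp]:
  "\<not> lx2 [] \<nu>" "lx2 \<eta> [] \<longleftrightarrow> \<eta> \<noteq> []"
  "lx2 (a # \<eta>) (b # \<nu>) \<longleftrightarrow> a < b \<or> a = b \<and> lx2 \<eta> \<nu>"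
  by (auto simp: lx2_def strict_prefix_def)

lemma ds_Nil [simp]: "[] \<in> ds"
  by (simp add: ds_def)

lemma ds_Cons: "a # \<nu> \<in> ds \<longleftrightarrow> \<nu> \<in> ds \<and> (\<forall>x\<in>set \<nu>. x < a)"
  by (auto simp: ds_def)

lemma ds_append: "\<eta> @ \<nu> \<in> ds \<Longrightarrow> \<eta> \<in> ds \<and> \<nu> \<in> ds"
  by (simp add: ds_def sorted_wrt_append)

lemma tree_Nil: "tree S \<Longrightarrow> [] \<in> S"
  unfolding tree_def by auto

lemma tree_prefix: "tree S \<Longrightarrow> \<eta> \<in> S \<Longrightarrow> prefix \<nu> \<eta> \<Longrightarrow> \<nu> \<in> S"
  unfolding tree_def by blast

lemma tree_root: "tree S \<Longrightarrow> i # \<nu> \<in> S \<Longrightarrow> [i] \<in> S"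
  by (rule tree_prefix) auto

lemma tree_sub:
  assumes "tree S" "[i] \<in> S"
  shows "tree (sub S i)"
  unfolding tree_def
proof (intro conjI ballI allI impI)
  show "sub S i \<noteq> {}" using assms(2) by (auto simp: sub_def)
  show "sub S i \<subseteq> ds"
  proof
    fix \<nu> assume "\<nu> \<in> sub S i"
    then have "i # \<nu> \<in> ds" using assms(1) unfolding tree_def by auto
    then show "\<nu> \<in> ds" by (simp add: ds_Cons)
  qed
  fix \<eta> \<nu> assume "\<eta> \<in> sub S i" "prefix \<nu> \<eta>"
  then show "\<nu> \<in> sub S i" using tree_prefix[OF assms(1), of "i # \<eta>" "i # \<nu>"] by simp
qed

lemma sub_root_less:
  assumes "tree S" "[i'] \<in> sub S i"
  shows "i' < i"
proof -
  have "[i, i'] \<in> ds" using assms unfolding tree_def by auto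
  then show ?thesis by (simp add: ds_Cons)
qed

lemma tree_embedding_mem: "tree_embedding f S T \<Longrightarrow> \<eta> \<in> S \<Longrightarrow> f \<eta> \<in> T"
  unfolding tree_embedding_def by auto

lemma tree_embedding_length: "tree_embedding f S T \<Longrightarrow> \<eta> \<in> S \<Longrightarrow> length (f \<eta>) = length \<eta>"
  unfolding tree_embedding_def by auto

lemma tree_embedding_mono: "tree_embedding f S T \<Longrightarrow> T \<subseteq> T' \<Longrightarrow> tree_embedding f S T'"
  unfolding tree_embedding_def by auto

lemma tree_embedding_comp:
  assumes "tree_embedding f S T" "tree_embedding g T U"
  shows "tree_embedding (g \<circ> f) S U"
  using assms unfolding tree_embedding_def by (auto simp: Pi_iff)

text \<open>
Trees are mapped child by child: \<open>j\<close> moves the children of the root and \<open>f i\<close> embeds what is above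
the child \<open>[i]\<close>. Monotonicity of \<open>j\<close> takes care of the order between different children.
\<close>

lemma tree_embedding_glue:
  assumes S: "tree S" and Nil: "[] \<in> T"
    and j: "strict_mono_on {i. [i] \<in> S} j"
    and f: "\<And>i. [i] \<in> S \<Longrightarrow> tree_embedding (f i) (sub S i) (sub T (j i))"
  shows "tree_embedding (glue j f) S T"
proof -
  have root: "[i] \<in> S" if "i # \<nu> \<in> S" for i \<nu> using tree_root[OF S that] .
  have mem: "glue j f \<eta> \<in> T" if "\<eta> \<in> S" for \<eta>
    using that Nil tree_embedding_mem[OF f[OF root]] by (cases \<eta>) auto
  have len: "length (glue j f \<eta>) = length \<eta>" if "\<eta> \<in> S" for \<eta>
    using that tree_embedding_length[OF f[OF root]] by (cases \<eta>) auto
  have pre: "strict_prefix (glue j f \<eta>) (glue j f \<nu>)" if "\<eta> \<in> S" "\<nu> \<in> S" "strict_prefix \<eta> \<nu>" for \<eta> \<nu>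
  proof (cases \<eta>)
    case Nil then show ?thesis using that by (cases \<nu>) auto
  next
    case (Cons i \<eta>')
    with that obtain \<nu>' where \<nu>: "\<nu> = i # \<nu>'" "strict_prefix \<eta>' \<nu>'" by (cases \<nu>) auto
    have "strict_prefix (f i \<eta>') (f i \<nu>')"
      using f[OF root] that Cons \<nu> unfolding tree_embedding_def by auto
    then show ?thesis using Cons \<nu> by simp
  qed
  have lx: "lx1 (glue j f \<eta>) (glue j f \<nu>)" if "\<eta> \<in> S" "\<nu> \<in> S" "lx1 \<eta> \<nu>" for \<eta> \<nu>
  proof (cases \<eta>)
    case Nil then show ?thesis using that by (cases \<nu>) auto
  next
    case (Cons i \<eta>')
    with that obtain i' \<nu>' where \<nu>: "\<nu> = i' # \<nu>'" by (cases \<nu>) auto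
    then have "i < i' \<or> i = i' \<and> lx1 \<eta>' \<nu>'" using that Cons by simp
    then consider "i < i'" | "i = i'" "lx1 \<eta>' \<nu>'" by blast
    then show ?thesis
    proof cases
      case 1
      then have "j i < j i'" using j root that Cons \<nu> unfolding strict_mono_on_def by auto
      then show ?thesis using Cons \<nu> by simp
    next
      case 2
      have "lx1 (f i \<eta>') (f i \<nu>')"
        using f[OF root] that Cons \<nu> 2 unfolding tree_embedding_def by auto
      then show ?thesis using Cons \<nu> 2 by simp
    qed
  qed
  show ?thesis unfolding tree_embedding_def using mem len pre lx by auto
qed

lemma lx2_irrefl [simp]: "\<not> lx2 \<eta> \<eta>"
  by (induction \<eta>) auto

lemma lx2_linear: "\<eta> \<noteq> \<nu> \<Longrightarrow> lx2 \<eta> \<nu> \<or> lx2 \<nu> \<eta>"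
proof (induction \<eta> arbitrary: \<nu>)
  case (Cons a \<eta>)
  then show ?case by (cases \<nu>) (auto simp: neq_iff)
qed auto

lemma lx2_asym: "lx2 \<eta> \<nu> \<Longrightarrow> \<not> lx2 \<nu> \<eta>"
proof (induction \<eta> arbitrary: \<nu>)
  case (Cons a \<eta>)
  then show ?case by (cases \<nu>) auto
qed simp

lemma tree_embedding_take:
  assumes f: "tree_embedding f S T" and S: "tree S" and \<eta>: "\<eta> \<in> S"
  shows "f (take l \<eta>) = take l (f \<eta>)"
proof (cases "l < length \<eta>")
  case True
  then have "strict_prefix (take l \<eta>) \<eta>" by (auto simp: strict_prefix_def take_is_prefix)
  moreover have m: "take l \<eta> \<in> S" using tree_prefix[OF S \<eta>] take_is_prefix by blast
  ultimately have "strict_prefix (f (take l \<eta>)) (f \<eta>)"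
    using f \<eta> unfolding tree_embedding_def by blast
  moreover have "length (f (take l \<eta>)) = l" using tree_embedding_length[OF f m] True by simp
  ultimately show ?thesis by (metis append_eq_conv_conj prefixE strict_prefix_def)
next
  case False
  then show ?thesis using tree_embedding_length[OF f \<eta>] by simp
qed

lemma tree_embedding_inj:
  assumes f: "tree_embedding f S T"
  shows "inj_on f S"
proof (rule inj_onI, rule ccontr)
  fix \<eta> \<nu> assume "\<eta> \<in> S" "\<nu> \<in> S" "f \<eta> = f \<nu>" "\<eta> \<noteq> \<nu>"
  have irr: "\<not> lx1 \<xi> \<xi>" for \<xi> :: "'a list" by (induction \<xi>) auto
  have "lx1 \<eta> \<nu> \<or> lx1 \<nu> \<eta>" if "\<eta> \<noteq> \<nu>" for \<eta> \<nu> :: "'a list"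
    using that
  proof (induction \<eta> arbitrary: \<nu>)
    case (Cons a \<eta>)
    then show ?case by (cases \<nu>) (auto simp: neq_iff)
  qed auto
  then show False using f \<open>\<eta> \<in> S\<close> \<open>\<nu> \<in> S\<close> \<open>f \<eta> = f \<nu>\<close> \<open>\<eta> \<noteq> \<nu>\<close> irr
    unfolding tree_embedding_def by metis
qed

text \<open>
An embedding commutes with initial segments and is injective, so it preserves the level at which
two nodes separate.
\<close>

lemma tree_embedding_lcp:
  assumes f: "tree_embedding f S T" and S: "tree S" and "\<eta> \<in> S" "\<nu> \<in> S"
  shows "length (longest_common_prefix (f \<eta>) (f \<nu>)) = length (longest_common_prefix \<eta> \<nu>)"
proof -
  have eq: "l \<le> length (longest_common_prefix \<eta> \<nu>) \<longleftrightarrow>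
      l \<le> length \<eta> \<and> l \<le> length \<nu> \<and> take l \<eta> = take l \<nu>" for l and \<eta> \<nu> :: "'a list"
    by (induction \<eta> \<nu> arbitrary: l rule: longest_common_prefix.induct)
      (auto simp: take_Cons split: nat.splits)
  have "take l \<eta> \<in> S" "take l \<nu> \<in> S" for l
    using tree_prefix[OF S] take_is_prefix assms(3,4) by blast+
  then have "take l (f \<eta>) = take l (f \<nu>) \<longleftrightarrow> take l \<eta> = take l \<nu>" for l
    using tree_embedding_take[OF f S] assms(3,4) tree_embedding_inj[OF f] by (metis inj_on_def)
  then have "l \<le> length (longest_common_prefix (f \<eta>) (f \<nu>)) \<longleftrightarrow> l \<le> length (longest_common_prefix \<eta> \<nu>)" for l
    unfolding eq using tree_embedding_length[OF f] assms(3,4) by simp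
  then show ?thesis by (meson order_antisym order_refl)
qed

text \<open>
Embeddings are required to preserve \<open>lx1\<close>. The orders \<open>lx1\<close> and \<open>lx2\<close> differ only in how they place a
proper initial segment, and embeddings neither destroy nor create this relation.
\<close>

lemma tree_embedding_lx2:
  assumes f: "tree_embedding f S T" and S: "tree S" and "\<eta> \<in> S" "\<nu> \<in> S" "lx2 \<eta> \<nu>"
  shows "lx2 (f \<eta>) (f \<nu>)"
proof -
  consider "strict_prefix \<nu> \<eta>" | "\<not> strict_prefix \<nu> \<eta>" "lex_below \<eta> \<nu>" using assms(5) unfolding lx2_def by auto
  then show ?thesis
  proof cases
    case 1
    then show ?thesis using assms unfolding tree_embedding_def lx2_def by blast
  next
    case 2
    then have 1: "lx1 \<eta> \<nu>" by (simp add: lx1_def)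
    have neq: "\<not> strict_prefix \<eta> \<nu>"
      using 2(2) unfolding lex_below_def strict_prefix_def prefix_def by (auto simp: nth_append)
    have "lx1 (f \<eta>) (f \<nu>)" using f assms(3,4) 1 unfolding tree_embedding_def by blast
    moreover have "\<not> strict_prefix (f \<eta>) (f \<nu>)"
    proof
      assume "strict_prefix (f \<eta>) (f \<nu>)"
      then have "f \<eta> = take (length \<eta>) (f \<nu>)"
        using tree_embedding_length[OF f assms(3)] by (metis append_eq_conv_conj prefixE strict_prefix_def)
      also have "\<dots> = f (take (length \<eta>) \<nu>)" using tree_embedding_take[OF f S assms(4)] by simp
      finally have "\<eta> = take (length \<eta>) \<nu>"
        using tree_embedding_inj[OF f] assms(3) tree_prefix[OF S assms(4) take_is_prefix]
        by (meson inj_onD)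
      then have "prefix \<eta> \<nu>" by (metis take_is_prefix)
      then show False using neq assms(5) by (auto simp: strict_prefix_def)
    qed
    ultimately show ?thesis unfolding lx1_def lx2_def by blast
  qed
qed


lemma tree_embedding_image_tree:
  assumes f: "tree_embedding f S T" and S: "tree S" and T: "T \<subseteq> ds"
  shows "tree (f ` S)"
  unfolding tree_def
proof (intro conjI ballI allI impI)
  show "f ` S \<noteq> {}" using tree_Nil[OF S] by blast
  show "f ` S \<subseteq> ds" using tree_embedding_mem[OF f] T by blast
  fix \<xi> \<nu> assume "\<xi> \<in> f ` S" "prefix \<nu> \<xi>"
  then obtain \<eta> where \<eta>: "\<eta> \<in> S" "\<xi> = f \<eta>" by blast
  have "\<nu> = take (length \<nu>) (f \<eta>)" using \<open>prefix \<nu> \<xi>\<close> \<eta> by (metis append_eq_conv_conj prefixE)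
  also have "\<dots> = f (take (length \<nu>) \<eta>)" using tree_embedding_take[OF f S \<eta>(1)] by simp
  finally show "\<nu> \<in> f ` S" using tree_prefix[OF S \<eta>(1) take_is_prefix] by blast
qed

section \<open>End-uniformity\<close>

lemma end_uniformD:
  assumes "end_uniform T c" "\<eta>s \<noteq> []" "set \<eta>s \<subseteq> T" "sorted_wrt lx2 \<eta>s" "\<rho>' \<in> T" "\<rho>'' \<in> T"
    "lx2 (last \<eta>s) \<rho>'" "lx2 (last \<eta>s) \<rho>''" "length \<rho>' = length \<rho>''"
    "length (longest_common_prefix (last \<eta>s) \<rho>') = length (longest_common_prefix (last \<eta>s) \<rho>'')"
  shows "c (insert \<rho>' (set \<eta>s)) = c (insert \<rho>'' (set \<eta>s))"
proof -
  have "c (set (\<eta>s @ [\<rho>'])) = c (set (\<eta>s @ [\<rho>'']))"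
    using assms unfolding end_uniform_def by blast
  then show ?thesis by simp
qed

text \<open>
This reduces the search for an end-uniform subtree to the search for an embedding \<open>f\<close> with a
property of the fixed tree \<open>S\<close>. It needs that \<open>f\<close> also reflects \<open>lx2\<close>, which holds because \<open>lx2\<close> is
linear.
\<close>

lemma end_uniform_image:
  assumes f: "tree_embedding f S T" and S: "tree S" and c: "end_uniform S (\<lambda>u. c (f ` u))"
  shows "end_uniform (f ` S) c"
  unfolding end_uniform_def
proof (intro allI impI, elim conjE)
  fix \<xi>s \<sigma>' \<sigma>''
  assume ne: "\<xi>s \<noteq> []" and sub: "set \<xi>s \<subseteq> f ` S" and sorted: "sorted_wrt lx2 \<xi>s"
    and "\<sigma>' \<in> f ` S" "\<sigma>'' \<in> f ` S" and lx: "lx2 (last \<xi>s) \<sigma>'" "lx2 (last \<xi>s) \<sigma>''"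
    and len: "length \<sigma>' = length \<sigma>''"
    and lcp: "length (longest_common_prefix (last \<xi>s) \<sigma>') = length (longest_common_prefix (last \<xi>s) \<sigma>'')"
  obtain \<rho>' \<rho>'' where \<rho>: "\<rho>' \<in> S" "\<rho>'' \<in> S" "\<sigma>' = f \<rho>'" "\<sigma>'' = f \<rho>''"
    using \<open>\<sigma>' \<in> f ` S\<close> \<open>\<sigma>'' \<in> f ` S\<close> by blast
  obtain \<eta>s where \<eta>s: "set \<eta>s \<subseteq> S" "\<xi>s = map f \<eta>s"
  proof -

    have "\<xi>s \<in> map f ` lists S" using sub unfolding lists_image[symmetric] by (auto simp: in_lists_conv_set)
    then show ?thesis using that by (auto simp: in_lists_conv_set)
  qed
  have reflect: "lx2 \<eta> \<nu>" if "\<eta> \<in> S" "\<nu> \<in> S" "lx2 (f \<eta>) (f \<nu>)" for \<eta> \<nu>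
    using lx2_linear[of \<eta> \<nu>] lx2_asym[OF that(3)] tree_embedding_lx2[OF f S] that lx2_irrefl by metis
  have ne': "\<eta>s \<noteq> []" using ne \<eta>s by simp
  then have last: "last \<eta>s \<in> S" "last \<xi>s = f (last \<eta>s)" using \<eta>s by (auto simp: last_map)
  have "sorted_wrt (\<lambda>x y. lx2 (f x) (f y)) \<eta>s" using sorted \<eta>s by (simp add: sorted_wrt_map)
  then have "sorted_wrt lx2 \<eta>s"
    by (rule sorted_wrt_mono_rel[rotated]) (use reflect \<eta>s in auto)
  then have "c (f ` insert \<rho>' (set \<eta>s)) = c (f ` insert \<rho>'' (set \<eta>s))"
  proof (intro end_uniformD[OF c ne'] \<eta>s \<rho>)
    show "lx2 (last \<eta>s) \<rho>'" "lx2 (last \<eta>s) \<rho>''" using reflect lx \<rho> last by simp_all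
    show "length \<rho>' = length \<rho>''" using len tree_embedding_length[OF f] \<rho> by simp
    show "length (longest_common_prefix (last \<eta>s) \<rho>') = length (longest_common_prefix (last \<eta>s) \<rho>'')"
      using lcp tree_embedding_lcp[OF f S] \<rho> last by simp
  qed
  then show "c (set (\<xi>s @ [\<sigma>'])) = c (set (\<xi>s @ [\<sigma>'']))" using \<rho> \<eta>s by simp
qed

text \<open>
Let \<open>\<eta> = i # \<nu>\<close> be the last entry of the given increasing sequence. A later node either is the root,
which is alone on its level, or belongs to the child \<open>i\<close>, or to a child beyond \<open>i\<close>; the length of the
common initial segment with \<open>\<eta>\<close> tells the last two apart. In the second case the part of the
sequence outside child \<open>i\<close> serves as \<open>u\<close> in \<open>within\<close>; in the third case the whole sequence serves as \<open>u\<close>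
in \<open>across\<close>.
\<close>

lemma end_uniform_children:
  assumes S: "tree S"
    and within: "\<And>i u. [i] \<in> S \<Longrightarrow> u \<in> Fpow (nodes_below S i) \<Longrightarrow>
      end_uniform (sub S i) (\<lambda>x. c (u \<union> (#) i ` x))"
    and across: "\<And>i i' \<nu> \<nu>' u. i # \<nu> \<in> S \<Longrightarrow> i' # \<nu>' \<in> S \<Longrightarrow> length \<nu> = length \<nu>' \<Longrightarrow>
      u \<noteq> {} \<Longrightarrow> u \<in> Fpow (nodes_below S i) \<Longrightarrow> u \<in> Fpow (nodes_below S i') \<Longrightarrow>
      c (insert (i # \<nu>) u) = c (insert (i' # \<nu>') u)"
  shows "end_uniform S c"
  unfolding end_uniform_def
proof (intro allI impI, elim conjE)
  fix \<eta>s \<rho>' \<rho>''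
  assume ne: "\<eta>s \<noteq> []" and sub: "set \<eta>s \<subseteq> S" and sorted: "sorted_wrt lx2 \<eta>s"
    and \<rho>: "\<rho>' \<in> S" "\<rho>'' \<in> S" and lx: "lx2 (last \<eta>s) \<rho>'" "lx2 (last \<eta>s) \<rho>''"
    and len: "length \<rho>' = length \<rho>''"
    and lcp: "length (longest_common_prefix (last \<eta>s) \<rho>') = length (longest_common_prefix (last \<eta>s) \<rho>'')"
  obtain \<xi>s \<eta> where \<eta>s: "\<eta>s = \<xi>s @ [\<eta>]" using ne by (metis rev_exhaust)
  then obtain i \<nu> where \<eta>: "\<eta> = i # \<nu>" using lx by (cases \<eta>) auto
  have le: "\<xi> \<noteq> [] \<and> hd \<xi> \<le> i" if "\<xi> \<in> set \<eta>s" for \<xi>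
  proof -
    have "\<xi> = \<eta> \<or> lx2 \<xi> \<eta>" using that sorted unfolding \<eta>s sorted_wrt_append by auto
    then show ?thesis unfolding \<eta> by (cases \<xi>) auto
  qed
  show "c (set (\<eta>s @ [\<rho>'])) = c (set (\<eta>s @ [\<rho>'']))"
  proof (cases \<rho>')
    case Nil
    then show ?thesis using len by simp
  next
    case (Cons i' \<nu>')
    then obtain i'' \<nu>'' where c'': "\<rho>'' = i'' # \<nu>''" using len by (cases \<rho>'') auto
    have ge: "i \<le> i'" "i \<le> i''" using lx \<eta>s \<eta> Cons c'' by auto
    have iff: "i' = i \<longleftrightarrow> i'' = i" using lcp \<eta>s \<eta> Cons c'' by (auto split: if_splits)
    show ?thesis
    proof (cases "i' = i")
      case False
      have "set \<eta>s \<in> Fpow (nodes_below S k)" if "i < k" for k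
        using le sub that unfolding nodes_below_def Fpow_def by force
      then show ?thesis using across[of i' \<nu>' i'' \<nu>'' "set \<eta>s"] ne False iff ge \<rho> Cons c'' len
        by (simp add: order.strict_iff_order)
    next
      case True
      define \<nu>s where "\<nu>s = map tl (filter (\<lambda>\<xi>. hd \<xi> = i) \<eta>s)"
      define u where "u = set \<eta>s \<inter> nodes_below S i"
      have u: "u \<in> Fpow (nodes_below S i)" unfolding u_def Fpow_def by auto
      have "\<xi> \<in> u \<union> (#) i ` set \<nu>s" if "\<xi> \<in> set \<eta>s" for \<xi>
      proof (cases "hd \<xi> = i")
        case True
        then have "\<xi> = i # tl \<xi>" "tl \<xi> \<in> set \<nu>s" using le[OF that] that by (auto simp: \<nu>s_def)
        then show ?thesis by (metis UnI2 image_eqI)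
      next
        case False
        then show ?thesis using that le[OF that] sub by (auto simp: u_def nodes_below_def)
      qed
      moreover have mem: "i # \<xi> \<in> set \<eta>s" if "\<xi> \<in> set \<nu>s" for \<xi>
      proof -
        obtain \<zeta> where \<zeta>: "\<zeta> \<in> set \<eta>s" "hd \<zeta> = i" "\<xi> = tl \<zeta>"
          using \<open>\<xi> \<in> set \<nu>s\<close> unfolding \<nu>s_def set_map set_filter by blast
        then show ?thesis using le[OF \<zeta>(1)] by (cases \<zeta>) auto
      qed
      ultimately have set: "set \<eta>s = u \<union> (#) i ` set \<nu>s" unfolding u_def by blast
      have \<nu>s: "\<nu>s \<noteq> []" "last \<nu>s = \<nu>" by (simp_all add: \<nu>s_def \<eta>s \<eta>)
      have root: "[i] \<in> S" using tree_root[OF S] \<rho>(1) Cons True by blast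
      have "sorted_wrt lx2 (filter (\<lambda>\<xi>. hd \<xi> = i) \<eta>s)" using sorted by (rule sorted_wrt_filter)
      then have "sorted_wrt (\<lambda>x y. lx2 (tl x) (tl y)) (filter (\<lambda>\<xi>. hd \<xi> = i) \<eta>s)"
      proof (rule sorted_wrt_mono_rel[rotated])
        fix x y assume "x \<in> set (filter (\<lambda>\<xi>. hd \<xi> = i) \<eta>s)" "y \<in> set (filter (\<lambda>\<xi>. hd \<xi> = i) \<eta>s)" "lx2 x y"
        moreover have "z = i # tl z" if "z \<in> set (filter (\<lambda>\<xi>. hd \<xi> = i) \<eta>s)" for z
        proof -
          have "z \<in> set \<eta>s" "hd z = i" using that unfolding set_filter by blast+
          then show ?thesis using le[of z] by (cases z) auto
        qed
        ultimately show "lx2 (tl x) (tl y)" using lx2_simps(3)[of i "tl x" i "tl y"] by simp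
      qed
      then have sorted\<nu>: "sorted_wrt lx2 \<nu>s" by (simp add: \<nu>s_def sorted_wrt_map)
      have "c (u \<union> (#) i ` insert \<nu>' (set \<nu>s)) = c (u \<union> (#) i ` insert \<nu>'' (set \<nu>s))"
      proof (rule end_uniformD[OF within[OF root u] \<nu>s(1)])
        show "sorted_wrt lx2 \<nu>s" by (rule sorted\<nu>)
        show "set \<nu>s \<subseteq> sub S i" using subsetD[OF sub mem] by auto
        show "\<nu>' \<in> sub S i" "\<nu>'' \<in> sub S i" using \<rho> Cons c'' True iff by simp_all
        show "lx2 (last \<nu>s) \<nu>'" "lx2 (last \<nu>s) \<nu>''"
          using lx Cons c'' True iff \<nu>s(2) \<eta>s \<eta> by simp_all
        show "length \<nu>' = length \<nu>''" using len Cons c'' by simp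
        show "length (longest_common_prefix (last \<nu>s) \<nu>') = length (longest_common_prefix (last \<nu>s) \<nu>'')"
          using lcp Cons c'' True iff \<nu>s(2) \<eta>s \<eta> by simp
      qed
      then show ?thesis using Cons c'' True iff by (simp add: set)
    qed
  qed
qed

lemma end_uniform_trivial:
  assumes "\<And>\<rho>' \<rho>''. \<rho>' \<in> S \<Longrightarrow> \<rho>'' \<in> S \<Longrightarrow> length \<rho>' = length \<rho>'' \<Longrightarrow> \<rho>' = \<rho>''"
  shows "end_uniform S c"
  unfolding end_uniform_def using assms by blast

section \<open>Cardinal bounds\<close>

lemma Pow_cexp_ctwo: "|Pow A| =o ctwo ^c |A|"
  unfolding ctwo_def cexp_def Field_card_of by (rule card_of_Pow_Func)

lemma card_of_Pow_ordLeq: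
  assumes "|A| \<le>o \<beta>" and "Card_order \<beta>"
  shows "|Pow A| \<le>o ctwo ^c \<beta>"
proof -
  have \<beta>: "|Field \<beta>| =o \<beta>" by (rule card_of_Field_ordIso[OF assms(2)])
  have "|A| \<le>o |Field \<beta>|" by (rule ordLeq_ordIso_trans[OF assms(1) ordIso_symmetric[OF \<beta>]])
  then obtain f where f: "inj_on f A" "f ` A \<subseteq> Field \<beta>"
    unfolding card_of_ordLeq[symmetric] by blast
  then have "inj_on ((`) f) (Pow A)" by (simp add: inj_on_image_Pow)
  then have "|Pow A| \<le>o |Pow (Field \<beta>)|" by (rule card_of_ordLeqI) (use f(2) in auto)
  also have "|Pow (Field \<beta>)| =o ctwo ^c |Field \<beta>|" by (rule Pow_cexp_ctwo)
  also have "ctwo ^c |Field \<beta>| =o ctwo ^c \<beta>"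
    by (rule cexp_cong2[OF \<beta> Card_order_ctwo card_of_Card_order])
  finally show ?thesis .
qed

lemma ordLeq_ctwo_cexp: "Card_order \<beta> \<Longrightarrow> \<beta> \<le>o ctwo ^c \<beta>"
  using ordLess_ctwo_cexp ordLess_imp_ordLeq by blast

lemma Cinfinite_ctwo_cexp: "Cinfinite \<beta> \<Longrightarrow> Cinfinite (ctwo ^c \<beta>)"
  by (rule Cinfinite_cexp) (simp_all add: ordLeq_refl Card_order_ctwo)

lemma card_of_Times_ordLeq:
  "Cinfinite \<beta> \<Longrightarrow> |A| \<le>o \<beta> \<Longrightarrow> |B| \<le>o \<beta> \<Longrightarrow> |A \<times> B| \<le>o \<beta>"
  by (rule card_of_Times_ordLeq_infinite_Field) (auto simp: cinfinite_def)

lemma card_of_extensional_ordLeq: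
  fixes A :: "'a set" and B :: "'b set"
  assumes \<beta>: "Cinfinite \<beta>" and A: "|A| \<le>o \<beta>" and B: "|B| \<le>o \<beta>"
  shows "|A \<rightarrow>\<^sub>E B| \<le>o ctwo ^c \<beta>"
proof -
  define G where "G f = {(x, f x) | x. x \<in> A}" for f :: "'a \<Rightarrow> 'b"
  have "inj_on G (A \<rightarrow>\<^sub>E B)"
  proof (rule inj_onI, rule ext)
    fix f g x assume fg: "f \<in> A \<rightarrow>\<^sub>E B" "g \<in> A \<rightarrow>\<^sub>E B" "G f = G g"
    show "f x = g x"
    proof (cases "x \<in> A")
      case True
      then have "(x, f x) \<in> G g" using fg(3) unfolding G_def by blast
      then show ?thesis unfolding G_def by blast
    qed (use fg in \<open>auto simp: PiE_def extensional_def\<close>)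
  qed
  moreover have "G ` (A \<rightarrow>\<^sub>E B) \<subseteq> Pow (A \<times> B)" unfolding G_def by auto
  ultimately have "|A \<rightarrow>\<^sub>E B| \<le>o |Pow (A \<times> B)|" by (intro card_of_ordLeqI[of G]) auto
  also have "|Pow (A \<times> B)| \<le>o ctwo ^c \<beta>"
    using card_of_Pow_ordLeq card_of_Times_ordLeq[OF \<beta> A B] \<beta> by blast
  finally show ?thesis .
qed

lemma card_of_Fpow_ordLeq:
  assumes "|A| \<le>o \<beta>" and "Card_order \<beta>"
  shows "|Fpow A| \<le>o ctwo ^c \<beta>"
proof -
  have "|Fpow A| \<le>o |Pow A|" by (rule card_of_mono1) (auto simp: Fpow_def)
  then show ?thesis using card_of_Pow_ordLeq[OF assms] ordLeq_transitive by blast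
qed

lemma card_of_nat_ordLeq: "Cinfinite \<beta> \<Longrightarrow> |UNIV :: nat set| \<le>o \<beta>"
  by (rule ordIso_ordLeq_trans[OF card_of_nat natLeq_ordLeq_cinfinite])

text \<open>
The power set is a generous bound, but its proof is short, and single exponentiations do not matter
for infinite trees.
\<close>

lemma card_of_lists_ordLeq:
  fixes A :: "'a set"
  assumes "Cinfinite \<beta>" and "|A| \<le>o \<beta>"
  shows "|lists A| \<le>o ctwo ^c \<beta>"
proof -
  define G where "G xs = {(n, xs ! n) | n. n < length xs}" for xs :: "'a list"
  have "inj_on G (lists A)"
  proof (rule inj_onI)
    fix xs ys assume eq: "G xs = G ys"
    have "fst ` G xs = {..<length xs}" for xs unfolding G_def by force
    then have len: "length xs = length ys" using eq by (metis lessThan_eq_iff)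
    moreover have "xs ! n = ys ! n" if "n < length xs" for n
    proof -
      have "(n, xs ! n) \<in> G ys" using that eq unfolding G_def by blast
      then show ?thesis unfolding G_def by blast
    qed
    ultimately show "xs = ys" by (simp add: list_eq_iff_nth_eq)
  qed
  moreover have "G ` lists A \<subseteq> Pow ((UNIV :: nat set) \<times> A)"
    unfolding G_def by (auto simp: in_lists_conv_set)
  ultimately have "|lists A| \<le>o |Pow ((UNIV :: nat set) \<times> A)|" by (intro card_of_ordLeqI[of G]) auto
  moreover have "|UNIV :: nat set| \<le>o \<beta>" by (rule card_of_nat_ordLeq[OF assms(1)])
  ultimately show ?thesis
    using card_of_Pow_ordLeq card_of_Times_ordLeq[OF assms(1) _ assms(2)] assms(1) ordLeq_transitive by blast
qed

lemma not_ordLeq_card_of: "Card_order \<beta> \<Longrightarrow> \<not> |A| \<le>o \<beta> \<longleftrightarrow> \<beta> <o |A|"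
  by (meson card_of_Well_order card_order_on_well_order_on not_ordLeq_iff_ordLess)

section \<open>Initial segments of the ordinals\<close>

lemma card_of_atMost_ordLeq:
  fixes x :: "'o::wellorder"
  assumes "Cinfinite \<beta>" and "|N \<inter> {..<x}| \<le>o \<beta>"
  shows "|N \<inter> {..x}| \<le>o \<beta>"
proof -
  have "|{x}| \<le>o \<beta>"
    using assms(1) by (intro Card_order_singl_ordLeq) (auto simp: cinfinite_def)
  then have "|N \<inter> {..<x} \<union> {x}| \<le>o \<beta>" by (rule Un_Cinfinite_bound[OF assms(2) _ assms(1)])
  moreover have "|N \<inter> {..x}| \<le>o |N \<inter> {..<x} \<union> {x}|" by (rule card_of_mono1) auto
  ultimately show ?thesis using ordLeq_transitive by blast
qed

text \<open>
Otherwise \<open>N\<close> has a subset \<open>A\<close> of cardinality \<open>2\<^bsup>\<beta>\<^esup> > \<beta>\<close>. No proper initial segment of \<open>N\<close> is large enough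
to contain \<open>A\<close>, so \<open>A\<close> is cofinal and \<open>N\<close> is a union of \<open>2\<^bsup>\<beta>\<^esup>\<close> initial segments of size at most \<open>\<beta>\<close>.
\<close>

lemma card_of_small_segments:
  fixes N :: "'o::wellorder set"
  assumes \<beta>: "Cinfinite \<beta>" and seg: "\<And>x. x \<in> N \<Longrightarrow> |N \<inter> {..<x}| \<le>o \<beta>"
  shows "|N| \<le>o ctwo ^c \<beta>"
proof (rule ccontr)
  let ?E = "ctwo ^c \<beta>"
  have E: "Cinfinite ?E" using Cinfinite_ctwo_cexp[OF \<beta>] .
  have less: "\<beta> <o ?E" using ordLess_ctwo_cexp \<beta> by blast
  assume contra: "\<not> |N| \<le>o ?E"
  then have "?E <o |N|" using not_ordLeq_card_of E by blast
  then have "|Field ?E| \<le>o |N|"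
    using E card_of_Field_ordIso ordIso_ordLeq_trans ordLess_imp_ordLeq by blast
  from iffD1[OF internalize_card_of_ordLeq2 this]
  obtain A where A: "A \<subseteq> N" "|Field ?E| =o |A|" by (elim exE conjE) 
  then have AE: "|A| =o ?E" using E card_of_Field_ordIso ordIso_symmetric ordIso_transitive by blast
  have "\<exists>a\<in>A. x \<le> a" if "x \<in> N" for x
  proof (rule ccontr)
    assume "\<not> (\<exists>a\<in>A. x \<le> a)"
    then have "A \<subseteq> N \<inter> {..<x}" using A by (auto simp: not_le)
    then have "|A| \<le>o \<beta>" using card_of_mono1 seg[OF that] ordLeq_transitive by blast
    then have "?E \<le>o \<beta>" using AE ordIso_ordLeq_trans ordIso_symmetric by blast
    then show False using less not_ordLess_ordLeq by blast
  qed
  then have "N \<subseteq> (\<Union>a\<in>A. N \<inter> {..a})" by auto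
  moreover have "|\<Union>a\<in>A. N \<inter> {..a}| \<le>o ?E"
  proof (rule UNION_Cinfinite_bound)
    show "|A| \<le>o ?E" using AE ordIso_imp_ordLeq by blast
    show "\<forall>a\<in>A. |N \<inter> {..a}| \<le>o ?E"
      using card_of_atMost_ordLeq[OF \<beta> seg] A less ordLess_imp_ordLeq ordLeq_transitive by blast
  qed (rule E)
  ultimately show False using contra card_of_mono1 ordLeq_transitive by blast
qed

text \<open>
Up to isomorphism \<open>{..<a}\<close> is the cardinal successor of \<open>\<beta>\<close>, realised as an initial segment of \<open>'o\<close>. The
next lemmas are the consequences of its regularity that are needed.
\<close>

definition first_above :: "'k rel \<Rightarrow> 'o::wellorder \<Rightarrow> bool" where
  "first_above \<beta> a \<longleftrightarrow> \<not> |{..<a}| \<le>o \<beta> \<and> (\<forall>x<a. |{..<x}| \<le>o \<beta>)"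

lemma ex_first_above:
  assumes \<beta>: "Cinfinite \<beta>" and big: "\<not> |UNIV :: 'o set| \<le>o ctwo ^c \<beta>"
  shows "\<exists>a :: 'o::wellorder. first_above \<beta> a"
proof -
  have "\<exists>a :: 'o. \<not> |{..<a}| \<le>o \<beta>"
    using card_of_small_segments[OF \<beta>, of "UNIV :: 'o set"] big by auto
  then have "\<not> |{..<LEAST a :: 'o. \<not> |{..<a}| \<le>o \<beta>}| \<le>o \<beta>" by (rule LeastI_ex)
  then show ?thesis unfolding first_above_def
    by (intro exI[of _ "LEAST a :: 'o. \<not> |{..<a}| \<le>o \<beta>"]) (use not_less_Least in blast)
qed

lemma first_above_card:
  assumes \<beta>: "Cinfinite \<beta>" and a: "first_above \<beta> a"
  shows "|{..<a}| \<le>o ctwo ^c \<beta>"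
proof (rule card_of_small_segments[OF \<beta>])
  fix x assume "x \<in> {..<a}"
  moreover then have "{..<a} \<inter> {..<x} = {..<x}" by auto
  ultimately show "|{..<a} \<inter> {..<x}| \<le>o \<beta>" using a unfolding first_above_def by simp
qed

lemma first_above_unbounded:
  assumes \<beta>: "Cinfinite \<beta>" and a: "first_above \<beta> a" and J: "J \<subseteq> {..<a}" "|J| \<le>o \<beta>"
  shows "\<exists>x<a. \<forall>y\<in>J. y < x"
proof (rule ccontr)
  assume "\<not> ?thesis"
  then have "\<exists>y\<in>J. x \<le> y" if "x < a" for x using that by (meson not_less)
  then have "{..<a} \<subseteq> (\<Union>y\<in>J. UNIV \<inter> {..y})" by auto
  moreover have "|\<Union>y\<in>J. UNIV \<inter> {..y}| \<le>o \<beta>"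
  proof (rule UNION_Cinfinite_bound[OF J(2) _ \<beta>], intro ballI)
    fix y assume "y \<in> J"
    then have "|UNIV \<inter> {..<y}| \<le>o \<beta>" using a J unfolding first_above_def by auto
    then show "|UNIV \<inter> {..y}| \<le>o \<beta>" by (rule card_of_atMost_ordLeq[OF \<beta>])
  qed
  ultimately show False using a card_of_mono1 ordLeq_transitive unfolding first_above_def by blast
qed

lemma first_above_gap:
  assumes \<beta>: "Cinfinite \<beta>" and a: "first_above (ctwo ^c \<beta>) a" and "b < a"
  shows "\<exists>b'<a. \<not> |{b..<b'}| \<le>o \<beta>"
proof (rule ccontr)
  assume neg: "\<not> ?thesis"
  have "|{b..<a}| \<le>o ctwo ^c \<beta>"
  proof (rule card_of_small_segments[OF \<beta>])
    fix x assume "x \<in> {b..<a}"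
    moreover then have "{b..<a} \<inter> {..<x} = {b..<x}" by auto
    ultimately show "|{b..<a} \<inter> {..<x}| \<le>o \<beta>" using neg by auto
  qed
  moreover have "|{..<b}| \<le>o ctwo ^c \<beta>" using a \<open>b < a\<close> unfolding first_above_def by blast
  ultimately have "|{..<b} \<union> {b..<a}| \<le>o ctwo ^c \<beta>"
    by (intro Un_Cinfinite_bound Cinfinite_ctwo_cexp[OF \<beta>])
  moreover have "{..<b} \<union> {b..<a} = {..<a}" using \<open>b < a\<close> by auto
  ultimately show False using a unfolding first_above_def by simp
qed

lemma first_above_pigeonhole:
  assumes \<beta>: "Cinfinite \<beta>" and a: "first_above \<beta> a" and f: "|f ` {..<a}| \<le>o \<beta>"
  shows "\<exists>y. \<forall>b<a. \<exists>x. b \<le> x \<and> x < a \<and> f x = y"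
proof (rule ccontr)
  assume "\<not> ?thesis"
  then obtain g where g: "\<And>y. g y < a \<and> (\<forall>x. g y \<le> x \<longrightarrow> x < a \<longrightarrow> f x \<noteq> y)" by metis
  have "|g ` f ` {..<a}| \<le>o \<beta>" using card_of_image f ordLeq_transitive by blast
  moreover have "g ` f ` {..<a} \<subseteq> {..<a}" using g by auto
  ultimately obtain x where "x < a" "\<forall>y\<in>g ` f ` {..<a}. y < x"
    using first_above_unbounded[OF \<beta> a] by blast
  then have "g (f x) < x" by blast
  then have "g (f x) \<le> x" by simp
  then show False using g[of "f x"] \<open>x < a\<close> by blast
qed

text \<open>
Enumerate \<open>N\<close> in increasing order by transfinite recursion. If the enumeration stops before \<open>\<gamma>\<close> then
it has exhausted \<open>N\<close>.
\<close>

lemma strict_mono_or_card_le: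
  fixes N :: "'o::wellorder set" and \<gamma> :: 'o
  shows "(\<exists>g. strict_mono_on {..<\<gamma>} g \<and> g ` {..<\<gamma>} \<subseteq> N) \<or> |N| \<le>o |{..<\<gamma>}|"
proof -
  let ?R = "{(x, y :: 'o). x < y}"
  define g where "g = wfrec ?R (\<lambda>h x. LEAST n. n \<in> N \<and> (\<forall>y<x. h y < n))"
  have g: "g x = (LEAST n. n \<in> N \<and> (\<forall>y<x. g y < n))" for x
  proof -
    have "g x = (LEAST n. n \<in> N \<and> (\<forall>y<x. cut g ?R x y < n))"
      unfolding g_def by (rule wfrec[OF wf])
    moreover have "(\<forall>y<x. cut g ?R x y < n) \<longleftrightarrow> (\<forall>y<x. g y < n)" for n by (auto simp: cut_def)
    ultimately show ?thesis by simp
  qed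
  show ?thesis
  proof (cases "\<forall>x<\<gamma>. \<exists>n\<in>N. \<forall>y<x. g y < n")
    case True
    then have "g x \<in> N \<and> (\<forall>y<x. g y < g x)" if "x < \<gamma>" for x
      using that LeastI_ex[of "\<lambda>n. n \<in> N \<and> (\<forall>y<x. g y < n)"] unfolding g[of x, symmetric] by blast
    then show ?thesis by (intro disjI1 exI[of _ g]) (auto simp: strict_mono_on_def)
  next
    case False
    define x where "x = (LEAST x. \<not> (\<exists>n\<in>N. \<forall>y<x. g y < n))"
    have x: "\<not> (\<exists>n\<in>N. \<forall>y<x. g y < n)" "\<And>z. z < x \<Longrightarrow> \<exists>n\<in>N. \<forall>y<z. g y < n"
      using LeastI_ex[of "\<lambda>x. \<not> (\<exists>n\<in>N. \<forall>y<x. g y < n)"] False not_less_Least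
      unfolding x_def by blast+
    obtain z where "z < \<gamma>" "\<not> (\<exists>n\<in>N. \<forall>y<z. g y < n)" using False by blast
    then have "x < \<gamma>" using x(2)[of z] by (metis not_less order.strict_trans1)
    have "N \<subseteq> g ` {..<\<gamma>}"
    proof
      fix n assume "n \<in> N"
      then have ex: "\<exists>y<x. n \<le> g y" using x(1) by (meson not_le)
      define y where "y = (LEAST y. n \<le> g y)"
      have y: "n \<le> g y" unfolding y_def using ex by (metis LeastI)
      have yx: "y \<le> x" using ex unfolding y_def by (meson Least_le order.trans order.strict_implies_order)
      have lt: "g z < n" if "z < y" for z using not_less_Least[OF that[unfolded y_def]] by simp
      have "g y \<le> n" unfolding g[of y] by (rule Least_le) (use \<open>n \<in> N\<close> lt in blast)
      then show "n \<in> g ` {..<\<gamma>}" using y yx \<open>x < \<gamma>\<close> by (metis antisym image_eqI lessThan_iff order.strict_trans1)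
    qed
    then show ?thesis using surj_imp_ordLeq by blast
  qed
qed

section \<open>Copies on which a colouring of nodes depends on the level\<close>

definition ds_below :: "'o::wellorder \<Rightarrow> 'o list set" where
  "ds_below a = {\<eta> \<in> ds. \<forall>x\<in>set \<eta>. x < a}"

lemma ds_below_Nil [simp]: "[] \<in> ds_below a"
  by (simp add: ds_below_def)

lemma ds_below_Cons [simp]: "i # \<nu> \<in> ds_below a \<longleftrightarrow> i < a \<and> \<nu> \<in> ds_below i"
  by (auto simp: ds_below_def ds_Cons)

lemma ds_below_mono: "a \<le> b \<Longrightarrow> ds_below a \<subseteq> ds_below b"
  by (auto simp: ds_below_def)

lemma tree_ds_below: "tree (ds_below a)"
  unfolding tree_def
proof (intro conjI ballI allI impI)
  show "ds_below a \<noteq> {}" using ds_below_Nil by blast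
  show "ds_below a \<subseteq> ds" by (auto simp: ds_below_def)
  fix \<eta> \<nu> assume "\<eta> \<in> ds_below a" "prefix \<nu> \<eta>"
  then show "\<nu> \<in> ds_below a" by (auto simp: ds_below_def prefix_def dest: ds_append)
qed

lemma sub_ds_below: "i < a \<Longrightarrow> sub (ds_below a) i = ds_below i"
  by (auto simp: sub_def)

lemma ds_below_snoc: "\<eta> @ [a] \<in> ds_below w \<longleftrightarrow> \<eta> \<in> ds_below w \<and> a < (if \<eta> = [] then w else last \<eta>)"
  by (induction \<eta> arbitrary: w) auto

lemma card_of_ds_below_ordLeq:
  assumes "Cinfinite \<beta>" "|{..<a}| \<le>o \<beta>"
  shows "|ds_below a| \<le>o ctwo ^c \<beta>"
proof -
  have "|ds_below a| \<le>o |lists {..<a}|" by (rule card_of_mono1) (auto simp: ds_below_def)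
  then show ?thesis using card_of_lists_ordLeq[OF assms] by (rule ordLeq_transitive)
qed

text \<open>
Suppose that there is no such copy. A function \<open>p\<close> from levels to colours then has a rank \<open>R p \<eta> \<le> v\<close> at
each node \<open>\<eta>\<close>: the first \<open>\<gamma>\<close> such that \<open>ds_below \<gamma>\<close> cannot be embedded above \<open>\<eta>\<close> with the
colours that \<open>p\<close> prescribes. If \<open>\<eta>\<close> fits \<open>p\<close>, the extensions \<open>\<eta> @ [a]\<close> on which the rank does not drop
are few, since otherwise the copies above them could be glued together to a copy of
\<open>ds_below (R p \<eta>)\<close> above \<open>\<eta>\<close>. The cardinal \<open>w\<close> is so large that one can always choose \<open>a\<close> such that the ranks
of all \<open>p\<close> that fit drop at the same time, and that the pigeonhole principle applies to the pairs of
the colour of a node and the family of its ranks. In this way the data along ever longer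
paths can be fixed in advance, which yields an infinite sequence of data. Its colours
define one \<open>p\<close> that fits all of them, and the ranks of this \<open>p\<close> decrease forever.
\<close>

lemma ex_level_uniform:
  fixes v w :: "'o::wellorder" and d :: "'o list \<Rightarrow> 'd"
  assumes \<beta>: "Cinfinite \<beta>" and v: "|{..<v}| \<le>o \<beta>" and d: "|d ` ds_below w| \<le>o \<beta>"
    and w: "first_above (ctwo ^c (ctwo ^c \<beta>)) w"
  shows "\<exists>g. tree_embedding g (ds_below v) (ds_below w) \<and>
    (\<forall>\<eta>\<in>ds_below v. \<forall>\<nu>\<in>ds_below v. length \<eta> = length \<nu> \<longrightarrow> d (g \<eta>) = d (g \<nu>))"
proof (rule ccontr)
  assume contra: "\<not> ?thesis"
  define \<beta>0 where "\<beta>0 = ctwo ^c \<beta>"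
  define \<beta>1 where "\<beta>1 = ctwo ^c \<beta>0"
  have \<beta>0: "Cinfinite \<beta>0" unfolding \<beta>0_def by (rule Cinfinite_ctwo_cexp[OF \<beta>])
  have \<beta>1: "Cinfinite \<beta>1" unfolding \<beta>1_def by (rule Cinfinite_ctwo_cexp[OF \<beta>0])
  have le0: "\<beta> \<le>o \<beta>0" unfolding \<beta>0_def by (rule ordLeq_ctwo_cexp) (simp add: \<beta>)
  have le1: "\<beta>0 \<le>o \<beta>1" unfolding \<beta>1_def by (rule ordLeq_ctwo_cexp) (simp add: \<beta>0)
  have w: "first_above \<beta>1 w" using w unfolding \<beta>0_def \<beta>1_def .
  define D where "D = d ` ds_below w"
  define P where "P = ((UNIV :: nat set) \<rightarrow>\<^sub>E D)"
  have cardP: "|P| \<le>o \<beta>0"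
    unfolding P_def \<beta>0_def D_def by (rule card_of_extensional_ordLeq[OF \<beta> card_of_nat_ordLeq[OF \<beta>] d])
  define E where "E p \<eta> \<gamma> \<longleftrightarrow> (\<exists>f. tree_embedding f (ds_below \<gamma>) {\<nu>. \<eta> @ \<nu> \<in> ds_below w} \<and>
      (\<forall>\<nu>\<in>ds_below \<gamma>. d (\<eta> @ f \<nu>) = p (length \<eta> + length \<nu>)))" for p \<eta> \<gamma>
  have not_E: "\<not> E p [] v" for p
  proof
    assume "E p [] v"
    then obtain f where "tree_embedding f (ds_below v) (ds_below w)" "\<forall>\<nu>\<in>ds_below v. d (f \<nu>) = p (length \<nu>)"
      unfolding E_def by auto
    then show False using contra by auto
  qed
  define R where "R p \<eta> = (LEAST \<gamma>. \<gamma> = v \<or> \<not> E p \<eta> \<gamma>)" for p \<eta>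
  have R_le: "R p \<eta> \<le> v" for p \<eta> unfolding R_def by (rule Least_le) simp
  have R_less: "E p \<eta> \<gamma>" if "\<gamma> < R p \<eta>" for p \<eta> \<gamma>
    using not_less_Least[OF that[unfolded R_def]] by blast
  have R_not: "R p \<eta> = v \<or> \<not> E p \<eta> (R p \<eta>)" for p \<eta>
    unfolding R_def by (rule LeastI_ex) blast
  define N where "N p \<eta> = {a. \<eta> @ [a] \<in> ds_below w \<and> R p \<eta> \<le> R p (\<eta> @ [a])}" for p \<eta>
  have cardN: "|N p \<eta>| \<le>o \<beta>0"
    if \<eta>: "\<eta> \<in> ds_below w" "d \<eta> = p (length \<eta>)" and nE: "\<not> E p \<eta> (R p \<eta>)" for p \<eta>
  proof -
    have False if g: "strict_mono_on {..<R p \<eta>} g" "g ` {..<R p \<eta>} \<subseteq> N p \<eta>" for g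
    proof -
      have "E p (\<eta> @ [g i]) i" if "i < R p \<eta>" for i
      proof (rule R_less)
        have "R p \<eta> \<le> R p (\<eta> @ [g i])" using that g(2) unfolding N_def by auto
        with that show "i < R p (\<eta> @ [g i])" by simp
      qed
      then have "\<forall>i. \<exists>f. i < R p \<eta> \<longrightarrow> tree_embedding f (ds_below i) {\<nu>. (\<eta> @ [g i]) @ \<nu> \<in> ds_below w} \<and>
          (\<forall>\<nu>\<in>ds_below i. d ((\<eta> @ [g i]) @ f \<nu>) = p (length (\<eta> @ [g i]) + length \<nu>))"
        unfolding E_def by blast
      then obtain f where f: "\<And>i. i < R p \<eta> \<Longrightarrow> tree_embedding (f i) (ds_below i) {\<nu>. (\<eta> @ [g i]) @ \<nu> \<in> ds_below w}"
        "\<And>i \<nu>. i < R p \<eta> \<Longrightarrow> \<nu> \<in> ds_below i \<Longrightarrow>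
          d ((\<eta> @ [g i]) @ f i \<nu>) = p (length (\<eta> @ [g i]) + length \<nu>)"
        by metis
      have "tree_embedding (glue g f) (ds_below (R p \<eta>)) {\<nu>. \<eta> @ \<nu> \<in> ds_below w}"
      proof (rule tree_embedding_glue[OF tree_ds_below])
        show "[] \<in> {\<nu>. \<eta> @ \<nu> \<in> ds_below w}" using \<eta> by simp
        have "{i. [i] \<in> ds_below (R p \<eta>)} = {..<R p \<eta>}" by auto
        then show "strict_mono_on {i. [i] \<in> ds_below (R p \<eta>)} g" using g by simp
        fix i assume "[i] \<in> ds_below (R p \<eta>)"
        then show "tree_embedding (f i) (sub (ds_below (R p \<eta>)) i) (sub {\<nu>. \<eta> @ \<nu> \<in> ds_below w} (g i))"
          using f(1)[of i] by (simp add: sub_ds_below) (simp add: sub_def)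
      qed
      moreover have "d (\<eta> @ glue g f \<nu>) = p (length \<eta> + length \<nu>)" if "\<nu> \<in> ds_below (R p \<eta>)" for \<nu>
        using that \<eta> f(2) by (cases \<nu>) auto
      ultimately show False using nE unfolding E_def by blast
    qed
    then have "|N p \<eta>| \<le>o |{..<R p \<eta>}|" using strict_mono_or_card_le[of "R p \<eta>" "N p \<eta>"] by blast
    moreover have "|{..<R p \<eta>}| \<le>o |{..<v}|" using R_le[of p \<eta>] by (intro card_of_mono1) auto
    ultimately show ?thesis using v le0 ordLeq_transitive by metis
  qed
  \<comment> \<open>Only those \<open>p\<close> are of interest that fit all initial segments of the node.\<close>
  define matches where "matches p \<eta> \<longleftrightarrow> (\<forall>i\<le>length \<eta>. d (take i \<eta>) = p i)" for p \<eta>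
  define good where "good \<eta> \<longleftrightarrow> \<eta> \<in> ds_below w \<and> (\<forall>i<length \<eta>. \<forall>p\<in>P. matches p (take i \<eta>) \<longrightarrow>
      R p (take (Suc i) \<eta>) < R p (take i \<eta>))" for \<eta>
  have good_N: "|N p \<eta>| \<le>o \<beta>0" if \<eta>: "good \<eta>" and p: "p \<in> P" "matches p \<eta>" for p \<eta>
  proof (rule cardN)
    show "\<eta> \<in> ds_below w" using \<eta> unfolding good_def by blast
    show "d \<eta> = p (length \<eta>)" using p(2) unfolding matches_def by auto
    show "\<not> E p \<eta> (R p \<eta>)"
    proof (cases \<eta> rule: rev_cases)
      case Nil
      then show ?thesis using R_not[of p \<eta>] not_E by metis
    next
      case (snoc \<xi> a)
      have "d (take i \<xi>) = p i" if "i \<le> length \<xi>" for i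
        using p(2)[unfolded matches_def, rule_format, of i] that by (simp add: snoc)
      then have "matches p \<xi>" unfolding matches_def by blast
      then have "R p \<eta> < R p \<xi>" using \<eta> p(1) unfolding good_def by (auto simp: snoc dest!: spec[where x = "length \<xi>"])
      then show ?thesis using R_not[of p \<eta>] R_le[of p \<xi>] by auto
    qed
  qed
  \<comment> \<open>Beyond \<open>b\<close> there are so many ordinals left to extend \<open>\<eta>\<close> that a small set of bad ones can be avoided.\<close>
  define room where "room b \<eta> \<longleftrightarrow> \<not> |{b..<if \<eta> = [] then w else last \<eta>}| \<le>o \<beta>0" for b \<eta>
  define data where "data \<eta> = (d \<eta>, \<lambda>p\<in>P. R p \<eta>)" for \<eta>
  have card_data: "|data ` ds_below w| \<le>o \<beta>1"
  proof -
    have "|{..v}| \<le>o \<beta>0"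
      using card_of_atMost_ordLeq[OF \<beta>0, of UNIV v] ordLeq_transitive[OF v le0] by simp
    then have "|P \<rightarrow>\<^sub>E {..v}| \<le>o \<beta>1"
      unfolding \<beta>1_def by (intro card_of_extensional_ordLeq \<beta>0 cardP)
    moreover have "|D| \<le>o \<beta>1" using ordLeq_transitive[OF ordLeq_transitive[OF d le0] le1] by (simp add: D_def)
    ultimately have "|D \<times> (P \<rightarrow>\<^sub>E {..v})| \<le>o \<beta>1" by (intro card_of_Times_ordLeq \<beta>1)
    moreover have "data ` ds_below w \<subseteq> D \<times> (P \<rightarrow>\<^sub>E {..v})" using R_le by (auto simp: data_def D_def)
    ultimately show ?thesis using card_of_mono1 ordLeq_transitive by blast
  qed
  have ex_gap: "\<exists>b'<w. \<not> |{b..<b'}| \<le>o \<beta>0" if "b < w" for b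
    using first_above_gap[OF \<beta>0 w[unfolded \<beta>1_def] that] .
  define trace where "trace \<eta> = map (\<lambda>i. data (take i \<eta>)) [0..<Suc (length \<eta>)]" for \<eta>
  \<comment> \<open>The data \<open>\<delta>\<close> occur on good paths that stay above an arbitrary \<open>b\<close>, so they can be continued.\<close>
  define cof where "cof \<delta> \<longleftrightarrow> (\<forall>b<w. \<exists>\<eta>. good \<eta> \<and> trace \<eta> = \<delta> \<and> room b \<eta>)" for \<delta>
  have cof_Nil: "cof [data []]"
    unfolding cof_def
  proof (intro allI impI)
    fix b assume "b < w"
    then obtain b' where b': "b' < w" "\<not> |{b..<b'}| \<le>o \<beta>0" using ex_gap by blast
    have "|{b..<b'}| \<le>o |{b..<w}|" using b'(1) by (intro card_of_mono1) auto
    then have "room b []" using b'(2) ordLeq_transitive unfolding room_def by auto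
    then show "\<exists>\<eta>. good \<eta> \<and> trace \<eta> = [data []] \<and> room b \<eta>"
      by (intro exI[of _ "[]"]) (auto simp: good_def trace_def)
  qed
  have cof_step: "\<exists>x. cof (\<delta> @ [x])" if \<delta>: "cof \<delta>" for \<delta>
  proof -
    have "\<exists>\<eta>. good \<eta> \<and> trace \<eta> = \<delta> @ [data \<eta>] \<and> room b \<eta>" if "b < w" for b
    proof -
      obtain b' where b': "b' < w" "\<not> |{b..<b'}| \<le>o \<beta>0" using ex_gap[OF \<open>b < w\<close>] by blast
      obtain \<eta> where \<eta>: "good \<eta>" "trace \<eta> = \<delta>" "room b' \<eta>" using \<delta> b'(1) unfolding cof_def by blast
      define bad where "bad = (\<Union>p\<in>{p\<in>P. matches p \<eta>}. N p \<eta>)"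
      have "|{p\<in>P. matches p \<eta>}| \<le>o \<beta>0" by (rule ordLeq_transitive[OF card_of_mono1 cardP]) auto
      then have "|bad| \<le>o \<beta>0"
        unfolding bad_def by (rule UNION_Cinfinite_bound) (use good_N[OF \<eta>(1)] \<beta>0 in auto)
      then have "\<not> {b'..<if \<eta> = [] then w else last \<eta>} \<subseteq> bad"
        using \<eta>(3) ordLeq_transitive[OF card_of_mono1] unfolding room_def by blast
      then obtain a where a: "b' \<le> a" "a < (if \<eta> = [] then w else last \<eta>)" "a \<notin> bad"
        by (meson atLeastLessThan_iff subsetI)
      have mem: "\<eta> @ [a] \<in> ds_below w" using \<eta>(1) a(2) unfolding good_def ds_below_snoc by blast
      have "R p (\<eta> @ [a]) < R p \<eta>" if "p \<in> P" "matches p \<eta>" for p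
        using a(3) that mem unfolding bad_def N_def by force
      then have "good (\<eta> @ [a])"
        using \<eta>(1) mem unfolding good_def by (auto simp: less_Suc_eq)
      moreover have "trace (\<eta> @ [a]) = \<delta> @ [data (\<eta> @ [a])]"
        using \<eta>(2) unfolding trace_def by auto
      moreover have "room b (\<eta> @ [a])"
      proof -
        have "|{b..<b'}| \<le>o |{b..<a}|" using a(1) by (intro card_of_mono1) auto
        then show ?thesis using b'(2) ordLeq_transitive unfolding room_def by auto
      qed
      ultimately show ?thesis by blast
    qed
    then obtain h where h: "\<And>b. b < w \<Longrightarrow> good (h b) \<and> trace (h b) = \<delta> @ [data (h b)] \<and> room b (h b)"
      by metis
    have "|(data \<circ> h) ` {..<w}| \<le>o \<beta>1"
    proof (rule ordLeq_transitive[OF card_of_mono1 card_data])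
      show "(data \<circ> h) ` {..<w} \<subseteq> data ` ds_below w" using h unfolding good_def by auto
    qed
    from first_above_pigeonhole[OF \<beta>1 w this]
    obtain y where y: "\<And>b. b < w \<Longrightarrow> \<exists>x. b \<le> x \<and> x < w \<and> data (h x) = y" by auto
    have "cof (\<delta> @ [y])"
      unfolding cof_def
    proof (intro allI impI)
      fix b assume "b < w"
      then obtain x where x: "b \<le> x" "x < w" "data (h x) = y" using y by blast
      have "room b (h x)"
      proof -
        have "|{x..<if h x = [] then w else last (h x)}| \<le>o |{b..<if h x = [] then w else last (h x)}|"
          using x(1) by (intro card_of_mono1) auto
        then show ?thesis using h[OF x(2)] ordLeq_transitive unfolding room_def by blast
      qed
      then show "\<exists>\<eta>. good \<eta> \<and> trace \<eta> = \<delta> @ [y] \<and> room b \<eta>" using h[OF x(2)] x(3) by blast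
    qed
    then show ?thesis by blast
  qed
  define \<delta> where "\<delta> = rec_nat [data []] (\<lambda>_ \<delta>. \<delta> @ [SOME x. cof (\<delta> @ [x])])"
  define x where "x n = last (\<delta> n)" for n
  have \<delta>: "cof (\<delta> n) \<and> \<delta> n = map x [0..<Suc n]" for n
  proof (induction n)
    case 0
    then show ?case using cof_Nil by (simp add: \<delta>_def x_def)
  next
    case (Suc n)
    have "\<delta> (Suc n) = \<delta> n @ [SOME x. cof (\<delta> n @ [x])]" by (simp add: \<delta>_def)
    moreover have "cof (\<delta> n @ [SOME x. cof (\<delta> n @ [x])])" using someI_ex[OF cof_step] Suc by blast
    moreover have "x (Suc n) = (SOME x. cof (\<delta> n @ [x]))" using calculation(1) by (simp add: x_def)
    moreover have "\<delta> n = map x [0..<Suc n]" using Suc by blast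
    ultimately show ?case by simp
  qed
  have "{..<w} \<noteq> {}" using w card_of_empty1[of \<beta>1] \<beta>1 unfolding first_above_def by auto
  then obtain b where b: "b < w" by auto
  have path: "\<exists>\<eta>. good \<eta> \<and> length \<eta> = n \<and> (\<forall>i\<le>n. data (take i \<eta>) = x i)" for n
  proof -
    have "cof (\<delta> n)" and \<delta>n: "\<delta> n = map x [0..<Suc n]" using \<delta> by blast+
    then obtain \<eta> where "good \<eta>" "trace \<eta> = \<delta> n" using b unfolding cof_def by blast
    with \<delta>n have \<eta>: "good \<eta>" "trace \<eta> = map x [0..<Suc n]" by simp_all
    from this(2) have "length (trace \<eta>) = Suc n" by simp
    then have len: "length \<eta> = n" unfolding trace_def by simp
    have "data (take i \<eta>) = x i" if "i \<le> n" for i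
    proof -
      have "trace \<eta> ! i = x i" using that \<eta>(2) by (simp del: upt_Suc)
      then show ?thesis using that len unfolding trace_def by (simp del: upt_Suc)
    qed
    then show ?thesis using \<eta>(1) len by blast
  qed
  define p where "p n = fst (x n)" for n
  have p: "p \<in> P"
  proof -
    have "p n \<in> D" for n
    proof -
      obtain \<eta> where "good \<eta>" "length \<eta> = n" "\<forall>i\<le>n. data (take i \<eta>) = x i" using path by blast
      then have "data \<eta> = x n" "\<eta> \<in> ds_below w" by (auto simp: good_def)
      then show ?thesis unfolding p_def D_def data_def by (metis fst_conv image_eqI)
    qed
    then show ?thesis unfolding P_def by auto
  qed
  have "snd (x (Suc n)) p < snd (x n) p" for n
  proof -
    obtain \<eta> where \<eta>: "good \<eta>" "length \<eta> = Suc n" "\<And>i. i \<le> Suc n \<Longrightarrow> data (take i \<eta>) = x i"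
      using path by metis
    have "d (take i \<eta>) = p i" if "i \<le> Suc n" for i
      unfolding p_def \<eta>(3)[OF that, symmetric] data_def by simp
    then have "matches p (take n \<eta>)" unfolding matches_def using \<eta>(2) by auto
    then have "R p (take (Suc n) \<eta>) < R p (take n \<eta>)" using \<eta>(1,2) p unfolding good_def by auto
    moreover have "snd (x i) p = R p (take i \<eta>)" if "i \<le> Suc n" for i
      unfolding \<eta>(3)[OF that, symmetric] data_def using p by simp
    ultimately show ?thesis by simp
  qed
  then show False using wf_iff_no_infinite_down_chain[of "{(x, y :: 'o). x < y}"] wf
    by (auto dest: spec[where x = "\<lambda>n. snd (x n) p"])
qed

section \<open>Placing copies one after another\<close>

text \<open>
A whole family of colourings \<open>c g\<close> is made end-uniform at the same time, because the recursion needs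
end-uniformity over all finite sets of nodes that have been chosen before. The
index \<open>g\<close> is a list of such sets of nodes, one for each level of the recursion: passing to a child
prepends an entry, so the type of indices does not change.
\<close>

definition arrows ::
    "'k rel \<Rightarrow> 'm set \<Rightarrow> 'o::wellorder list set \<Rightarrow> 'o list set \<Rightarrow> bool" where
  "arrows \<kappa> C T S \<longleftrightarrow>
     (\<forall>(c :: 'o list set list \<Rightarrow> 'o list set \<Rightarrow> 'm) G. (\<forall>g x. c g x \<in> C) \<and> |G| \<le>o \<kappa> \<longrightarrow>
        (\<exists>f. tree_embedding f S T \<and> (\<forall>g\<in>G. end_uniform S (\<lambda>x. c g (f ` x)))))"

lemma arrows_mono: "arrows \<kappa> C T S \<Longrightarrow> T \<subseteq> T' \<Longrightarrow> arrows \<kappa> C T' S"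
  unfolding arrows_def using tree_embedding_mono by metis

text \<open>
A history \<open>H\<close> assigns to each child \<open>i\<close> the ordinal \<open>fst (H i)\<close> above which \<open>sub S i\<close> is placed and the
embedding \<open>snd (H i)\<close> that places it; \<open>F H\<close> is the resulting partial embedding of \<open>S\<close>. The value
\<open>q (l, u, g)\<close> prescribes the colour that a new node of level \<open>Suc l\<close> has to produce together with
the image of \<open>u\<close>. Each \<open>q\<close> determines one history by recursion on \<open>i\<close>, with arbitrary but fixed choices.
The prescription is indexed by subsets of \<open>S\<close> and not of the image, so there are at most \<open>2\<^bsup>\<kappa>\<^esup>\<close> of them
and hence few histories. The set \<open>M\<close> collects the nodes of all histories, \<open>j\<close> is an ordinal to the
right of them, and \<open>g0\<close> thins the tree above \<open>j\<close> over \<open>M\<close>. The history \<open>H\<close> follows the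
types of the tree thinned in this way; its prescription \<open>q\<close> is only known afterwards, but \<open>H\<close> is the
history of \<open>q\<close>, which brings its nodes into \<open>M\<close>.
\<close>

lemma arrows_step:
  fixes S :: "'o::wellorder list set" and v w z :: 'o and C :: "'m set" and \<kappa> :: "'k rel" and \<beta> :: "'b rel"
  assumes S: "tree S" and \<kappa>: "Cinfinite \<kappa>" and cardS: "|Fpow S| \<le>o \<kappa>" and cardC: "|C| \<le>o \<kappa>"
    and \<beta>: "Cinfinite \<beta>" and \<kappa>\<beta>: "ctwo ^c (ctwo ^c (ctwo ^c \<kappa>)) \<le>o \<beta>"
    and v: "|{..<v}| \<le>o \<beta>" and w: "first_above (ctwo ^c (ctwo ^c \<beta>)) w"
    and z: "first_above (ctwo ^c (ctwo ^c (ctwo ^c \<beta>))) z"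
    and children: "\<And>i. [i] \<in> S \<Longrightarrow> arrows \<kappa> C (ds_below v) (sub S i)"
  shows "arrows \<kappa> C (ds_below z) S"
  unfolding arrows_def
proof (intro allI impI, elim conjE)
  fix c :: "'o list set list \<Rightarrow> 'o list set \<Rightarrow> 'm" and G :: "'o list set list set"
  assume c: "\<forall>g x. c g x \<in> C" and cardG: "|G| \<le>o \<kappa>"
  define \<kappa>1 where "\<kappa>1 = ctwo ^c \<kappa>"
  define \<kappa>2 where "\<kappa>2 = ctwo ^c \<kappa>1"
  define \<kappa>3 where "\<kappa>3 = ctwo ^c \<kappa>2"
  have \<kappa>1: "Cinfinite \<kappa>1" unfolding \<kappa>1_def by (rule Cinfinite_ctwo_cexp[OF \<kappa>])
  have \<kappa>2: "Cinfinite \<kappa>2" unfolding \<kappa>2_def by (rule Cinfinite_ctwo_cexp[OF \<kappa>1])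
  have le1: "\<kappa> \<le>o \<kappa>1" unfolding \<kappa>1_def by (rule ordLeq_ctwo_cexp) (simp add: \<kappa>)
  have le2: "\<kappa>1 \<le>o \<kappa>2" unfolding \<kappa>2_def by (rule ordLeq_ctwo_cexp) (simp add: \<kappa>1)
  have le3: "\<kappa>2 \<le>o \<kappa>3" unfolding \<kappa>3_def by (rule ordLeq_ctwo_cexp) (simp add: \<kappa>2)
  have \<kappa>3: "\<kappa>3 \<le>o \<beta>" using \<kappa>\<beta> unfolding \<kappa>1_def \<kappa>2_def \<kappa>3_def .
  define \<beta>2 where "\<beta>2 = ctwo ^c (ctwo ^c \<beta>)"
  define \<zeta> where "\<zeta> = ctwo ^c \<beta>2"
  have \<beta>1: "Cinfinite (ctwo ^c \<beta>)" by (rule Cinfinite_ctwo_cexp[OF \<beta>])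
  have \<beta>2: "Cinfinite \<beta>2" unfolding \<beta>2_def by (rule Cinfinite_ctwo_cexp[OF \<beta>1])
  have \<zeta>: "Cinfinite \<zeta>" unfolding \<zeta>_def by (rule Cinfinite_ctwo_cexp[OF \<beta>2])
  have le\<beta>: "\<beta> \<le>o ctwo ^c \<beta>" by (rule ordLeq_ctwo_cexp) (simp add: \<beta>)
  have le\<beta>': "ctwo ^c \<beta> \<le>o \<beta>2" unfolding \<beta>2_def by (rule ordLeq_ctwo_cexp) (simp add: \<beta>1)
  have le\<zeta>: "\<beta>2 \<le>o \<zeta>" unfolding \<zeta>_def by (rule ordLeq_ctwo_cexp) (simp add: \<beta>2)
  have \<kappa>1\<zeta>: "\<kappa>1 \<le>o \<zeta>" using le2 le3 \<kappa>3 le\<beta> le\<beta>' le\<zeta> by (metis (no_types) ordLeq_transitive)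
  have w: "first_above \<beta>2 w" using w unfolding \<beta>2_def .
  have z: "first_above \<zeta> z" using z unfolding \<zeta>_def \<beta>2_def .
  have wz: "w \<le> z"
  proof (rule ccontr)
    assume "\<not> w \<le> z"
    then have "|{..<z}| \<le>o \<beta>2" using w unfolding first_above_def by simp
    then have "|{..<z}| \<le>o \<zeta>" using le\<zeta> by (rule ordLeq_transitive)
    then show False using z unfolding first_above_def by blast
  qed
  let ?R = "{(x, y :: 'o). x < y}"
  define F where "F H = glue (fst \<circ> H) (snd \<circ> H)" for H :: "'o \<Rightarrow> 'o \<times> ('o list \<Rightarrow> 'o list)"
  define Good where "Good q i H jf \<longleftrightarrow>
      (\<forall>i'. [i'] \<in> S \<and> i' < i \<longrightarrow> fst (H i') < fst jf) \<and> fst jf < z \<and>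
      tree_embedding (snd jf) (sub S i) (ds_below (fst jf)) \<and>
      (\<forall>u\<in>Fpow (nodes_below S i). \<forall>g\<in>G.
        end_uniform (sub S i) (\<lambda>x. c g (F H ` u \<union> (#) (fst jf) ` snd jf ` x)) \<and>
        (\<forall>\<nu>\<in>sub S i. c g (insert (fst jf # snd jf \<nu>) (F H ` u)) = q (length \<nu>, u, g)))"
    for q :: "nat \<times> 'o list set \<times> 'o list set list \<Rightarrow> 'm" and i H jf
  have F_cong: "F H ` u = F H' ` u" if eq: "\<And>i'. i' < i \<Longrightarrow> H i' = H' i'" and u: "u \<subseteq> nodes_below S i" for H H' u i
  proof (rule image_cong[OF refl])
    fix \<eta> assume "\<eta> \<in> u"
    then obtain i' \<nu> where "\<eta> = i' # \<nu>" "i' < i" using u unfolding nodes_below_def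
      by (cases \<eta>) auto
    then show "F H \<eta> = F H' \<eta>" using eq[of i'] by (simp add: F_def)
  qed
  have Good_cong: "Good q i H = Good q' i H'"
    if H: "\<And>i'. i' < i \<Longrightarrow> H i' = H' i'"
      and q: "\<And>l u g. u \<in> Fpow (nodes_below S i) \<Longrightarrow> g \<in> G \<Longrightarrow> q (l, u, g) = q' (l, u, g)"
    for q q' i H H'
  proof (rule ext)
    fix jf
    have "F H ` u = F H' ` u" if "u \<in> Fpow (nodes_below S i)" for u
      using that by (intro F_cong[OF H]) (auto simp: Fpow_def)
    then show "Good q i H jf = Good q' i H' jf"
      unfolding Good_def using H q by (simp cong: conj_cong)
  qed
  define run where "run \<Phi> = wfrec ?R (\<lambda>h i. SOME jf. Good (\<Phi> h) i h jf)"
    for \<Phi> :: "('o \<Rightarrow> 'o \<times> ('o list \<Rightarrow> 'o list)) \<Rightarrow> nat \<times> 'o list set \<times> 'o list set list \<Rightarrow> 'm"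
  have run: "run \<Phi> i = (SOME jf. Good (\<Phi> (cut (run \<Phi>) ?R i)) i (cut (run \<Phi>) ?R i) jf)" for \<Phi> i
    unfolding run_def by (rule wfrec[OF wf])
  have cut: "cut H ?R i i' = H i'" if "i' < i" for H :: "'o \<Rightarrow> 'o \<times> ('o list \<Rightarrow> 'o list)" and i i'
    using that by (simp add: cut_def)

  define Dm where "Dm = (UNIV :: nat set) \<times> Fpow S \<times> G"
  define Q where "Q = Dm \<rightarrow>\<^sub>E C"
  have cardQ: "|Q| \<le>o \<kappa>1"
    unfolding Q_def Dm_def \<kappa>1_def
    by (intro card_of_extensional_ordLeq card_of_Times_ordLeq \<kappa> cardS cardC cardG card_of_nat_ordLeq)
  have cardS1: "|S| \<le>o \<kappa>1"
  proof -
    have "|S| \<le>o |Fpow S|" by (rule card_of_ordLeqI[of "\<lambda>s. {s}"]) (auto simp: Fpow_def)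
    then show ?thesis using ordLeq_transitive[OF ordLeq_transitive[OF _ cardS] le1] by blast
  qed
  define M where "M = (\<Union>(q, s)\<in>Q \<times> S. {F (run (\<lambda>_. q)) s})"
  define J where "J = (\<Union>(q, s)\<in>Q \<times> S. {fst (run (\<lambda>_. q) (hd s))}) \<inter> {..<z}"
  have cardQS: "|Q \<times> S| \<le>o \<kappa>1" by (rule card_of_Times_ordLeq[OF \<kappa>1 cardQ cardS1])
  have "M = (\<lambda>(q, s). F (run (\<lambda>_. q)) s) ` (Q \<times> S)" unfolding M_def by auto
  then have cardM: "|M| \<le>o \<kappa>1" using ordLeq_transitive[OF card_of_image cardQS] by simp
  have "J \<subseteq> (\<lambda>(q, s). fst (run (\<lambda>_. q) (hd s))) ` (Q \<times> S)" unfolding J_def by auto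
  then have cardJ: "|J| \<le>o \<kappa>1"
    by (rule ordLeq_transitive[OF ordLeq_transitive[OF card_of_mono1 card_of_image] cardQS])
  have "|{..<w}| \<le>o \<zeta>" unfolding \<zeta>_def by (rule first_above_card[OF \<beta>2 w])
  then have "|J \<union> {..<w}| \<le>o \<zeta>"
    by (intro Un_Cinfinite_bound \<zeta> ordLeq_transitive[OF cardJ \<kappa>1\<zeta>])
  moreover have "J \<union> {..<w} \<subseteq> {..<z}" using wz unfolding J_def by auto
  ultimately obtain j where j: "j < z" "\<And>y. y \<in> J \<Longrightarrow> y < j" "\<And>y. y < w \<Longrightarrow> y < j"
    using first_above_unbounded[OF \<zeta> z] by (metis UnCI lessThan_iff)
  have wj: "w \<le> j" using j(3) by (meson not_less order.irrefl)

  define d where "d \<nu> = (\<lambda>(x, g)\<in>Fpow M \<times> G. c g (insert (j # \<nu>) x))" for \<nu>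
  have "|Fpow M| \<le>o \<kappa>2" unfolding \<kappa>2_def by (rule card_of_Fpow_ordLeq[OF cardM]) (simp add: \<kappa>1)
  then have "|(Fpow M \<times> G) \<rightarrow>\<^sub>E C| \<le>o \<kappa>3"
    unfolding \<kappa>3_def
    by (intro card_of_extensional_ordLeq card_of_Times_ordLeq \<kappa>2
          ordLeq_transitive[OF ordLeq_transitive[OF cardG le1] le2]
          ordLeq_transitive[OF ordLeq_transitive[OF cardC le1] le2])
  moreover have "d ` ds_below w \<subseteq> (Fpow M \<times> G) \<rightarrow>\<^sub>E C" 
    unfolding d_def using c by (auto split: if_splits)
  ultimately have "|d ` ds_below w| \<le>o \<beta>"
    using ordLeq_transitive[OF ordLeq_transitive[OF card_of_mono1] \<kappa>3] by blast
  from ex_level_uniform[OF \<beta> v this w[unfolded \<beta>2_def]]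
  obtain g0 where g0: "tree_embedding g0 (ds_below v) (ds_below w)"
    "\<And>\<eta> \<nu>. \<eta> \<in> ds_below v \<Longrightarrow> \<nu> \<in> ds_below v \<Longrightarrow> length \<eta> = length \<nu> \<Longrightarrow> d (g0 \<eta>) = d (g0 \<nu>)"
    by blast

  \<comment> \<open>The type over the history \<open>h\<close> of the thinned tree above \<open>j\<close>, read off at one node of each level.\<close>
  define tp where "tp h = (\<lambda>(l, u, g). if \<exists>\<nu>\<in>ds_below v. length \<nu> = l
      then c g (insert (j # g0 (SOME \<nu>. \<nu> \<in> ds_below v \<and> length \<nu> = l)) (F h ` u)) else c g {})" for h
  define H where "H = run tp"
  define q where "q = restrict (tp H) Dm"
  have q: "q \<in> Q" unfolding q_def Q_def tp_def using c by auto
  have q_eq: "q (l, u, g) = tp (cut H ?R i) (l, u, g)" if "u \<in> Fpow (nodes_below S i)" "g \<in> G" for l u g i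
  proof -
    have "F (cut H ?R i) ` u = F H ` u" by (rule F_cong[OF cut]) (use that in \<open>auto simp: Fpow_def\<close>)
    moreover have "(l, u, g) \<in> Dm" using that unfolding Dm_def Fpow_def nodes_below_def by auto
    ultimately show ?thesis unfolding q_def tp_def by simp
  qed
  have H_some: "H i = (SOME jf. Good q i H jf)" for i
  proof -
    have "Good (tp (cut H ?R i)) i (cut H ?R i) = Good q i H"
      by (rule Good_cong) (use cut q_eq in auto)
    then show ?thesis using run[of tp i] unfolding H_def by simp
  qed
  have H_eq: "H i = run (\<lambda>_. q) i" for i
  proof (induction i rule: less_induct)
    case (less i)
    have "Good q i (cut (run (\<lambda>_. q)) ?R i) = Good q i H"
      by (rule Good_cong) (use cut less in auto)
    then show ?case using run[of "\<lambda>_. q" i] H_some by simp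
  qed
  have good: "Good q i H (H i)" if "[i] \<in> S" for i
    using that
  proof (induction i rule: less_induct)
    case (less i)
    let ?B = "Fpow (nodes_below S i)"
    define c' where "c' y x = c (tl y) (F H ` hd y \<union> (#) j ` g0 ` x)" for y x
    define G' where "G' = (\<lambda>(u, g). u # g) ` (?B \<times> G)"
    have "|?B| \<le>o |Fpow S|" by (rule card_of_mono1) (auto simp: Fpow_def nodes_below_def)
    then have "|?B \<times> G| \<le>o \<kappa>" by (intro card_of_Times_ordLeq \<kappa> cardG ordLeq_transitive[OF _ cardS])
    then have "|G'| \<le>o \<kappa>" unfolding G'_def by (rule ordLeq_transitive[OF card_of_image])
    moreover have "\<forall>y x. c' y x \<in> C" using c unfolding c'_def by blast
    ultimately obtain e where e: "tree_embedding e (sub S i) (ds_below v)"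
      "\<And>y. y \<in> G' \<Longrightarrow> end_uniform (sub S i) (\<lambda>x. c' y (e ` x))"
      using children[OF less.prems] unfolding arrows_def by meson
    \<comment> \<open>The thinned tree above \<open>j\<close> is a candidate at every stage, so the choice in \<open>run\<close> succeeds.\<close>
    have "Good q i H (j, g0 \<circ> e)"
      unfolding Good_def fst_conv snd_conv
    proof (intro conjI allI impI ballI)
      fix i' assume "[i'] \<in> S \<and> i' < i"
      then have i': "[i'] \<in> S" "Good q i' H (H i')" using less.IH by blast+
      have "fst (H i') \<in> J" unfolding J_def
      proof (intro IntI UN_I)
        show "(q, [i']) \<in> Q \<times> S" using q i' by simp
        show "fst (H i') \<in> (case (q, [i']) of (q, s) \<Rightarrow> {fst (run (\<lambda>_. q) (hd s))})"
          using H_eq by simp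
        show "fst (H i') \<in> {..<z}" using i'(2) unfolding Good_def by simp
      qed
      then show "fst (H i') < j" by (rule j(2))
    next
      show "j < z" by (rule j(1))
      show "tree_embedding (g0 \<circ> e) (sub S i) (ds_below j)"
        by (rule tree_embedding_mono[OF tree_embedding_comp[OF e(1) g0(1)] ds_below_mono[OF wj]])
    next
      fix u g assume u: "u \<in> ?B" and g: "g \<in> G"
      then have "u # g \<in> G'" unfolding G'_def by force
      from e(2)[OF this]
      show "end_uniform (sub S i) (\<lambda>x. c g (F H ` u \<union> (#) j ` (g0 \<circ> e) ` x))"
        unfolding c'_def by (simp add: image_comp)
      fix \<nu> assume \<nu>: "\<nu> \<in> sub S i"
      define \<xi> where "\<xi> = (SOME \<xi>. \<xi> \<in> ds_below v \<and> length \<xi> = length \<nu>)"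
      have e\<nu>: "e \<nu> \<in> ds_below v" "length (e \<nu>) = length \<nu>"
        using tree_embedding_mem[OF e(1) \<nu>] tree_embedding_length[OF e(1) \<nu>] by auto
      then have \<xi>: "\<xi> \<in> ds_below v" "length \<xi> = length \<nu>"
        using someI[of "\<lambda>\<xi>. \<xi> \<in> ds_below v \<and> length \<xi> = length \<nu>"] unfolding \<xi>_def by blast+
      have uS: "u \<subseteq> S" "finite u" using u by (auto simp: Fpow_def nodes_below_def)
      have "F H ` u \<subseteq> M"
      proof -
        have "H = run (\<lambda>_. q)" using H_eq by (rule ext)
        then have "F H s \<in> M" if "s \<in> S" for s unfolding M_def using q that by auto
        then show ?thesis using uS by auto
      qed
      then have FM: "(F H ` u, g) \<in> Fpow M \<times> G" using uS g by (auto simp: Fpow_def)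
      have "d (g0 (e \<nu>)) (F H ` u, g) = d (g0 \<xi>) (F H ` u, g)"
        using g0(2)[OF e\<nu>(1) \<xi>(1)] e\<nu> \<xi> by simp
      then have "c g (insert (j # g0 (e \<nu>)) (F H ` u)) = c g (insert (j # g0 \<xi>) (F H ` u))"
        using FM unfolding d_def by simp
      also have "\<dots> = tp H (length \<nu>, u, g)"
        using e\<nu> unfolding tp_def \<xi>_def by auto
      also have "\<dots> = q (length \<nu>, u, g)"
        using uS g unfolding q_def Dm_def by (simp add: Fpow_def)
      finally show "c g (insert (j # (g0 \<circ> e) \<nu>) (F H ` u)) = q (length \<nu>, u, g)" by simp
    qed
    then have "Good q i H (SOME jf. Good q i H jf)" by (rule someI)
    then show ?case unfolding H_some[symmetric] .
  qed

  have emb: "tree_embedding (F H) S (ds_below z)"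
    unfolding F_def
  proof (rule tree_embedding_glue[OF S])
    show "strict_mono_on {i. [i] \<in> S} (fst \<circ> H)"
      using good unfolding Good_def strict_mono_on_def by auto
    fix i assume "[i] \<in> S"
    then have "tree_embedding (snd (H i)) (sub S i) (ds_below (fst (H i)))" "fst (H i) < z"
      using good unfolding Good_def by blast+
    then show "tree_embedding ((snd \<circ> H) i) (sub S i) (sub (ds_below z) ((fst \<circ> H) i))"
      by (simp add: sub_ds_below)
  qed simp
  have "end_uniform S (\<lambda>x. c g (F H ` x))" if g: "g \<in> G" for g
  proof (rule end_uniform_children[OF S])
    fix i u assume iu: "[i] \<in> S" "u \<in> Fpow (nodes_below S i)"
    have "F H ` (#) i ` x = (#) (fst (H i)) ` snd (H i) ` x" for x
      by (simp add: image_image F_def)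
    then show "end_uniform (sub S i) (\<lambda>x. c g (F H ` (u \<union> (#) i ` x)))"
      using good[OF iu(1)] iu(2) g unfolding Good_def by (simp add: image_Un)
  next
    have eq: "c g (F H ` insert (i # \<nu>) u) = q (length \<nu>, u, g)"
      if "i # \<nu> \<in> S" "u \<in> Fpow (nodes_below S i)" for i \<nu> u
    proof -
      have "F H (i # \<nu>) = fst (H i) # snd (H i) \<nu>" by (simp add: F_def)
      then show ?thesis using good[OF tree_root[OF S that(1)]] that g unfolding Good_def by simp
    qed
    fix i i' \<nu> \<nu>' u
    assume "i # \<nu> \<in> S" "i' # \<nu>' \<in> S" "length \<nu> = length \<nu>'"
      "u \<in> Fpow (nodes_below S i)" "u \<in> Fpow (nodes_below S i')"
    then show "c g (F H ` insert (i # \<nu>) u) = c g (F H ` insert (i' # \<nu>') u)" by (simp only: eq)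
  qed
  then show "\<exists>f. tree_embedding f S (ds_below z) \<and> (\<forall>g\<in>G. end_uniform S (\<lambda>x. c g (f ` x)))"
    using emb by blast
qed

section \<open>From copies to subtrees\<close>

lemma end_uniform_cong:
  assumes "\<And>u. u \<in> Fpow S \<Longrightarrow> c u = c' u" and "end_uniform S c"
  shows "end_uniform S c'"
proof -
  have "c (set (\<eta>s @ [\<rho>])) = c' (set (\<eta>s @ [\<rho>]))" if "set \<eta>s \<subseteq> S" "\<rho> \<in> S" for \<eta>s \<rho>
    by (rule assms(1)) (use that in \<open>auto simp: Fpow_def\<close>)
  then show ?thesis using assms(2) unfolding end_uniform_def by metis
qed

lemma ex_uniform_subtree:
  assumes S: "tree S" and T: "tree T" and f: "tree_embedding f S T"
    and c: "end_uniform S (\<lambda>u. c (f ` u))"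
  shows "\<exists>T'. subtree T' T \<and> tree_isomorphic S T' \<and> end_uniform T' c"
proof (intro exI conjI)
  have ds: "T \<subseteq> ds" using T unfolding tree_def by blast
  show "subtree (f ` S) T"
    using tree_embedding_image_tree[OF f S ds] tree_embedding_mem[OF f] unfolding subtree_def by blast
  have "tree_embedding f S (f ` S)" using f unfolding tree_embedding_def by auto
  then show "tree_isomorphic S (f ` S)" unfolding tree_isomorphic_def by blast
  show "end_uniform (f ` S) c" by (rule end_uniform_image[OF f S c])
qed

text \<open>
The single index \<open>[]\<close> stands for the given colouring. Outside \<open>Fpow T\<close> its values are unknown, and it
is replaced there by the colour of the empty set, so that all values lie in \<open>C\<close>.
\<close>

lemma arrows_uniform_subtree:
  assumes S: "tree S" and T: "tree T" and a: "arrows \<kappa> C T S" and \<kappa>: "Card_order \<kappa>" "Field \<kappa> \<noteq> {}"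
    and c: "c \<in> Fpow T \<rightarrow> C"
  shows "\<exists>T'. subtree T' T \<and> tree_isomorphic S T' \<and> end_uniform T' c"
proof -
  define c' where "c' g x = (if x \<in> Fpow T then c x else c {})" for g :: "'a list set list" and x
  have "c' g x \<in> C" for g x using c unfolding c'_def by (auto simp: Fpow_def)
  moreover have "|{[] :: 'a list set list}| \<le>o \<kappa>" using \<kappa> by (rule Card_order_singl_ordLeq)
  ultimately obtain f where f: "tree_embedding f S T" "end_uniform S (\<lambda>x. c' [] (f ` x))"
    using a unfolding arrows_def by (metis singletonI)
  show ?thesis
  proof (rule ex_uniform_subtree[OF S T f(1) end_uniform_cong[OF _ f(2)]])
    fix u assume "u \<in> Fpow S"
    then have "f ` u \<in> Fpow T" using tree_embedding_mem[OF f(1)] by (auto simp: Fpow_def)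
    then show "c' [] (f ` u) = c (f ` u)" by (simp add: c'_def)
  qed
qed

section \<open>The beth hierarchy along a well-order\<close>

lemma Well_order_not_le:
  assumes "Well_order \<alpha>" "j \<in> Field \<alpha>" "i \<in> Field \<alpha>" "(j, i) \<notin> \<alpha>"
  shows "i \<noteq> j \<and> (i, j) \<in> \<alpha>"
proof -
  have "Refl \<alpha>" "Total \<alpha>"
    using assms(1) unfolding order_on_defs by simp_all
  then show ?thesis using assms(2-4) unfolding refl_on_def total_on_def by metis
qed

lemma ctwo_cexp_mono:
  assumes "r \<le>o s" "Cinfinite r"
  shows "ctwo ^c r \<le>o ctwo ^c s"
  by (rule cexp_mono2_Cnotzero[OF assms(1) Card_order_ctwo Cinfinite_Cnotzero[OF assms(2)]])

text \<open>
One step of the hierarchy is above all earlier values. In the limit case this is part of the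
definition; in the successor case it is Cantor's theorem for the last value, which dominates the
others by monotonicity.
\<close>

lemma beth_step_ge:
  assumes step: "beth_step \<kappa> \<alpha> b A \<theta>" and \<kappa>: "Card_order \<kappa>"
    and b: "\<And>j. j \<in> A \<Longrightarrow> Card_order (b j) \<and> \<kappa> \<le>o b j"
    and mono: "\<And>j k. j \<in> A \<Longrightarrow> k \<in> A \<Longrightarrow> (k, j) \<in> \<alpha> \<Longrightarrow> b k \<le>o b j"
  shows "\<kappa> \<le>o \<theta> \<and> (\<forall>j\<in>A. b j \<le>o \<theta>)"
proof -
  consider "A = {}" | m where "m \<in> A" "\<forall>i\<in>A. (i, m) \<in> \<alpha>"
    | "A \<noteq> {}" "\<not> (\<exists>m\<in>A. \<forall>i\<in>A. (i, m) \<in> \<alpha>)" by blast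
  then show ?thesis
  proof cases
    case 1
    then have "\<theta> =o \<kappa>" using step unfolding beth_step_def by simp
    then show ?thesis using 1 ordIso_symmetric[THEN ordIso_imp_ordLeq] by blast
  next
    case 2
    then have \<theta>: "\<theta> =o ctwo ^c b m" using step unfolding beth_step_def by (elim conjE; blast)
    have "b m \<le>o ctwo ^c b m" using b[OF 2(1)] by (intro ordLeq_ctwo_cexp) blast
    then have m: "b m \<le>o \<theta>" by (rule ordLeq_ordIso_trans[OF _ ordIso_symmetric[OF \<theta>]])
    have "\<kappa> \<le>o \<theta>" using b[OF 2(1)] m ordLeq_transitive by metis
    moreover have "b j \<le>o \<theta>" if "j \<in> A" for j
      using ordLeq_transitive[OF mono[OF 2(1) that] m] 2(2) that by blast
    ultimately show ?thesis by blast
  next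
    case 3
    then have u: "\<forall>i\<in>A. b i \<le>o \<theta>" using step unfolding beth_step_def by simp
    obtain j where "j \<in> A" using 3(1) by blast
    then have "\<kappa> \<le>o b j" "b j \<le>o \<theta>" using b u by blast+
    then have "\<kappa> \<le>o \<theta>" by (rule ordLeq_transitive)
    then show ?thesis using u by blast
  qed
qed

lemma is_beth_increasing:
  assumes "is_beth \<kappa> \<alpha> \<theta>" and wo: "Well_order \<alpha>" and \<kappa>: "Card_order \<kappa>"
  shows "\<exists>b. beth_step \<kappa> \<alpha> b (Field \<alpha>) \<theta> \<and>
    (\<forall>i\<in>Field \<alpha>. beth_step \<kappa> \<alpha> b (underS \<alpha> i) (b i) \<and> Card_order (b i) \<and> \<kappa> \<le>o b i \<and> b i \<le>o \<theta>) \<and>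
    (\<forall>i j. (i, j) \<in> \<alpha> \<longrightarrow> b i \<le>o b j)"
proof -
  obtain b where b: "\<And>i. i \<in> Field \<alpha> \<Longrightarrow> beth_step \<kappa> \<alpha> b (underS \<alpha> i) (b i)"
    "beth_step \<kappa> \<alpha> b (Field \<alpha>) \<theta>" using assms(1) unfolding is_beth_def by blast
  have card: "Card_order (b i)" if "i \<in> Field \<alpha>" for i
    using b(1)[OF that] unfolding beth_step_def by (rule conjunct1)
  have field: "k \<in> Field \<alpha>" if "k \<in> underS \<alpha> i" for i k using that by (auto simp: underS_def Field_def)
  have "wf (\<alpha> - Id)" using wo unfolding well_order_on_def by blast
  then have ge: "i \<in> Field \<alpha> \<longrightarrow> \<kappa> \<le>o b i \<and> (\<forall>j\<in>underS \<alpha> i. b j \<le>o b i)" for i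
  proof (induction i rule: wf_induct_rule)
    case (less i)
    show ?case
    proof
      assume i: "i \<in> Field \<alpha>"
      show "\<kappa> \<le>o b i \<and> (\<forall>j\<in>underS \<alpha> i. b j \<le>o b i)"
      proof (rule beth_step_ge[OF b(1)[OF i] \<kappa>])
        fix j assume j: "j \<in> underS \<alpha> i"
        then have ji: "(j, i) \<in> \<alpha> - Id" by (auto simp: underS_def)
        then show "Card_order (b j) \<and> \<kappa> \<le>o b j" using less card field[OF j] by blast
        fix k assume "k \<in> underS \<alpha> i" "(k, j) \<in> \<alpha>"
        show "b k \<le>o b j"
        proof (cases "k = j")
          case True
          then show ?thesis using ordLeq_refl card field[OF j] by blast
        next
          case False
          then have "k \<in> underS \<alpha> j" using \<open>(k, j) \<in> \<alpha>\<close> by (simp add: underS_def)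
          then show ?thesis using less[OF ji] field[OF j] by blast
        qed
      qed
    qed
  qed
  have mono: "b i \<le>o b j" if "(i, j) \<in> \<alpha>" for i j
  proof (cases "i = j")
    case True
    then show ?thesis using ordLeq_refl card that by (metis FieldI2)
  next
    case False
    then have "i \<in> underS \<alpha> j" using that by (simp add: underS_def)
    then show ?thesis using ge that by (meson FieldI2)
  qed
  have "\<kappa> \<le>o \<theta> \<and> (\<forall>j\<in>Field \<alpha>. b j \<le>o \<theta>)"
    by (rule beth_step_ge[OF b(2) \<kappa>]) (use card ge mono in auto)
  then show ?thesis by (intro exI[of _ b]) (use b card ge mono in auto)
qed

section \<open>Infinite trees\<close>

text \<open>
Say that a tree is reached if it has copies in \<open>ds_below a\<close> for some \<open>a\<close> with \<open>|{..<a}|\<close> bounded by a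
value \<open>\<beth>\<^sub>k\<close>, \<open>k < |S|\<^sup>+\<close>. If all trees \<open>sub S' i\<close> are reached then regularity of \<open>|S|\<^sup>+\<close> bounds their indices by
one \<open>l\<close>, and \<open>arrows_step\<close> reaches \<open>S'\<close> finitely many exponentiations later. Entries of \<open>sub S' i\<close> are
smaller than \<open>i\<close>, so all trees of size at most \<open>|S|\<close> with bounded entries are reached by
induction on the bound. The entries of \<open>S\<close> itself may be unbounded in \<open>'o\<close>, which calls for one more step
at the root.
\<close>

lemma uniform_copy_infinite:
  fixes S :: "'o::wellorder list set" and \<mu> :: "'m rel" and \<theta> :: "'o rel"
  assumes S: "tree S" and inf: "infinite S" and \<mu>: "Card_order \<mu>"
    and \<theta>: "is_beth ( |S| +c \<mu>) (cardSuc |S| ) \<theta>"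
  shows "\<exists>T :: 'o list set. tree T \<and>
           (\<forall>c. c \<in> Fpow T \<rightarrow> Field \<mu> \<longrightarrow>
              (\<exists>T'. subtree T' T \<and> tree_isomorphic S T' \<and> end_uniform T' c)) \<and>
           |T| <o \<theta>"
proof -
  define \<alpha> where "\<alpha> = cardSuc |S|"
  define \<kappa>0 where "\<kappa>0 = |S| +c \<mu>"
  have Sinf: "Cinfinite |S|" 
    by (intro conjI card_of_Card_order) (simp add: cinfinite_def Field_card_of inf)
  have \<kappa>0: "Cinfinite \<kappa>0" unfolding \<kappa>0_def using Sinf by (rule Cinfinite_csum1)
  have \<alpha>: "Cinfinite \<alpha>" unfolding \<alpha>_def using Sinf by (rule Cinfinite_cardSuc)
  then have wo: "Well_order \<alpha>" unfolding card_order_on_def by blast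
  have "Card_order \<kappa>0" using \<kappa>0 by simp
  from is_beth_increasing[OF \<theta>[folded \<kappa>0_def \<alpha>_def] wo this]
  obtain b where top: "beth_step \<kappa>0 \<alpha> b (Field \<alpha>) \<theta>" and
    bs: "\<forall>i\<in>Field \<alpha>. beth_step \<kappa>0 \<alpha> b (underS \<alpha> i) (b i) \<and> Card_order (b i) \<and> \<kappa>0 \<le>o b i \<and> b i \<le>o \<theta>"
    "\<forall>i j. (i, j) \<in> \<alpha> \<longrightarrow> b i \<le>o b j" by (elim exE conjE)
  have b: "\<And>i. i \<in> Field \<alpha> \<Longrightarrow> beth_step \<kappa>0 \<alpha> b (underS \<alpha> i) (b i)"
    "\<And>i. i \<in> Field \<alpha> \<Longrightarrow> Card_order (b i) \<and> \<kappa>0 \<le>o b i \<and> b i \<le>o \<theta>"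
    "\<And>i j. (i, j) \<in> \<alpha> \<Longrightarrow> b i \<le>o b j" "Card_order \<theta>"
    using bs top unfolding beth_step_def by blast+
  have b_inf: "Cinfinite (b i)" if "i \<in> Field \<alpha>" for i
    using b(2)[OF that] \<kappa>0 cinfinite_mono[of \<kappa>0 "b i"] by simp
  have next_beth: "\<exists>k\<in>Field \<alpha>. (i, k) \<in> \<alpha> \<and> ctwo ^c b i \<le>o b k" if i: "i \<in> Field \<alpha>" for i
  proof -
    define A where "A = {k. i \<in> underS \<alpha> k}"
    have "A \<noteq> {}"
      using infinite_Card_order_limit[of \<alpha> i] \<alpha> i unfolding A_def cinfinite_def underS_def by blast
    moreover have "wf (\<alpha> - Id)" using wo unfolding well_order_on_def by blast
    ultimately have "\<exists>k\<in>A. \<forall>y. (y, k) \<in> \<alpha> - Id \<longrightarrow> y \<notin> A" unfolding wf_eq_minimal by blast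
    then obtain k where k: "k \<in> A" "\<And>y. (y, k) \<in> \<alpha> - Id \<Longrightarrow> y \<notin> A" by blast
    then have ik: "(i, k) \<in> \<alpha>" "i \<in> underS \<alpha> k" unfolding A_def underS_def by blast+
    have kF: "k \<in> Field \<alpha>" using ik(1) by (rule FieldI2)
    have "(j, i) \<in> \<alpha>" if "j \<in> underS \<alpha> k" for j
    proof (rule ccontr)
      assume nj: "(j, i) \<notin> \<alpha>"
      have j: "(j, k) \<in> \<alpha> - Id" "j \<in> Field \<alpha>" using that by (auto simp: underS_def Field_def)
      have "i \<noteq> j" "(i, j) \<in> \<alpha>"
        using Well_order_not_le[OF wo j(2) i nj] by simp_all
      then have "j \<in> A" unfolding A_def underS_def by blast
      then show False using k(2)[OF j(1)] by blast
    qed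
    then have "b k =o ctwo ^c b i"
      using b(1)[OF kF] ik(2) unfolding beth_step_def by (elim conjE; blast)
    then have "ctwo ^c b i \<le>o b k" by (rule ordIso_imp_ordLeq[OF ordIso_symmetric])
    then show ?thesis using kF ik(1) by blast
  qed
  have up: "\<exists>k'\<in>Field \<alpha>. ctwo ^c r \<le>o b k'" if "Cinfinite r" "r \<le>o b k" "k \<in> Field \<alpha>" for r :: "'z rel" and k
    using next_beth[OF that(3)] ordLeq_transitive[OF ctwo_cexp_mono[OF that(2,1)]] by blast
  have less_\<theta>: "r <o \<theta>" if r: "Card_order r" "r \<le>o b k" "k \<in> Field \<alpha>" for r :: "'z rel" and k
  proof -
    obtain k' where "k' \<in> Field \<alpha>" "ctwo ^c b k \<le>o b k'" using next_beth[OF r(3)] by blast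
    then have "ctwo ^c b k \<le>o \<theta>" using b(2)[of k'] ordLeq_transitive[of _ "b k'" \<theta>] by simp
    moreover have "b k <o ctwo ^c b k" using b(2)[OF r(3)] by (intro ordLess_ctwo_cexp) blast
    ultimately have "b k <o \<theta>" by (rule ordLess_ordLeq_trans[rotated])
    then show ?thesis by (rule ordLeq_ordLess_trans[OF r(2)])
  qed
  have \<theta>_UNIV: "\<theta> \<le>o |UNIV :: 'o set|"
    by (rule ordIso_ordLeq_trans[OF ordIso_symmetric[OF card_of_Field_ordIso[OF b(4)]] card_of_mono1]) simp
  have ex_first: "\<exists>a :: 'o. first_above r a" if r: "Cinfinite r" "r \<le>o b k" "k \<in> Field \<alpha>" for r :: "'z rel" and k
  proof (rule ex_first_above[OF r(1)])
    obtain k' where k': "k' \<in> Field \<alpha>" "ctwo ^c r \<le>o b k'" using up[OF r] by blast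
    have "ctwo ^c r <o \<theta>" using less_\<theta>[OF Card_order_cexp k'(2,1)] .
    then have "ctwo ^c r <o |UNIV :: 'o set|" using \<theta>_UNIV by (rule ordLess_ordLeq_trans)
    then show "\<not> |UNIV :: 'o set| \<le>o ctwo ^c r" using not_ordLess_ordLeq by blast
  qed
  have bounded: "\<exists>k\<in>Field \<alpha>. \<forall>i\<in>K. (i, k) \<in> \<alpha>" if K: "K \<subseteq> Field \<alpha>" "|K| \<le>o |S|" for K
  proof (rule ccontr)
    assume neg: "\<not> ?thesis"
    have "cofinal K \<alpha>"
      unfolding cofinal_def
    proof
      fix a assume a: "a \<in> Field \<alpha>"
      then obtain i where i: "i \<in> K" "(i, a) \<notin> \<alpha>" using neg by blast
      then have "i \<noteq> a \<and> (a, i) \<in> \<alpha>"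
        using a K(1) Well_order_not_le[OF wo _ a i(2)] by blast
      then show "\<exists>i\<in>K. a \<noteq> i \<and> (a, i) \<in> \<alpha>" using i(1) by blast
    qed
    moreover have "regularCard \<alpha>" unfolding \<alpha>_def by (rule regularCard_cardSuc[OF Sinf])
    ultimately have "|K| =o \<alpha>" using K(1) unfolding regularCard_def by blast
    then have "\<alpha> \<le>o |S|" by (rule ordIso_ordLeq_trans[OF ordIso_symmetric K(2)])
    moreover have "|S| <o \<alpha>" unfolding \<alpha>_def by (rule cardSuc_greater[OF card_of_Card_order])
    ultimately show False using not_ordLess_ordLeq by blast
  qed

  define \<kappa> where "\<kappa> = ctwo ^c \<kappa>0"
  have \<kappa>: "Cinfinite \<kappa>" unfolding \<kappa>_def by (rule Cinfinite_ctwo_cexp[OF \<kappa>0])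
  have S\<kappa>0: "|S| \<le>o \<kappa>0" unfolding \<kappa>0_def by (rule ordLeq_csum1[OF card_of_Card_order])
  have card\<mu>: "|Field \<mu>| \<le>o \<kappa>"
  proof -
    have "|Field \<mu>| \<le>o \<kappa>0"
      unfolding \<kappa>0_def by (rule ordIso_ordLeq_trans[OF card_of_Field_ordIso[OF \<mu>] ordLeq_csum2[OF \<mu>]])
    moreover have "\<kappa>0 \<le>o ctwo ^c \<kappa>0" by (rule ordLeq_ctwo_cexp) (use \<kappa>0 in simp)
    ultimately show ?thesis unfolding \<kappa>_def by (rule ordLeq_transitive)
  qed
  have c1: "Cinfinite (ctwo ^c \<kappa>)" by (rule Cinfinite_ctwo_cexp[OF \<kappa>])
  have c2: "Cinfinite (ctwo ^c (ctwo ^c \<kappa>))" by (rule Cinfinite_ctwo_cexp[OF c1])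
  obtain k0 where k0: "k0 \<in> Field \<alpha>" using \<alpha> unfolding cinfinite_def by fastforce
  then have "\<kappa>0 \<le>o b k0" using b(2) by blast
  from up[OF \<kappa>0 this k0] obtain k1 where k1: "k1 \<in> Field \<alpha>" "\<kappa> \<le>o b k1" unfolding \<kappa>_def by blast
  from up[OF \<kappa> k1(2,1)] obtain k2 where k2: "k2 \<in> Field \<alpha>" "ctwo ^c \<kappa> \<le>o b k2" by blast
  from up[OF c1 k2(2,1)] obtain k3 where k3: "k3 \<in> Field \<alpha>" "ctwo ^c (ctwo ^c \<kappa>) \<le>o b k3" by blast
  from up[OF c2 k3(2,1)] obtain kb
    where kb: "kb \<in> Field \<alpha>" "ctwo ^c (ctwo ^c (ctwo ^c \<kappa>)) \<le>o b kb" by blast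

  define reach where "reach S' \<longleftrightarrow>
      (\<exists>k\<in>Field \<alpha>. \<exists>a. |{..<a}| \<le>o b k \<and> arrows \<kappa> (Field \<mu>) (ds_below a) S')" for S' :: "'o list set"
  have step: "reach S'" if S': "tree S'" "|S'| \<le>o |S|" and ch: "\<And>i. [i] \<in> S' \<Longrightarrow> reach (sub S' i)" for S'
  proof -
    obtain k a where ka: "\<And>i. [i] \<in> S' \<Longrightarrow> k i \<in> Field \<alpha>"
      "\<And>i. [i] \<in> S' \<Longrightarrow> |{..<a i}| \<le>o b (k i)"
      "\<And>i. [i] \<in> S' \<Longrightarrow> arrows \<kappa> (Field \<mu>) (ds_below (a i)) (sub S' i)"
      using ch unfolding reach_def by metis
    have one: "|{kb}| \<le>o |S|" 
      by (rule Card_order_singl_ordLeq[OF card_of_Card_order]) (use inf in \<open>auto simp: Field_card_of\<close>)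
    have "|{i. [i] \<in> S'}| \<le>o |S'|" by (rule card_of_ordLeqI[of "\<lambda>i. [i]"]) (auto simp: inj_on_def)
    then have "|k ` {i. [i] \<in> S'}| \<le>o |S|"
      by (rule ordLeq_transitive[OF card_of_image ordLeq_transitive[OF _ S'(2)]])
    then have "|k ` {i. [i] \<in> S'} \<union> {kb}| \<le>o |S|" by (rule Un_Cinfinite_bound[OF _ one Sinf])
    then obtain l where l: "l \<in> Field \<alpha>" "\<And>i. [i] \<in> S' \<Longrightarrow> (k i, l) \<in> \<alpha>" "(kb, l) \<in> \<alpha>"
      using bounded[of "k ` {i. [i] \<in> S'} \<union> {kb}"] ka(1) kb(1) by auto
    obtain v :: 'o where v: "first_above (b l) v"
      using ex_first[OF b_inf[OF l(1)] _ l(1)] b(2)[OF l(1)] ordLeq_refl[of "b l"] by auto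
    obtain l' where l': "l' \<in> Field \<alpha>" "(l, l') \<in> \<alpha>" "ctwo ^c b l \<le>o b l'"
      using next_beth[OF l(1)] by blast
    define \<beta> where "\<beta> = b l'"
    have \<beta>: "Cinfinite \<beta>" unfolding \<beta>_def by (rule b_inf[OF l'(1)])
    have \<beta>1: "Cinfinite (ctwo ^c \<beta>)" by (rule Cinfinite_ctwo_cexp[OF \<beta>])
    have \<beta>2: "Cinfinite (ctwo ^c (ctwo ^c \<beta>))" by (rule Cinfinite_ctwo_cexp[OF \<beta>1])
    have \<beta>3: "Cinfinite (ctwo ^c (ctwo ^c (ctwo ^c \<beta>)))" by (rule Cinfinite_ctwo_cexp[OF \<beta>2])
    have "\<beta> \<le>o b l'" unfolding \<beta>_def using b(2)[OF l'(1)] ordLeq_refl[of "b l'"] by simp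
    from up[OF \<beta> this l'(1)] obtain m1 where m1: "m1 \<in> Field \<alpha>" "ctwo ^c \<beta> \<le>o b m1" by blast
    from up[OF \<beta>1 m1(2,1)] obtain m2 where m2: "m2 \<in> Field \<alpha>" "ctwo ^c (ctwo ^c \<beta>) \<le>o b m2" by blast
    from up[OF \<beta>2 m2(2,1)] obtain m3
      where m3: "m3 \<in> Field \<alpha>" "ctwo ^c (ctwo ^c (ctwo ^c \<beta>)) \<le>o b m3" by blast
    from up[OF \<beta>3 m3(2,1)] obtain m4
      where m4: "m4 \<in> Field \<alpha>" "ctwo ^c (ctwo ^c (ctwo ^c (ctwo ^c \<beta>))) \<le>o b m4" by blast
    obtain w :: 'o where w: "first_above (ctwo ^c (ctwo ^c \<beta>)) w" using ex_first[OF \<beta>2 m2(2,1)] by blast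
    obtain z :: 'o where z: "first_above (ctwo ^c (ctwo ^c (ctwo ^c \<beta>))) z"
      using ex_first[OF \<beta>3 m3(2,1)] by blast
    have "arrows \<kappa> (Field \<mu>) (ds_below z) S'"
    proof (rule arrows_step[OF S'(1) \<kappa> _ card\<mu> \<beta> _ _ w z])
      show "|Fpow S'| \<le>o \<kappa>"
        unfolding \<kappa>_def by (rule card_of_Fpow_ordLeq[OF ordLeq_transitive[OF S'(2) S\<kappa>0]]) (simp add: \<kappa>0)
      show "ctwo ^c (ctwo ^c (ctwo ^c \<kappa>)) \<le>o \<beta>"
        unfolding \<beta>_def by (rule ordLeq_transitive[OF kb(2) ordLeq_transitive[OF b(3)[OF l(3)] b(3)[OF l'(2)]]])
      show "|{..<v}| \<le>o \<beta>"
        unfolding \<beta>_def by (rule ordLeq_transitive[OF first_above_card[OF b_inf[OF l(1)] v] l'(3)])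
      fix i assume i: "[i] \<in> S'"
      have "a i \<le> v"
      proof (rule ccontr)
        assume "\<not> a i \<le> v"
        then have "|{..<v}| \<le>o |{..<a i}|" by (intro card_of_mono1) auto
        then have "|{..<v}| \<le>o b l"
          by (rule ordLeq_transitive[OF _ ordLeq_transitive[OF ka(2)[OF i] b(3)[OF l(2)[OF i]]]])
        then show False using v unfolding first_above_def by blast
      qed
      then show "arrows \<kappa> (Field \<mu>) (ds_below v) (sub S' i)" by (rule arrows_mono[OF ka(3)[OF i] ds_below_mono])
    qed
    moreover have "|{..<z}| \<le>o b m4" by (rule ordLeq_transitive[OF first_above_card[OF \<beta>3 z] m4(2)])
    ultimately show ?thesis using m4(1) unfolding reach_def by blast
  qed
  have card_sub: "|sub S' i| \<le>o |S'|" for S' :: "'o list set" and i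
    by (rule card_of_ordLeqI[of "(#) i"]) auto
  have below: "\<forall>S'. tree S' \<and> |S'| \<le>o |S| \<and> (\<forall>i. [i] \<in> S' \<longrightarrow> i < x) \<longrightarrow> reach S'" for x :: 'o
  proof (induction x rule: less_induct)
    case (less x)
    show ?case
    proof (intro allI impI, elim conjE)
      fix S' assume S': "tree S'" "|S'| \<le>o |S|" "\<forall>i. [i] \<in> S' \<longrightarrow> i < x"
      show "reach S'"
      proof (rule step[OF S'(1,2)])
        fix i assume i: "[i] \<in> S'"
        show "reach (sub S' i)"
          using sub_root_less[OF S'(1)] less.IH[of i] i S' tree_sub[OF S'(1) i] ordLeq_transitive[OF card_sub S'(2)] by blast
      qed
    qed
  qed
  have "reach S"
  proof (rule step[OF S])
    show "|S| \<le>o |S|" by (rule ordLeq_refl[OF card_of_Card_order])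
    fix i assume i: "[i] \<in> S"
    show "reach (sub S i)" using sub_root_less[OF S] below[of i] tree_sub[OF S i] card_sub by blast
  qed
  then obtain k and a :: 'o where ka: "k \<in> Field \<alpha>" "|{..<a}| \<le>o b k" "arrows \<kappa> (Field \<mu>) (ds_below a) S"
    unfolding reach_def by blast
  have "|ds_below a| \<le>o ctwo ^c b k" by (rule card_of_ds_below_ordLeq[OF b_inf[OF ka(1)] ka(2)])
  moreover obtain k' where k': "k' \<in> Field \<alpha>" "ctwo ^c b k \<le>o b k'" using next_beth[OF ka(1)] by blast
  ultimately have "|ds_below a| \<le>o b k'" by (simp add: ordLeq_transitive[of "|ds_below a|" "ctwo ^c b k"])
  then have "|ds_below a| <o \<theta>" using less_\<theta>[OF card_of_Card_order _ k'(1)] by blast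
  moreover have "\<forall>c. c \<in> Fpow (ds_below a) \<rightarrow> Field \<mu> \<longrightarrow>
      (\<exists>T'. subtree T' (ds_below a) \<and> tree_isomorphic S T' \<and> end_uniform T' c)"
    using arrows_uniform_subtree[OF S tree_ds_below ka(3)] \<kappa> unfolding cinfinite_def by fastforce
  ultimately show ?thesis using tree_ds_below by blast
qed

section \<open>Thinning trees with large sets of children\<close>

text \<open>
In \<open>full big t h X\<close> the set \<open>X\<close> is a tree all of whose branches have length \<open>h\<close>, and \<open>big t\<close> holds for the set of
children of each node below the top. The number \<open>t\<close> counts how many more thinnings the tree can stand.
\<close>

primrec full :: "(nat \<Rightarrow> 'o set \<Rightarrow> bool) \<Rightarrow> nat \<Rightarrow> nat \<Rightarrow> 'o list set \<Rightarrow> bool" where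
  "full big t 0 X \<longleftrightarrow> X = {[]}"
| "full big t (Suc h) X \<longleftrightarrow> [] \<in> X \<and> big t {b. [b] \<in> X} \<and> (\<forall>b \<nu>. b # \<nu> \<in> X \<longrightarrow> [b] \<in> X) \<and>
     (\<forall>b. [b] \<in> X \<longrightarrow> full big t h (sub X b))"

text \<open>
A pigeonhole principle, for a colouring whose colours are themselves functions \<open>D \<rightarrow> C\<close> with at most \<open>N\<close>
arguments. Only elements to the right of \<open>x\<close> are kept. The point \<open>x\<close> does not depend on
the colouring: it is the place of the next copy, and the colouring is the type over this
copy.
\<close>

definition splits_at ::
    "(nat \<Rightarrow> 'o::wellorder set \<Rightarrow> bool) \<Rightarrow> 'm set \<Rightarrow> nat \<Rightarrow> nat \<Rightarrow> 'o set \<Rightarrow> 'o \<Rightarrow> bool" where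
  "splits_at big C N t X x \<longleftrightarrow>
     (\<forall>(D :: (nat \<times> 'o list set list) set) f. finite D \<longrightarrow> card D \<le> N \<longrightarrow> f \<in> X \<rightarrow> (D \<rightarrow>\<^sub>E C) \<longrightarrow>
        (\<exists>y. big t {b \<in> X. x < b \<and> f b = y}))"

text \<open>
For finite \<open>C\<close> this is achieved by cardinalities that are powers of a large number
(\<open>divisible_finite\<close>), otherwise by cardinality above an infinite bound of \<open>|C|\<close>, where \<open>t\<close> need not be counted
(\<open>divisible_infinite\<close>).
\<close>

definition divisible :: "(nat \<Rightarrow> 'o::wellorder set \<Rightarrow> bool) \<Rightarrow> 'm set \<Rightarrow> nat \<Rightarrow> bool" where
  "divisible big C N \<longleftrightarrow>
     (\<forall>t X. big t X \<longrightarrow> X \<noteq> {}) \<and>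
     (\<forall>t X. big (Suc t) X \<longrightarrow> (\<exists>x\<in>X. splits_at big C N t X x))"

definition thins_at ::
    "(nat \<Rightarrow> 'o::wellorder set \<Rightarrow> bool) \<Rightarrow> 'm set \<Rightarrow> nat \<Rightarrow> nat \<Rightarrow> nat \<Rightarrow> 'o list set \<Rightarrow> 'o \<Rightarrow> bool" where
  "thins_at big C N t h X x \<longleftrightarrow>
     (\<forall>(U :: 'o list set list set) (d :: 'o list set list \<Rightarrow> 'o list \<Rightarrow> 'm).
        finite U \<longrightarrow> h * card U \<le> N \<longrightarrow> (\<forall>g \<nu>. d g \<nu> \<in> C) \<longrightarrow>
        (\<exists>Y\<subseteq>X. full big t h Y \<and> (\<forall>b. [b] \<in> Y \<longrightarrow> x < b) \<and>
          (\<forall>g\<in>U. \<forall>\<nu>\<in>Y. \<forall>\<nu>'\<in>Y. length \<nu> = length \<nu>' \<longrightarrow> d g \<nu> = d g \<nu>')))"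

lemma full_Nil: "full big t h X \<Longrightarrow> [] \<in> X"
  by (cases h) auto

lemma full_length: "full big t h X \<Longrightarrow> \<nu> \<in> X \<Longrightarrow> length \<nu> \<le> h"
proof (induction h arbitrary: X \<nu>)
  case (Suc h)
  show ?case
  proof (cases \<nu>)
    case (Cons b \<xi>)
    then have "[b] \<in> X" using Suc.prems by auto
    then have "length \<xi> \<le> h" using Suc.IH[of "sub X b" \<xi>] Suc.prems Cons by simp
    then show ?thesis using Cons by simp
  qed simp
qed auto

lemma full_levels:
  assumes "divisible big C N"
  shows "full big t h X \<Longrightarrow> l \<le> h \<Longrightarrow> \<exists>\<nu>\<in>X. length \<nu> = l"
proof (induction h arbitrary: X l)
  case (Suc h)
  show ?case
  proof (cases l)
    case 0
    then show ?thesis using full_Nil[OF Suc.prems(1)] by auto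
  next
    case (Suc l')
    have "big t {b. [b] \<in> X}" using Suc.prems(1) by simp
    then have "{b. [b] \<in> X} \<noteq> {}" using assms unfolding divisible_def by blast
    then obtain b where b: "[b] \<in> X" by blast
    then have "full big t h (sub X b)" using Suc.prems(1) by simp
    then obtain \<nu> where "\<nu> \<in> sub X b" "length \<nu> = l'" using Suc.IH Suc.prems(2) \<open>l = Suc l'\<close> by fastforce
    then show ?thesis using \<open>l = Suc l'\<close> by (intro bexI[of _ "b # \<nu>"]) auto
  qed
qed auto

text \<open>
By induction the tree above each child \<open>b\<close> is thinned to \<open>Y b\<close>, on which the colours depend only on the
level. The resulting sequence of colours is a colour of \<open>b\<close> itself, and one application of the
pigeonhole principle to the children makes it constant. The whole tree thus loses only one
step of \<open>t\<close>, at whichever height.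
\<close>

lemma full_thin:
  fixes X :: "'o::wellorder list set" and C :: "'m set"
  assumes big: "divisible big C N"
  shows "full big (Suc t) h X \<Longrightarrow> \<exists>x. (h \<noteq> 0 \<longrightarrow> [x] \<in> X) \<and> thins_at big C N t h X x"
proof (induction h arbitrary: X)
  case 0
  then show ?case by (auto simp: thins_at_def)
next
  case (Suc h)
  let ?I = "{b. [b] \<in> X}"
  have "big (Suc t) ?I" using Suc.prems by simp
  then obtain x where x: "x \<in> ?I" and split: "splits_at big C N t ?I x"
    using big unfolding divisible_def by blast
  have "thins_at big C N t (Suc h) X x"
    unfolding thins_at_def
  proof (intro allI impI)
    fix U :: "'o list set list set" and d :: "'o list set list \<Rightarrow> 'o list \<Rightarrow> 'm"
    assume 2: "finite U" "Suc h * card U \<le> N" "\<forall>g \<nu>. d g \<nu> \<in> C"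
    have "\<exists>Y\<subseteq>sub X b. full big t h Y \<and>
        (\<forall>g\<in>U. \<forall>\<nu>\<in>Y. \<forall>\<nu>'\<in>Y. length \<nu> = length \<nu>' \<longrightarrow> d g (b # \<nu>) = d g (b # \<nu>'))"
      if b: "[b] \<in> X" for b
    proof -
      have "full big (Suc t) h (sub X b)" using Suc.prems b by simp
      from Suc.IH[OF this] obtain x' where "thins_at big C N t h (sub X b) x'" by blast
      from this[unfolded thins_at_def, rule_format, of U "\<lambda>g \<nu>. d g (b # \<nu>)"] 2 show ?thesis by auto
    qed
    then obtain Y where Y: "\<And>b. [b] \<in> X \<Longrightarrow> Y b \<subseteq> sub X b" "\<And>b. [b] \<in> X \<Longrightarrow> full big t h (Y b)"
      "\<And>b g \<nu> \<nu>'. [b] \<in> X \<Longrightarrow> g \<in> U \<Longrightarrow> \<nu> \<in> Y b \<Longrightarrow> \<nu>' \<in> Y b \<Longrightarrow> length \<nu> = length \<nu>' \<Longrightarrow>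
        d g (b # \<nu>) = d g (b # \<nu>')"
      by metis
    define rep where "rep b l = (SOME \<nu>. \<nu> \<in> Y b \<and> length \<nu> = l)" for b l
    have rep: "rep b l \<in> Y b \<and> length (rep b l) = l" if "[b] \<in> X" "l \<le> h" for b l
    proof -
      have "\<exists>\<nu>. \<nu> \<in> Y b \<and> length \<nu> = l" using full_levels[OF big Y(2)[OF that(1)] that(2)] by blast
      then show ?thesis unfolding rep_def by (rule someI_ex)
    qed
    define D where "D = {..h} \<times> U"
    define f where "f b = (\<lambda>(l, g)\<in>D. d g (b # rep b l))" for b
    have "finite D" "card D \<le> N" using 2 by (simp_all add: D_def card_cartesian_product)
    moreover have "f \<in> ?I \<rightarrow> (D \<rightarrow>\<^sub>E C)" using 2 unfolding f_def by (auto split: if_splits)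
    ultimately obtain y where y: "big t {b \<in> ?I. x < b \<and> f b = y}"
      using split[unfolded splits_at_def, rule_format, of D f] by blast
    define B where "B = {b \<in> ?I. x < b \<and> f b = y}"
    define Z where "Z = insert [] {b # \<nu> | b \<nu>. b \<in> B \<and> \<nu> \<in> Y b}"
    have root: "[b] \<in> Z \<longleftrightarrow> b \<in> B" for b
      using full_Nil[OF Y(2)] unfolding Z_def B_def by auto
    have "b # \<nu> \<in> X" if "b \<in> B" "\<nu> \<in> Y b" for b \<nu> using Y(1)[of b] that unfolding B_def by auto
    then have "Z \<subseteq> X" using full_Nil[OF Suc.prems] unfolding Z_def by auto
    moreover have "full big t (Suc h) Z"
    proof -
      have "sub Z b = Y b" if "b \<in> B" for b using that unfolding Z_def sub_def by auto
      moreover have "{b. [b] \<in> Z} = B" using root by auto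
      ultimately show ?thesis using y Y(2) root unfolding B_def[symmetric]
        by (auto simp: Z_def B_def)
    qed
    moreover have "\<forall>b. [b] \<in> Z \<longrightarrow> x < b" unfolding root B_def by auto
    moreover have "d g \<nu> = d g \<nu>'" if "g \<in> U" "\<nu> \<in> Z" "\<nu>' \<in> Z" "length \<nu> = length \<nu>'" for g \<nu> \<nu>'
    proof (cases \<nu>)
      case Nil
      then show ?thesis using that by simp
    next
      case (Cons b \<xi>)
      then have "\<nu>' \<noteq> []" using that(4) by auto
      then obtain b' \<xi>' where \<nu>': "\<nu>' = b' # \<xi>'" by (cases \<nu>') auto
      have b: "[b] \<in> X" "f b = y" "\<xi> \<in> Y b" "[b'] \<in> X" "f b' = y" "\<xi>' \<in> Y b'"
        using that(2,3) unfolding Cons \<nu>' Z_def B_def by auto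
      define l where "l = length \<xi>"
      have l: "l \<le> h" "length \<xi>' = l"
        using full_length[OF Y(2)] b that(4) unfolding l_def Cons \<nu>' by auto
      then have "(l, g) \<in> D" using that(1) unfolding D_def by simp
      have "d g (b # rep b l) = d g (b' # rep b' l)"
      proof -
        have "f b (l, g) = f b' (l, g)" using b(2,5) by simp
        then show ?thesis using \<open>(l, g) \<in> D\<close> unfolding f_def by simp
      qed
      moreover have "d g (b # \<xi>) = d g (b # rep b l)"
        using Y(3)[OF b(1) that(1) b(3)] rep[OF b(1) l(1)] unfolding l_def by simp
      moreover have "d g (b' # \<xi>') = d g (b' # rep b' l)"
        using Y(3)[OF b(4) that(1) b(6)] rep[OF b(4) l(1)] l(2) by simp
      ultimately show ?thesis unfolding Cons \<nu>' by simp
    qed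
    ultimately show "\<exists>Y\<subseteq>X. full big t (Suc h) Y \<and> (\<forall>b. [b] \<in> Y \<longrightarrow> x < b) \<and>
        (\<forall>g\<in>U. \<forall>\<nu>\<in>Y. \<forall>\<nu>'\<in>Y. length \<nu> = length \<nu>' \<longrightarrow> d g \<nu> = d g \<nu>')"
      by blast
  qed
  then show ?case using x by blast
qed

text \<open>
The children of \<open>S\<close> are placed from left to right. At the stage \<open>K\<close>, where \<open>K\<close> is the set of children
already placed, \<open>Y\<close> is the part of \<open>X\<close> that is left: it is to the right of all copies and
level-uniform over them. The next copy is found in \<open>Y\<close> above the child given by \<open>full_thin\<close>, and its
nodes have the same colours over earlier nodes as the nodes that remain in \<open>Y\<close>. At the end any node
of \<open>Y\<close> serves to compare the colours of different children. The index set grows from \<open>G\<close> to the pairs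
of an element of \<open>G\<close> and a set of earlier nodes; as the earlier nodes and \<open>sub S i\<close> are disjoint
subsets of \<open>S\<close>, the quantity \<open>card G * 2 ^ card S\<close> does not increase.
\<close>

lemma finite_arrows:
  fixes X S :: "'o::wellorder list set" and C :: "'m set"
    and c :: "'o list set list \<Rightarrow> 'o list set \<Rightarrow> 'm" and G :: "'o list set list set"
  assumes big: "divisible big C N"
  shows "full big t h X \<Longrightarrow> tree S \<Longrightarrow> finite S \<Longrightarrow> (\<And>\<eta>. \<eta> \<in> S \<Longrightarrow> length \<eta> \<le> h) \<Longrightarrow>
    card S \<le> Suc t \<Longrightarrow> finite G \<Longrightarrow> h * (card G * 2 ^ card S) \<le> N \<Longrightarrow> (\<And>g x. c g x \<in> C) \<Longrightarrow>
    \<exists>f. tree_embedding f S X \<and> (\<forall>g\<in>G. end_uniform S (\<lambda>x. c g (f ` x)))"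
proof (induction h arbitrary: t X S G c)
  case 0
  then have S: "S = {[]}" using tree_Nil[of S] by auto
  have "tree_embedding id S X" using 0(1) unfolding S tree_embedding_def by auto
  moreover have "end_uniform S (\<lambda>x. c g (id ` x))" for g by (rule end_uniform_trivial) (auto simp: S)
  ultimately show ?case by blast
next
  case (Suc h)
  note S = Suc.prems(2) and fin = Suc.prems(3) and finG = Suc.prems(6) and c = Suc.prems(8)
  define I where "I = {i. [i] \<in> S}"
  define nodes where "nodes K = {\<eta> \<in> S. \<eta> \<noteq> [] \<and> hd \<eta> \<in> K}" for K
  have finI: "finite I"
    unfolding I_def by (rule finite_imageD[of "\<lambda>i. [i]"]) (auto intro: finite_subset[OF _ fin] simp: inj_on_def)
  have fin_nodes: "finite (nodes K)" for K using fin unfolding nodes_def by simp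
  have card_nodes: "card K \<le> card (nodes K)" if "K \<subseteq> I" for K
  proof -
    have "(\<lambda>i. [i]) ` K \<subseteq> nodes K" using that unfolding nodes_def I_def by auto
    then have "card ((\<lambda>i. [i]) ` K) \<le> card (nodes K)" by (rule card_mono[OF fin_nodes])
    then show ?thesis by (simp add: card_image inj_on_def)
  qed
  have card_split: "card (nodes K) + card (sub S i) < card S" if "i \<in> I" "i \<notin> K" for K i
  proof -
    have "nodes K \<union> (#) i ` sub S i \<subseteq> S - {[]}" unfolding nodes_def by auto
    then have "card (nodes K \<union> (#) i ` sub S i) < card S"
      using fin tree_Nil[OF S] by (meson card_Diff1_less card_mono finite_Diff le_less_trans)
    moreover have "nodes K \<inter> (#) i ` sub S i = {}" using that unfolding nodes_def by auto
    moreover have "finite ((#) i ` sub S i)" by (rule finite_subset[OF _ fin]) auto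
    ultimately show ?thesis using fin_nodes[of K] by (simp add: card_Un_disjoint card_image)
  qed
  have nodes_below: "nodes_below S i = nodes K"
    if "K \<subseteq> I" "\<And>i'. i' \<in> K \<Longrightarrow> i' < i" "\<And>i'. i' \<in> I \<Longrightarrow> i' < i \<Longrightarrow> i' \<in> K" for i K
  proof -
    have "hd \<eta> \<in> I" if "\<eta> \<in> S" "\<eta> \<noteq> []" for \<eta>
      using that tree_root[OF S] unfolding I_def by (cases \<eta>) auto
    then show ?thesis using that unfolding nodes_below_def nodes_def by auto
  qed
  define stage where "stage K j f Y \<longleftrightarrow>
      Y \<subseteq> X \<and>
      full big (t - card K) (Suc h) Y \<and>
      strict_mono_on K j \<and>
      (\<forall>i\<in>K. \<forall>b. [b] \<in> Y \<longrightarrow> j i < b) \<and>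
      (\<forall>i\<in>K. tree_embedding (f i) (sub S i) (sub X (j i))) \<and>
      (\<forall>i\<in>K. \<forall>u\<in>Fpow (nodes_below S i). \<forall>g\<in>G.
        end_uniform (sub S i) (\<lambda>x. c g (glue j f ` u \<union> (#) (j i) ` f i ` x))) \<and>
      (\<forall>i\<in>K. \<forall>u\<in>Fpow (nodes_below S i). \<forall>g\<in>G. u \<noteq> {} \<longrightarrow>
        (\<forall>\<nu>\<in>sub S i. \<forall>\<rho>\<in>Y. length \<rho> = Suc (length \<nu>) \<longrightarrow>
          c g (insert (j i # f i \<nu>) (glue j f ` u)) = c g (insert \<rho> (glue j f ` u)))) \<and>
      (\<forall>u\<in>Fpow (nodes K). \<forall>g\<in>G. u \<noteq> {} \<longrightarrow> (\<forall>\<rho>\<in>Y. \<forall>\<rho>'\<in>Y. length \<rho> = length \<rho>' \<longrightarrow>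
        c g (insert \<rho> (glue j f ` u)) = c g (insert \<rho>' (glue j f ` u))))"
    for K :: "'o set" and j :: "'o \<Rightarrow> 'o" and f :: "'o \<Rightarrow> 'o list \<Rightarrow> 'o list" and Y
  have stageD:
    "Y \<subseteq> X"
    "full big (t - card K) (Suc h) Y"
    "strict_mono_on K j"
    "\<forall>i\<in>K. \<forall>b. [b] \<in> Y \<longrightarrow> j i < b"
    "\<forall>i\<in>K. tree_embedding (f i) (sub S i) (sub X (j i))"
    "\<forall>i\<in>K. \<forall>u\<in>Fpow (nodes_below S i). \<forall>g\<in>G.
        end_uniform (sub S i) (\<lambda>x. c g (glue j f ` u \<union> (#) (j i) ` f i ` x))"
    "\<forall>i\<in>K. \<forall>u\<in>Fpow (nodes_below S i). \<forall>g\<in>G. u \<noteq> {} \<longrightarrow>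
        (\<forall>\<nu>\<in>sub S i. \<forall>\<rho>\<in>Y. length \<rho> = Suc (length \<nu>) \<longrightarrow>
          c g (insert (j i # f i \<nu>) (glue j f ` u)) = c g (insert \<rho> (glue j f ` u)))"
    "\<forall>u\<in>Fpow (nodes K). \<forall>g\<in>G. u \<noteq> {} \<longrightarrow> (\<forall>\<rho>\<in>Y. \<forall>\<rho>'\<in>Y. length \<rho> = length \<rho>' \<longrightarrow>
        c g (insert \<rho> (glue j f ` u)) = c g (insert \<rho>' (glue j f ` u)))"
    if "stage K j f Y" for K j f Y
  proof -
    note conjs = that[unfolded stage_def]
    show "Y \<subseteq> X"
      by (rule conjs[THEN conjunct1])
    show "full big (t - card K) (Suc h) Y"
      by (rule conjs[THEN conjunct2, THEN conjunct1])
    show "strict_mono_on K j"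
      by (rule conjs[THEN conjunct2, THEN conjunct2, THEN conjunct1])
    show "\<forall>i\<in>K. \<forall>b. [b] \<in> Y \<longrightarrow> j i < b"
      by (rule conjs[THEN conjunct2, THEN conjunct2, THEN conjunct2, THEN conjunct1])
    show "\<forall>i\<in>K. tree_embedding (f i) (sub S i) (sub X (j i))"
      by (rule conjs[THEN conjunct2, THEN conjunct2, THEN conjunct2, THEN conjunct2, THEN conjunct1])
    show "\<forall>i\<in>K. \<forall>u\<in>Fpow (nodes_below S i). \<forall>g\<in>G.
        end_uniform (sub S i) (\<lambda>x. c g (glue j f ` u \<union> (#) (j i) ` f i ` x))"
      by (rule conjs[THEN conjunct2, THEN conjunct2, THEN conjunct2, THEN conjunct2, THEN conjunct2, THEN conjunct1])
    show "\<forall>i\<in>K. \<forall>u\<in>Fpow (nodes_below S i). \<forall>g\<in>G. u \<noteq> {} \<longrightarrow>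
        (\<forall>\<nu>\<in>sub S i. \<forall>\<rho>\<in>Y. length \<rho> = Suc (length \<nu>) \<longrightarrow>
          c g (insert (j i # f i \<nu>) (glue j f ` u)) = c g (insert \<rho> (glue j f ` u)))"
      by (rule conjs[THEN conjunct2, THEN conjunct2, THEN conjunct2, THEN conjunct2, THEN conjunct2, THEN conjunct2, THEN conjunct1])
    show "\<forall>u\<in>Fpow (nodes K). \<forall>g\<in>G. u \<noteq> {} \<longrightarrow> (\<forall>\<rho>\<in>Y. \<forall>\<rho>'\<in>Y. length \<rho> = length \<rho>' \<longrightarrow>
        c g (insert \<rho> (glue j f ` u)) = c g (insert \<rho>' (glue j f ` u)))"
      by (rule conjs[THEN conjunct2, THEN conjunct2, THEN conjunct2, THEN conjunct2, THEN conjunct2, THEN conjunct2, THEN conjunct2])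
  qed
  have ex_stage: "K \<subseteq> I \<and> (\<forall>i\<in>K. \<forall>i'\<in>I. i' < i \<longrightarrow> i' \<in> K) \<longrightarrow> (\<exists>j f Y. stage K j f Y)"
    if "finite K" for K
    using that
  proof (induction K rule: finite_linorder_max_induct)
    case empty
    have "stage {} j f X" for j f
      unfolding stage_def nodes_def using Suc.prems(1) by (auto simp: Fpow_def strict_mono_on_def)
    then show ?case by blast
  next
    case (insert i K)
    show ?case
    proof
      assume K': "insert i K \<subseteq> I \<and> (\<forall>k\<in>insert i K. \<forall>i'\<in>I. i' < k \<longrightarrow> i' \<in> insert i K)"
      then have K: "K \<subseteq> I" "i \<in> I" "i \<notin> K" using insert by auto
      have down: "\<forall>k\<in>K. \<forall>i'\<in>I. i' < k \<longrightarrow> i' \<in> K"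
        using K' insert.hyps(2) by (metis insertE insertCI order.strict_trans order.irrefl)
      then obtain j f Y where st: "stage K j f Y" using insert.IH K by blast
      have nb: "nodes_below S i = nodes K"
        by (rule nodes_below[OF K(1)]) (use insert.hyps K' in auto)
      define F where "F = glue j f"
      define r where "r = t - card (insert i K)"
      have card_K: "card (insert i K) = Suc (card K)" using insert.hyps K(3) by simp
      have lt: "card (nodes K) + card (sub S i) < card S" by (rule card_split[OF K(2,3)])
      have "card (sub S i) > 0"
      proof -
        have "finite (sub S i)"
          by (rule finite_imageD[of "(#) i"]) (auto intro: finite_subset[OF _ fin])
        moreover have "[] \<in> sub S i" using K(2) unfolding I_def by simp
        ultimately show ?thesis by (auto simp: card_gt_0_iff)
      qed
      then have r: "t - card K = Suc r" "card (sub S i) \<le> Suc (Suc r)"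
        using lt card_nodes[OF K(1)] Suc.prems(5) card_K unfolding r_def by simp_all
      have fullY: "full big (Suc r) (Suc h) Y" using stageD(2)[OF st] r by simp
      from full_thin[OF big fullY] obtain x where x: "[x] \<in> Y" and thin: "thins_at big C N r (Suc h) Y x"
        by blast
      have card_index: "card ((\<lambda>(u, g). u # g) ` (Fpow (nodes L) \<times> G)) \<le> 2 ^ card (nodes L) * card G"
        and fin_index: "finite ((\<lambda>(u, g). u # g) ` (Fpow (nodes L) \<times> G))" for L
      proof -
        have Fp: "Fpow (nodes L) = Pow (nodes L)"
          using fin_nodes finite_subset by (auto simp: Fpow_def)
        have "card ((\<lambda>(u, g). u # g) ` (Fpow (nodes L) \<times> G)) \<le> card (Fpow (nodes L) \<times> G)"
          by (rule card_image_le) (simp add: Fp fin_nodes finG)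
        then show "card ((\<lambda>(u, g). u # g) ` (Fpow (nodes L) \<times> G)) \<le> 2 ^ card (nodes L) * card G"
          by (simp add: Fp card_cartesian_product card_Pow fin_nodes)
        show "finite ((\<lambda>(u, g). u # g) ` (Fpow (nodes L) \<times> G))" by (simp add: Fp fin_nodes finG)
      qed
      define G' where "G' = (\<lambda>(u, g). u # g) ` (Fpow (nodes K) \<times> G)"
      have "\<exists>e. tree_embedding e (sub S i) (sub Y x) \<and>
          (\<forall>y\<in>G'. end_uniform (sub S i) (\<lambda>v. c (tl y) (F ` hd y \<union> (#) x ` e ` v)))"
      proof (rule Suc.IH[of "Suc r"])
        show "full big (Suc r) h (sub Y x)" using fullY x by simp
        show "tree (sub S i)" using tree_sub[OF S] K(2) unfolding I_def by simp
        show "finite (sub S i)"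
          by (rule finite_imageD[of "(#) i"]) (auto intro: finite_subset[OF _ fin])
        show "length \<nu> \<le> h" if "\<nu> \<in> sub S i" for \<nu> using Suc.prems(4)[of "i # \<nu>"] that by simp
        show "card (sub S i) \<le> Suc (Suc r)" by (rule r(2))
        show "finite G'" unfolding G'_def by (rule fin_index)
        show "c (tl y) (F ` hd y \<union> (#) x ` v) \<in> C" for y v by (rule c)
        have "h * (card G' * 2 ^ card (sub S i)) \<le> Suc h * ((2 ^ card (nodes K) * card G) * 2 ^ card (sub S i))"
          using card_index[of K] unfolding G'_def by (intro mult_le_mono) auto
        also have "\<dots> = Suc h * (card G * 2 ^ (card (nodes K) + card (sub S i)))"
          by (simp add: power_add)
        also have "\<dots> \<le> Suc h * (card G * 2 ^ card S)"
          using lt by (intro mult_le_mono power_increasing) auto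
        also have "\<dots> \<le> N" by (rule Suc.prems(7))
        finally show "h * (card G' * 2 ^ card (sub S i)) \<le> N" .
      qed
      then obtain e where e: "tree_embedding e (sub S i) (sub Y x)"
        "\<And>u g. u \<in> Fpow (nodes K) \<Longrightarrow> g \<in> G \<Longrightarrow>
          end_uniform (sub S i) (\<lambda>v. c g (F ` u \<union> (#) x ` e ` v))"
        unfolding G'_def by auto
      define j' where "j' = j(i := x)"
      define f' where "f' = f(i := e)"
      define F' where "F' = glue j' f'"
      have F': "F' ` u = F ` u" if "u \<in> Fpow (nodes K)" for u
      proof (rule image_cong[OF refl])
        fix \<eta> assume "\<eta> \<in> u"
        then have "\<eta> \<in> nodes K" using that by (auto simp: Fpow_def)
        then show "F' \<eta> = F \<eta>" using K(3) unfolding F'_def F_def j'_def f'_def nodes_def by (cases \<eta>) auto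
      qed
      define U where "U = (\<lambda>(u, g). u # g) ` (Fpow (nodes (insert i K)) \<times> G)"
      have "Suc h * card U \<le> N"
      proof -
        have "card (nodes (insert i K)) \<le> card S" by (rule card_mono[OF fin]) (auto simp: nodes_def)
        then have "Suc h * card U \<le> Suc h * (2 ^ card S * card G)"
          using card_index[of "insert i K"] unfolding U_def
          by (intro mult_le_mono) (auto intro: order_trans[OF _ mult_le_mono1[OF power_increasing]])
        then show ?thesis using Suc.prems(7) by (simp add: mult.commute)
      qed
      moreover have "finite U" unfolding U_def by (rule fin_index)
      ultimately have "\<exists>Z\<subseteq>Y. full big r (Suc h) Z \<and> (\<forall>b. [b] \<in> Z \<longrightarrow> x < b) \<and>
          (\<forall>y\<in>U. \<forall>\<nu>\<in>Z. \<forall>\<nu>'\<in>Z. length \<nu> = length \<nu>' \<longrightarrow>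
            c (tl y) (insert \<nu> (F' ` hd y)) = c (tl y) (insert \<nu>' (F' ` hd y)))"
        by (intro thin[unfolded thins_at_def, rule_format] c)
      then obtain Z where Z0: "Z \<subseteq> Y \<and> full big r (Suc h) Z \<and> (\<forall>b. [b] \<in> Z \<longrightarrow> x < b) \<and>
          (\<forall>y\<in>U. \<forall>\<nu>\<in>Z. \<forall>\<nu>'\<in>Z. length \<nu> = length \<nu>' \<longrightarrow>
            c (tl y) (insert \<nu> (F' ` hd y)) = c (tl y) (insert \<nu>' (F' ` hd y)))" ..
      then have Z: "Z \<subseteq> Y" "full big r (Suc h) Z" "\<And>b. [b] \<in> Z \<Longrightarrow> x < b" by simp_all
      from Z0 have uni: "\<forall>y\<in>U. \<forall>\<nu>\<in>Z. \<forall>\<nu>'\<in>Z. length \<nu> = length \<nu>' \<longrightarrow>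
          c (tl y) (insert \<nu> (F' ` hd y)) = c (tl y) (insert \<nu>' (F' ` hd y))" by (elim conjE)
      have "stage (insert i K) j' f' Z"
        unfolding stage_def F'_def[symmetric] r_def[symmetric]
      proof (intro conjI ballI allI impI)
        show "Z \<subseteq> X" using Z(1) stageD(1)[OF st] by blast
        show "full big r (Suc h) Z" by (rule Z(2))
        show "strict_mono_on (insert i K) j'"
        proof (rule strict_mono_onI)
          fix k l assume kl: "k \<in> insert i K" "l \<in> insert i K" "k < l"
          have "k \<in> K" using kl insert.hyps(2) by fastforce
          show "j' k < j' l"
          proof (cases "l = i")
            case True
            then show ?thesis using stageD(4)[OF st] \<open>k \<in> K\<close> x K(3) unfolding j'_def by auto
          next
            case False
            then show ?thesis
              using stageD(3)[OF st] \<open>k \<in> K\<close> kl K(3) unfolding j'_def strict_mono_on_def by auto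
          qed
        qed
        fix k assume k: "k \<in> insert i K"
        show "j' k < b" if "[b] \<in> Z" for b
        proof (cases "k = i")
          case True
          then show ?thesis using Z(3)[OF that] by (simp add: j'_def)
        next
          case False
          then show ?thesis using stageD(4)[OF st] k that Z(1) unfolding j'_def by auto
        qed
        show "tree_embedding (f' k) (sub S k) (sub X (j' k))"
        proof (cases "k = i")
          case True
          have "sub Y x \<subseteq> sub X x" using stageD(1)[OF st] unfolding sub_def by auto
          then show ?thesis using True e(1) tree_embedding_mono by (auto simp: j'_def f'_def)
        next
          case False
          then show ?thesis using stageD(5)[OF st] k unfolding j'_def f'_def by auto
        qed
      next
        fix k u g assume k: "k \<in> insert i K" and u: "u \<in> Fpow (nodes_below S k)" and g: "g \<in> G"
        have uK: "u \<in> Fpow (nodes K)"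
        proof -
          have "nodes_below S k \<subseteq> nodes_below S i"
            using k insert.hyps(2) unfolding nodes_below_def by auto
          then show ?thesis using u nb by (auto simp: Fpow_def)
        qed
        show "end_uniform (sub S k) (\<lambda>x. c g (F' ` u \<union> (#) (j' k) ` f' k ` x))"
          unfolding F'[OF uK]
        proof (cases "k = i")
          case True
          then show "end_uniform (sub S k) (\<lambda>x. c g (F ` u \<union> (#) (j' k) ` f' k ` x))"
            using e(2)[OF uK g] by (simp add: j'_def f'_def)
        next
          case False
          then show "end_uniform (sub S k) (\<lambda>x. c g (F ` u \<union> (#) (j' k) ` f' k ` x))"
            using stageD(6)[OF st] k u g unfolding j'_def f'_def F_def by auto
        qed
        fix \<nu> \<rho> assume "u \<noteq> {}" and \<nu>: "\<nu> \<in> sub S k" and \<rho>: "\<rho> \<in> Z" "length \<rho> = Suc (length \<nu>)"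
        show "c g (insert (j' k # f' k \<nu>) (F' ` u)) = c g (insert \<rho> (F' ` u))"
          unfolding F'[OF uK]
        proof (cases "k = i")
          case True
          have "x # e \<nu> \<in> Y" "length (e \<nu>) = length \<nu>"
            using tree_embedding_mem[OF e(1)] tree_embedding_length[OF e(1)] \<nu> True by auto
          then have "c g (insert (x # e \<nu>) (F ` u)) = c g (insert \<rho> (F ` u))"
            using stageD(8)[OF st, rule_format, OF uK g \<open>u \<noteq> {}\<close>] \<rho> Z(1) unfolding F_def
            by (metis length_Cons subsetD)
          then show "c g (insert (j' k # f' k \<nu>) (F ` u)) = c g (insert \<rho> (F ` u))"
            using True by (simp add: j'_def f'_def)
        next
          case False
          then have "k \<in> K" using k by simp
          then have "c g (insert (j k # f k \<nu>) (F ` u)) = c g (insert \<rho> (F ` u))"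
            using stageD(7)[OF st, rule_format, OF _ u g \<open>u \<noteq> {}\<close> \<nu>] \<rho> Z(1) unfolding F_def by blast
          then show "c g (insert (j' k # f' k \<nu>) (F ` u)) = c g (insert \<rho> (F ` u))"
            using False by (simp add: j'_def f'_def)
        qed
      next
        fix u g \<rho> \<rho>' assume "u \<in> Fpow (nodes (insert i K))" "g \<in> G" "\<rho> \<in> Z" "\<rho>' \<in> Z" "length \<rho> = length \<rho>'"
        moreover then have "u # g \<in> U" unfolding U_def by force
        ultimately show "c g (insert \<rho> (F' ` u)) = c g (insert \<rho>' (F' ` u))"
          using uni by (metis list.sel(1,3))
      qed
      then show "\<exists>j f Y. stage (insert i K) j f Y" by blast
    qed
  qed
  then obtain j f Y where st: "stage I j f Y" using finI by blast
  have "tree_embedding (glue j f) S X"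
  proof (rule tree_embedding_glue[OF S])
    show "[] \<in> X" by (rule full_Nil[OF Suc.prems(1)])
    show "strict_mono_on {i. [i] \<in> S} j" using stageD(3)[OF st] unfolding I_def .
    show "tree_embedding (f i) (sub S i) (sub X (j i))" if "[i] \<in> S" for i
      using stageD(5)[OF st] that unfolding I_def by blast
  qed
  moreover have "end_uniform S (\<lambda>x. c g (glue j f ` x))" if g: "g \<in> G" for g
  proof (rule end_uniform_children[OF S])
    fix i u assume iu: "[i] \<in> S" "u \<in> Fpow (nodes_below S i)"
    have "glue j f ` (#) i ` x = (#) (j i) ` f i ` x" for x by (simp add: image_image)
    then show "end_uniform (sub S i) (\<lambda>x. c g (glue j f ` (u \<union> (#) i ` x)))"
      using stageD(6)[OF st] iu g unfolding I_def by (simp add: image_Un)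
  next
    fix i i' \<nu> \<nu>' u
    assume *: "i # \<nu> \<in> S" "i' # \<nu>' \<in> S" "length \<nu> = length \<nu>'" "u \<noteq> {}"
      "u \<in> Fpow (nodes_below S i)" "u \<in> Fpow (nodes_below S i')"
    have "Suc (length \<nu>) \<le> Suc h" using Suc.prems(4)[OF *(1)] by simp
    moreover have "full big (t - card I) (Suc h) Y" by (rule stageD(2)[OF st])
    ultimately obtain \<rho> where \<rho>: "\<rho> \<in> Y" "length \<rho> = Suc (length \<nu>)" using full_levels[OF big] by blast
    have "c g (insert (j k # f k \<xi>) (glue j f ` u)) = c g (insert \<rho> (glue j f ` u))"
      if "k # \<xi> \<in> S" "length \<xi> = length \<nu>" "u \<in> Fpow (nodes_below S k)" for k \<xi>
    proof -
      have "k \<in> I" "\<xi> \<in> sub S k" using that(1) tree_root[OF S] unfolding I_def by auto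
      then show ?thesis using stageD(7)[OF st, rule_format, OF _ that(3) g *(4)] that(2) \<rho> by simp
    qed
    then show "c g (glue j f ` insert (i # \<nu>) u) = c g (glue j f ` insert (i' # \<nu>') u)"
      using * by simp
  qed
  ultimately show ?case by blast
qed

section \<open>Finite trees\<close>

text \<open>
The first entries come from \<open>B (h - 1)\<close>, the next ones from \<open>B (h - 2)\<close> and so on; with blocks that
increase with their index the sequences are decreasing.
\<close>

primrec block_tree :: "(nat \<Rightarrow> 'a set) \<Rightarrow> nat \<Rightarrow> 'a list set" where
  "block_tree B 0 = {[]}"
| "block_tree B (Suc h) = insert [] {a # \<nu> | a \<nu>. a \<in> B h \<and> \<nu> \<in> block_tree B h}"

lemma block_tree_Nil: "[] \<in> block_tree B h"
  by (cases h) auto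

lemma block_tree_Suc_image:
  "block_tree B (Suc h) = insert [] ((\<lambda>(a, \<nu>). a # \<nu>) ` (B h \<times> block_tree B h))"
  by auto

lemma block_tree_entries: "\<nu> \<in> block_tree B h \<Longrightarrow> x \<in> set \<nu> \<Longrightarrow> \<exists>k<h. x \<in> B k"
proof (induction h arbitrary: \<nu>)
  case (Suc h)
  then obtain a \<xi> where \<nu>: "\<nu> = a # \<xi>" "a \<in> B h" "\<xi> \<in> block_tree B h" by auto
  show ?case
  proof (cases "x = a")
    case False
    then obtain k where "k < h" "x \<in> B k" using Suc.IH[OF \<nu>(3)] Suc.prems(2) \<nu>(1) by auto
    then show ?thesis using less_SucI by blast
  qed (use \<nu> in auto)
qed auto

lemma block_tree_full: "(\<And>k. k < h \<Longrightarrow> big t (B k)) \<Longrightarrow> full big t h (block_tree B h)"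
proof (induction h)
  case (Suc h)
  have "sub (block_tree B (Suc h)) b = block_tree B h" if "b \<in> B h" for b
    using that by (auto simp: sub_def)
  moreover have "{b. [b] \<in> block_tree B (Suc h)} = B h" using block_tree_Nil by auto
  ultimately show ?case using Suc block_tree_Nil by auto
qed simp

lemma tree_block_tree:
  fixes B :: "nat \<Rightarrow> 'o::wellorder set"
  assumes "\<And>k l a b. k < l \<Longrightarrow> l < h \<Longrightarrow> a \<in> B k \<Longrightarrow> b \<in> B l \<Longrightarrow> a < b"
  shows "tree (block_tree B h)"
  using assms
proof (induction h)
  case 0
  then show ?case by (simp add: tree_def)
next
  case (Suc h)
  then have IH: "tree (block_tree B h)" by simp
  show ?case
    unfolding tree_def
  proof (intro conjI ballI allI impI)
    show "block_tree B (Suc h) \<noteq> {}" using block_tree_Nil by blast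
    show "block_tree B (Suc h) \<subseteq> ds"
    proof
      fix \<eta> assume "\<eta> \<in> block_tree B (Suc h)"
      then consider "\<eta> = []" | a \<nu> where "\<eta> = a # \<nu>" "a \<in> B h" "\<nu> \<in> block_tree B h" by auto
      then show "\<eta> \<in> ds"
      proof cases
        case 2
        have "x < a" if "x \<in> set \<nu>" for x
          using block_tree_entries[OF 2(3) that] Suc.prems[of _ h x a] 2(2) by auto
        then show ?thesis using 2 IH unfolding tree_def by (auto simp: ds_Cons)
      qed simp
    qed
    fix \<eta> \<nu> assume "\<eta> \<in> block_tree B (Suc h)" "prefix \<nu> \<eta>"
    then show "\<nu> \<in> block_tree B (Suc h)"
      using tree_prefix[OF IH] by (cases \<nu>) (auto simp: prefix_Cons)
  qed
qed

lemma card_block_tree: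
  assumes "\<And>k. k < h \<Longrightarrow> finite (B k) \<and> card (B k) \<le> q"
  shows "finite (block_tree B h) \<and> card (block_tree B h) \<le> (q + 1) ^ h"
  using assms
proof (induction h)
  case (Suc h)
  then have IH: "finite (block_tree B h)" "card (block_tree B h) \<le> (q + 1) ^ h" by simp_all
  have fin: "finite (B h \<times> block_tree B h)" using IH(1) Suc.prems by simp
  have "card (block_tree B (Suc h)) \<le> Suc (card (B h \<times> block_tree B h))"
    unfolding block_tree_Suc_image
    by (rule order_trans[OF card_insert_le_m1]) (use card_image_le[OF fin] fin in \<open>auto simp: card_insert_if\<close>)
  also have "\<dots> \<le> Suc (q * (q + 1) ^ h)"
    unfolding card_cartesian_product using Suc.prems[of h] IH(2) by (simp add: mult_le_mono)
  also have "\<dots> \<le> (q + 1) ^ Suc h" by simp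
  finally show ?case using fin unfolding block_tree_Suc_image by simp
qed simp

lemma card_of_block_tree_ordLeq:
  assumes \<beta>: "Cinfinite \<beta>" and B: "\<And>k. k < h \<Longrightarrow> |B k| \<le>o \<beta>"
  shows "|block_tree B h| \<le>o \<beta>"
  using B
proof (induction h)
  case 0
  show ?case using \<beta> by (auto intro: Card_order_singl_ordLeq simp: cinfinite_def)
next
  case (Suc h)
  have "|B h \<times> block_tree B h| \<le>o \<beta>" using Suc by (intro card_of_Times_ordLeq \<beta>) auto
  then have "|(\<lambda>(a, \<nu>). a # \<nu>) ` (B h \<times> block_tree B h)| \<le>o \<beta>" by (rule ordLeq_transitive[OF card_of_image])
  moreover have "|{[] :: 'b list}| \<le>o \<beta>"
    using \<beta> by (auto intro: Card_order_singl_ordLeq simp: cinfinite_def)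
  ultimately have "|{[]} \<union> (\<lambda>(a, \<nu>). a # \<nu>) ` (B h \<times> block_tree B h)| \<le>o \<beta>"
    by (intro Un_Cinfinite_bound \<beta>)
  then show ?case unfolding block_tree_Suc_image by simp
qed

text \<open>
The number \<open>K\<close> bounds the number of functions \<open>D \<rightarrow> C\<close>; the base is \<open>C\<close> enlarged by one element so that
\<open>K\<close> is positive even if \<open>C\<close> is empty. Removing the minimum of \<open>(K + 1) ^ Suc t\<close> points leaves more than
\<open>K * ((K + 1) ^ t - 1)\<close> of them.
\<close>

lemma divisible_finite:
  fixes C :: "'m set"
  assumes C: "finite C" and K: "K = (card C + 1) ^ N"
  shows "divisible (\<lambda>t (X :: 'o::wellorder set). finite X \<and> (K + 1) ^ t \<le> card X) C N"
  unfolding divisible_def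
proof (intro conjI allI impI)
  fix t and X :: "'o set" assume "finite X \<and> (K + 1) ^ t \<le> card X"
  then have "card X > 0" by (metis add_gr_0 less_le_trans zero_less_one zero_less_power)
  then show "X \<noteq> {}" by auto
next
  fix t and X :: "'o set" assume X: "finite X \<and> (K + 1) ^ Suc t \<le> card X"
  then have pos: "card X > 0" by (metis add_gr_0 less_le_trans zero_less_one zero_less_power)
  define x where "x = Min X"
  have x: "x \<in> X" "\<And>y. y \<in> X \<Longrightarrow> x \<le> y" using X pos unfolding x_def by (auto simp: card_gt_0_iff)
  have "splits_at (\<lambda>t X. finite X \<and> (K + 1) ^ t \<le> card X) C N t X x"
    unfolding splits_at_def
  proof (intro allI impI)
    fix D :: "(nat \<times> 'o list set list) set" and f
    assume D: "finite D" "card D \<le> N" and f: "f \<in> X \<rightarrow> (D \<rightarrow>\<^sub>E C)"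
    define X' where "X' = X - {x}"
    define part where "part y = {b \<in> X. x < b \<and> f b = y}" for y
    have "card (D \<rightarrow>\<^sub>E C) = card C ^ card D" using D by (simp add: card_PiE)
    also have "\<dots> \<le> (card C + 1) ^ card D" by (rule power_mono) auto
    also have "\<dots> \<le> K" unfolding K using D by (intro power_increasing) auto
    finally have cardE: "card (D \<rightarrow>\<^sub>E C) \<le> K" .
    have "card (f ` X') \<le> card (D \<rightarrow>\<^sub>E C)"
    proof (rule card_mono)
      show "finite (D \<rightarrow>\<^sub>E C)" using C D(1) by (simp add: finite_PiE)
      show "f ` X' \<subseteq> D \<rightarrow>\<^sub>E C" using f unfolding X'_def by blast
    qed
    then have cardf: "card (f ` X') \<le> K" using cardE by simp
    have "\<exists>y. (K + 1) ^ t \<le> card (part y)"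
    proof (rule ccontr)
      assume "\<not> ?thesis"
      then have "card (part y) < (K + 1) ^ t" for y by (simp add: not_le)
      then have small: "card (part y) \<le> (K + 1) ^ t - 1" for y
        using add_le_imp_le_diff[of "card (part y)" 1 "(K + 1) ^ t"] by (metis Suc_eq_plus1 Suc_leI)
      have "X' \<subseteq> (\<Union>y\<in>f ` X'. part y)" using x unfolding X'_def part_def by (auto simp: order.strict_iff_order)
      then have "card X' \<le> card (\<Union>y\<in>f ` X'. part y)"
        by (rule card_mono[rotated]) (use X in \<open>auto simp: X'_def part_def\<close>)
      also have "\<dots> \<le> (\<Sum>y\<in>f ` X'. card (part y))" by (rule card_UN_le) (use X in \<open>auto simp: X'_def\<close>)
      also have "\<dots> \<le> card (f ` X') * ((K + 1) ^ t - 1)"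
        using sum_bounded_above[of "f ` X'" "\<lambda>y. card (part y)" "(K + 1) ^ t - 1"] small by simp
      also have "\<dots> \<le> K * ((K + 1) ^ t - 1)" using cardf by (rule mult_le_mono1)
      finally have "card X' \<le> K * ((K + 1) ^ t - 1)" .
      moreover define p where "p = (K + 1) ^ t"
      ultimately have "card X - 1 \<le> K * p - K" using x(1) X unfolding X'_def by (simp add: diff_mult_distrib2)
      moreover have "K * p + p \<le> card X" using X unfolding p_def by simp
      moreover have "1 \<le> p" "1 \<le> K" unfolding p_def K by simp_all
      moreover have "K * 1 \<le> K * p" using \<open>1 \<le> p\<close> by (rule mult_le_mono2)
      ultimately show False by linarith
    qed
    then show "\<exists>y. finite {b \<in> X. x < b \<and> f b = y} \<and> (K + 1) ^ t \<le> card {b \<in> X. x < b \<and> f b = y}"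
      using X unfolding part_def by auto
  qed
  then show "\<exists>x\<in>X. splits_at (\<lambda>t X. finite X \<and> (K + 1) ^ t \<le> card X) C N t X x" using x(1) by blast
qed

lemma card_of_finite_PiE_ordLeq:
  assumes \<beta>: "Cinfinite \<beta>" and C: "|C| \<le>o \<beta>" and D: "finite D"
  shows "|D \<rightarrow>\<^sub>E C| \<le>o \<beta>"
  using D
proof induction
  case empty
  show ?case using \<beta> by (auto intro: Card_order_singl_ordLeq simp: cinfinite_def)
next
  case (insert x D)
  have "|C \<times> (D \<rightarrow>\<^sub>E C)| \<le>o \<beta>" by (rule card_of_Times_ordLeq[OF \<beta> C insert.IH])
  then show ?case unfolding PiE_insert_eq by (rule ordLeq_transitive[OF card_of_image])
qed

lemma divisible_infinite:
  fixes C :: "'m set"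
  assumes \<beta>: "Cinfinite \<beta>" and C: "|C| \<le>o \<beta>"
  shows "divisible (\<lambda>t (X :: 'o::wellorder set). \<not> |X| \<le>o \<beta>) C N"
  unfolding divisible_def
proof (intro conjI allI impI)
  fix X :: "'o set" assume "\<not> |X| \<le>o \<beta>"
  then show "X \<noteq> {}" using \<beta> Card_order_empty by blast
next
  fix t and X :: "'o set" assume X: "\<not> |X| \<le>o \<beta>"
  then have "X \<noteq> {}" using \<beta> Card_order_empty by blast
  define x where "x = (LEAST x. x \<in> X)"
  have x: "x \<in> X" "\<And>y. y \<in> X \<Longrightarrow> x \<le> y"
    using \<open>X \<noteq> {}\<close> unfolding x_def by (auto intro: LeastI Least_le)
  have "splits_at (\<lambda>t X. \<not> |X| \<le>o \<beta>) C N t X x"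
    unfolding splits_at_def
  proof (intro allI impI, rule ccontr)
    fix D :: "(nat \<times> 'o list set list) set" and f
    assume D: "finite D" and f: "f \<in> X \<rightarrow> (D \<rightarrow>\<^sub>E C)"
      and neg: "\<not> (\<exists>y. \<not> |{b \<in> X. x < b \<and> f b = y}| \<le>o \<beta>)"
    have "|f ` X| \<le>o \<beta>"
      by (rule ordLeq_transitive[OF card_of_mono1 card_of_finite_PiE_ordLeq[OF \<beta> C D]]) (use f in auto)
    then have "|\<Union>y\<in>f ` X. {b \<in> X. x < b \<and> f b = y}| \<le>o \<beta>"
      using neg by (intro UNION_Cinfinite_bound \<beta>) auto
    moreover have "|{x}| \<le>o \<beta>" using \<beta> by (auto intro: Card_order_singl_ordLeq simp: cinfinite_def)
    ultimately have "|{x} \<union> (\<Union>y\<in>f ` X. {b \<in> X. x < b \<and> f b = y})| \<le>o \<beta>"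
      by (intro Un_Cinfinite_bound \<beta>)
    moreover have "X \<subseteq> {x} \<union> (\<Union>y\<in>f ` X. {b \<in> X. x < b \<and> f b = y})"
      using x(2) by (auto simp: order.strict_iff_order)
    ultimately have "|X| \<le>o \<beta>" by (rule ordLeq_transitive[OF card_of_mono1, rotated])
    then show False using X by blast
  qed
  then show "\<exists>x\<in>X. splits_at (\<lambda>t X. \<not> |X| \<le>o \<beta>) C N t X x" using x(1) by blast
qed

lemma tree_length_less_card:
  assumes S: "tree S" "finite S" and \<eta>: "\<eta> \<in> S"
  shows "length \<eta> < card S"
proof -
  have "(\<lambda>l. take l \<eta>) ` {..length \<eta>} \<subseteq> S" using tree_prefix[OF S(1) \<eta> take_is_prefix] by auto
  then have "card ((\<lambda>l. take l \<eta>) ` {..length \<eta>}) \<le> card S" by (rule card_mono[OF S(2)])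
  moreover have "inj_on (\<lambda>l. take l \<eta>) {..length \<eta>}"
    by (rule inj_onI) (metis atMost_iff length_take min.absorb2)
  ultimately show ?thesis by (simp add: card_image)
qed

text \<open>
The bound \<open>|{()}|\<close> on the index set admits a single colouring, which is all that is
asked of the root. In a tree with \<open>n\<close> nodes all lengths are below \<open>n\<close>, so that \<open>n\<close> can be taken for
the height and for the number of thinnings.
\<close>

lemma arrows_finite:
  fixes S X :: "'o::wellorder list set"
  assumes big: "divisible big C (card S * 2 ^ card S)" and X: "full big (card S) (card S) X"
    and S: "tree S" "finite S"
  shows "arrows |{()}| C X S"
  unfolding arrows_def
proof (intro allI impI, elim conjE)
  fix c :: "'o list set list \<Rightarrow> 'o list set \<Rightarrow> 'a" and G :: "'o list set list set"
  assume c: "\<forall>g x. c g x \<in> C" and "|G| \<le>o |{()}|"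
  then obtain f :: "'o list set list \<Rightarrow> unit" where "inj_on f G"
    unfolding card_of_ordLeq[symmetric] by blast
  then have G: "finite G" "card G \<le> 1"
    using inj_on_finite[of f G UNIV] card_inj_on_le[of f G UNIV] by auto
  show "\<exists>f. tree_embedding f S X \<and> (\<forall>g\<in>G. end_uniform S (\<lambda>x. c g (f ` x)))"
  proof (rule finite_arrows[OF big X S])
    show "length \<eta> \<le> card S" if "\<eta> \<in> S" for \<eta> using tree_length_less_card[OF S that] by simp
    show "card S * (card G * 2 ^ card S) \<le> card S * 2 ^ card S" using G(2) by simp
  qed (use G c in auto)
qed

text \<open>
A finite non-empty initial segment has a last element, so only the successor case of the hierarchy
occurs.
\<close>

lemma beth_step_finite:
  assumes wo: "Well_order \<alpha>" and A: "finite A" "A \<noteq> {}" "A \<subseteq> Field \<alpha>"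
    and down: "\<And>i j. j \<in> A \<Longrightarrow> (i, j) \<in> \<alpha> \<Longrightarrow> i \<in> A"
    and step: "beth_step \<kappa> \<alpha> b A \<theta>"
  shows "\<exists>m\<in>A. underS \<alpha> m = A - {m} \<and> \<theta> =o ctwo ^c b m"
proof -
  have ord: "Refl \<alpha>" "trans \<alpha>" "antisym \<alpha>" using wo unfolding order_on_defs by simp_all
  have "\<exists>m\<in>A. \<forall>i\<in>A. (i, m) \<in> \<alpha>"
    using A
  proof (induction A rule: finite_ne_induct)
    case (singleton x)
    then show ?case using ord(1) by (auto simp: refl_on_def)
  next
    case (insert x F)
    then obtain m where m: "m \<in> F" "\<forall>i\<in>F. (i, m) \<in> \<alpha>" by auto
    show ?case
    proof (cases "(x, m) \<in> \<alpha>")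
      case True
      then show ?thesis using m by auto
    next
      case False
      then have "(m, x) \<in> \<alpha>" using Well_order_not_le[OF wo, of x m] insert.prems m(1) by auto
      then have "\<forall>i\<in>insert x F. (i, x) \<in> \<alpha>"
        using m ord(1,2) insert.prems by (auto simp: refl_on_def dest: transD)
      then show ?thesis by blast
    qed
  qed
  then obtain m where m: "m \<in> A" "\<forall>i\<in>A. (i, m) \<in> \<alpha>" by blast
  have "underS \<alpha> m = A - {m}"
  proof
    show "underS \<alpha> m \<subseteq> A - {m}" using down[OF m(1)] unfolding underS_def by blast
    show "A - {m} \<subseteq> underS \<alpha> m" using m(2) unfolding underS_def by blast
  qed
  moreover have "\<theta> =o ctwo ^c b m" using step m unfolding beth_step_def by (elim conjE; blast)
  ultimately show ?thesis using m(1) by blast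
qed

text \<open>
Iterated power sets of the field stand for iterated exponentiations, as their cardinality can be
computed when \<open>\<kappa>\<close> is finite.
\<close>

lemma is_beth_finite:
  assumes \<theta>: "is_beth \<kappa> \<alpha> \<theta>" and wo: "Well_order \<alpha>" and \<kappa>: "Card_order \<kappa>"
    and fin: "finite (Field \<alpha>)" "Field \<alpha> \<noteq> {}"
  shows "|Pow (Field \<kappa>)| \<le>o \<theta>"
    and "4 \<le> card (Field \<alpha>) \<Longrightarrow> |Pow (Pow (Pow (Pow (Field \<kappa>))))| \<le>o \<theta>"
proof -
  from is_beth_increasing[OF \<theta> wo \<kappa>]
  obtain b where top: "beth_step \<kappa> \<alpha> b (Field \<alpha>) \<theta>" and b: "\<forall>i\<in>Field \<alpha>.
      beth_step \<kappa> \<alpha> b (underS \<alpha> i) (b i) \<and> Card_order (b i) \<and> \<kappa> \<le>o b i \<and> b i \<le>o \<theta>" by blast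
  have tr: "trans \<alpha>" "antisym \<alpha>" using wo unfolding order_on_defs by simp_all
  have base: "|Field \<kappa>| \<le>o b i" if "i \<in> Field \<alpha>" for i
    using ordIso_ordLeq_trans[OF card_of_Field_ordIso[OF \<kappa>]] b that by blast
  have Pow: "|Pow X| \<le>o \<chi>" if "|X| \<le>o b m" "\<chi> =o ctwo ^c b m" "m \<in> Field \<alpha>" for X :: "'z set" and \<chi> m
  proof -
    have "|Pow X| \<le>o ctwo ^c b m" using card_of_Pow_ordLeq[OF that(1)] b that(3) by simp
    then show ?thesis by (rule ordLeq_ordIso_trans[OF _ ordIso_symmetric[OF that(2)]])
  qed
  have below: "\<exists>m\<in>Field \<alpha>. b i =o ctwo ^c b m \<and> card (underS \<alpha> i) = Suc (card (underS \<alpha> m))"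
    if i: "i \<in> Field \<alpha>" and ne: "card (underS \<alpha> i) > 0" for i
  proof -
    have "underS \<alpha> i \<subseteq> Field \<alpha>" by (auto simp: underS_def Field_def)
    moreover then have "finite (underS \<alpha> i)" using fin(1) finite_subset by blast
    moreover have "k \<in> underS \<alpha> i" if "j \<in> underS \<alpha> i" "(k, j) \<in> \<alpha>" for j k
      using that tr unfolding underS_def by (auto dest: transD antisymD)
    ultimately obtain m where "m \<in> underS \<alpha> i" "underS \<alpha> m = underS \<alpha> i - {m}" "b i =o ctwo ^c b m"
      using beth_step_finite[OF wo, of "underS \<alpha> i" \<kappa> b "b i"] b i ne by (metis card_gt_0_iff)
    moreover have "card (underS \<alpha> i) = Suc (card (underS \<alpha> i - {m}))"
      by (rule card.remove[OF \<open>finite (underS \<alpha> i)\<close> calculation(1)])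
    ultimately show ?thesis using \<open>underS \<alpha> i \<subseteq> Field \<alpha>\<close> by auto
  qed
  have closed: "i \<in> Field \<alpha>" if "j \<in> Field \<alpha>" "(i, j) \<in> \<alpha>" for i j
    using that by (auto simp: Field_def)
  have "\<exists>m\<in>Field \<alpha>. underS \<alpha> m = Field \<alpha> - {m} \<and> \<theta> =o ctwo ^c b m"
    by (rule beth_step_finite[OF wo fin order_refl closed top])
  then obtain m1 where m1: "m1 \<in> Field \<alpha>" "underS \<alpha> m1 = Field \<alpha> - {m1}" "\<theta> =o ctwo ^c b m1"
    by (elim bexE conjE)
  show "|Pow (Field \<kappa>)| \<le>o \<theta>" by (rule Pow[OF base[OF m1(1)] m1(3,1)])
  assume four: "4 \<le> card (Field \<alpha>)"
  then have c1: "3 \<le> card (underS \<alpha> m1)" using m1 fin(1) by simp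
  obtain m2 where m2: "m2 \<in> Field \<alpha>" "b m1 =o ctwo ^c b m2" "2 \<le> card (underS \<alpha> m2)"
    using below[OF m1(1)] c1 by fastforce
  obtain m3 where m3: "m3 \<in> Field \<alpha>" "b m2 =o ctwo ^c b m3" "1 \<le> card (underS \<alpha> m3)"
    using below[OF m2(1)] m2(3) by fastforce
  obtain m4 where m4: "m4 \<in> Field \<alpha>" "b m3 =o ctwo ^c b m4"
    using below[OF m3(1)] m3(3) by fastforce
  have "|Pow (Field \<kappa>)| \<le>o b m3" by (rule Pow[OF base[OF m4(1)] m4(2,1)])
  then have "|Pow (Pow (Field \<kappa>))| \<le>o b m2" by (rule Pow[OF _ m3(2,1)])
  then have "|Pow (Pow (Pow (Field \<kappa>)))| \<le>o b m1" by (rule Pow[OF _ m2(2,1)])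
  then show "|Pow (Pow (Pow (Pow (Field \<kappa>))))| \<le>o \<theta>" by (rule Pow[OF _ m1(3,1)])
qed

text \<open>
The left-hand side bounds the size of a \<open>block_tree\<close> of height \<open>n\<close> with blocks of size \<open>(K + 1) ^ n\<close>. With
\<open>a = 2\<^bsup>n + m\<^esup>\<close> the exponents that occur are polynomials in \<open>a\<close>, hence below \<open>2\<^bsup>2\<^bsup>a\<^esup>\<^esup>\<close>.
\<close>

lemma block_size_bound:
  fixes n m :: nat
  assumes n: "3 \<le> n"
  defines "K \<equiv> (m + 1) ^ (n * 2 ^ n)"
  shows "((K + 1) ^ n + 1) ^ n < 2 ^ 2 ^ 2 ^ 2 ^ (n + m)"
proof -
  define a where "a = (2::nat) ^ (n + m)"
  have na: "n \<le> a" "m + 1 \<le> 2 ^ a" "2 ^ n \<le> a"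
  proof -
    have "n + m < a" unfolding a_def by (rule less_exp)
    then show "n \<le> a" by simp
    show "2 ^ n \<le> a" unfolding a_def by (rule power_increasing) auto
    have "m + 1 \<le> a" using \<open>n + m < a\<close> by simp
    also have "a \<le> 2 ^ a" using less_exp[of a] by simp
    finally show "m + 1 \<le> 2 ^ a" .
  qed
  have a8: "8 \<le> a"
    using power_increasing[of 3 "n + m" "2::nat"] n unfolding a_def by simp
  have a2: "a \<le> 2 ^ a" using less_exp[of a] by simp
  have "K \<le> (2 ^ a) ^ (n * 2 ^ n)" unfolding K_def by (rule power_mono[OF na(2)]) simp
  also have "\<dots> = 2 ^ (a * (n * 2 ^ n))" by (simp add: power_mult)
  also have "\<dots> \<le> 2 ^ (a * (a * a))" using na by (intro power_increasing mult_le_mono) auto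
  finally have K: "K \<le> 2 ^ (a * (a * a))" .
  define e where "e = a * (a * a) + 1"
  have "K + 1 \<le> 2 ^ e" using K unfolding e_def
    by (metis add_mono_thms_linordered_semiring(1) mult_2 one_le_numeral one_le_power power_add power_one_right mult.commute)
  then have "(K + 1) ^ n \<le> (2 ^ e) ^ n" by (rule power_mono) simp
  also have "\<dots> \<le> 2 ^ (e * a)" using na(1) by (simp add: power_mult[symmetric])
  finally have "(K + 1) ^ n \<le> 2 ^ (e * a)" .
  moreover have "(1::nat) \<le> 2 ^ (e * a)" by simp
  moreover have "(2::nat) ^ (e * a + 1) = 2 ^ (e * a) + 2 ^ (e * a)" by simp
  ultimately have "(K + 1) ^ n + 1 \<le> 2 ^ (e * a + 1)" by linarith
  then have "((K + 1) ^ n + 1) ^ n \<le> (2 ^ (e * a + 1)) ^ n" by (rule power_mono) simp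
  also have "\<dots> \<le> 2 ^ ((e * a + 1) * a)"
    unfolding power_mult[symmetric] using na(1) by (intro power_increasing mult_le_mono) auto
  finally have main: "((K + 1) ^ n + 1) ^ n \<le> 2 ^ ((e * a + 1) * a)" .
  have pow: "6 * x < 2 ^ x" if "8 \<le> x" for x :: nat
    using that by (induction x rule: dec_induct) auto
  have "(e * a + 1) * a \<le> a ^ 6"
  proof -
    have "(e * a + 1) * a = a ^ 5 + a * a + a" unfolding e_def by (simp add: algebra_simps power_numeral_reduce)
    moreover have "a * a \<le> a ^ 5" "a \<le> a ^ 5" using a8 by (simp_all add: power_numeral_reduce)
    moreover have "3 * a ^ 5 \<le> a * a ^ 5" using a8 by (intro mult_le_mono1) simp
    moreover have "a ^ 6 = a * a ^ 5" by (simp add: power_numeral_reduce)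
    ultimately show ?thesis by linarith
  qed
  also have "\<dots> < (2 ^ a) ^ 6" by (rule power_strict_mono) (simp_all add: less_exp)
  also have "\<dots> = 2 ^ (6 * a)" by (simp add: power_mult[symmetric] mult.commute)
  also have "\<dots> \<le> 2 ^ 2 ^ a" using pow[OF a8] by (intro power_increasing) auto
  finally have "(e * a + 1) * a < 2 ^ 2 ^ a" .
  then have "(2::nat) ^ ((e * a + 1) * a) < 2 ^ 2 ^ 2 ^ a" by simp
  then show ?thesis using main unfolding a_def by (rule le_less_trans[rotated])
qed


lemma ex_finite_blocks:
  fixes A :: "'o::wellorder set"
  assumes A: "finite A" "h * q \<le> card A"
  shows "\<exists>B :: nat \<Rightarrow> 'o set. (\<forall>k<h. finite (B k) \<and> card (B k) = q) \<and>
    (\<forall>k l a b. k < l \<longrightarrow> l < h \<longrightarrow> a \<in> B k \<longrightarrow> b \<in> B l \<longrightarrow> a < b)"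
proof -
  define xs where "xs = sorted_list_of_set A"
  have xs: "length xs = card A" "sorted_wrt (<) xs" using A(1) by (simp_all add: xs_def)
  define B where "B k = (!) xs ` {k * q..<k * q + q}" for k
  have le: "k * q + q \<le> l * q" if "k < l" for k l
    using mult_le_mono1[of "Suc k" l q] that by simp
  have bound: "k * q + q \<le> length xs" if "k < h" for k
    using le[OF that] A(2) xs(1) by simp
  have less: "xs ! i < xs ! j" if "i < j" "j < length xs" for i j
    using xs(2) that by (simp add: sorted_wrt_iff_nth_less)
  have size: "finite (B k) \<and> card (B k) = q" if k: "k < h" for k
  proof -
    have "inj_on ((!) xs) {k * q..<k * q + q}"
    proof (rule inj_onI, rule ccontr)
      fix i j assume "i \<in> {k * q..<k * q + q}" "j \<in> {k * q..<k * q + q}" "xs ! i = xs ! j" "i \<noteq> j"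
      then show False using less[of i j] less[of j i] bound[OF k] by (cases "i < j") auto
    qed
    then show ?thesis by (simp add: B_def card_image)
  qed
  have sep: "a < b" if kl: "k < l" "l < h" and ab: "a \<in> B k" "b \<in> B l" for k l a b
  proof -
    obtain i where i: "i < k * q + q" "a = xs ! i" using ab(1) unfolding B_def by auto
    obtain j where j: "l * q \<le> j" "j < l * q + q" "b = xs ! j" using ab(2) unfolding B_def by auto
    show ?thesis using less[of i j] i j le[OF kl(1)] bound[OF kl(2)] by simp
  qed
  show ?thesis
  proof (intro exI[of _ B] conjI allI impI)
    show "finite (B k)" "card (B k) = q" if "k < h" for k using size[OF that] by simp_all
    show "a < b" if "k < l" "l < h" "a \<in> B k" "b \<in> B l" for k l a b using sep[OF that] .
  qed
qed

text \<open>
Below \<open>a\<close> every point is followed by a gap of more than \<open>\<beta>\<close> ordinals; iterating this yields consecutive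
intervals.
\<close>

lemma ex_infinite_blocks:
  fixes a :: "'o::wellorder"
  assumes \<beta>: "Cinfinite \<beta>" and a: "first_above (ctwo ^c \<beta>) a"
  shows "\<exists>B :: nat \<Rightarrow> 'o set. (\<forall>k. \<not> |B k| \<le>o \<beta> \<and> |B k| \<le>o ctwo ^c \<beta>) \<and>
    (\<forall>k l. \<forall>x\<in>B k. \<forall>y\<in>B l. k < l \<longrightarrow> x < y)"
proof -
  define nxt where "nxt b = (SOME b'. b' < a \<and> \<not> |{b..<b'}| \<le>o \<beta>)" for b
  have nxt: "nxt b < a \<and> \<not> |{b..<nxt b}| \<le>o \<beta>" if "b < a" for b
    unfolding nxt_def by (rule someI_ex) (use first_above_gap[OF \<beta> a that] in blast)
  have "{..<a} \<noteq> {}"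
    using a Card_order_empty[OF Card_order_cexp] unfolding first_above_def by metis
  then obtain b0 where b0: "b0 < a" by auto
  define s where "s k = (nxt ^^ k) b0" for k
  have s: "s k < a" for k by (induction k) (use b0 nxt in \<open>auto simp: s_def\<close>)
  have gap: "\<not> |{s k..<s (Suc k)}| \<le>o \<beta>" for k using nxt[OF s[of k]] by (simp add: s_def)
  have step: "s k \<le> s (Suc k)" for k
  proof (rule ccontr)
    assume "\<not> s k \<le> s (Suc k)"
    then have "{s k..<s (Suc k)} = {}" by simp
    then show False using gap[of k] \<beta> by (simp add: Card_order_empty)
  qed
  have mono: "s k \<le> s l" if "k \<le> l" for k l using lift_Suc_mono_le[of s, OF step that] .
  have "|{s k..<s (Suc k)}| \<le>o ctwo ^c \<beta>" for k
  proof (rule ordLeq_transitive[OF card_of_mono1])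
    show "{s k..<s (Suc k)} \<subseteq> {..<s (Suc k)}" by auto
    show "|{..<s (Suc k)}| \<le>o ctwo ^c \<beta>" using a s unfolding first_above_def by blast
  qed
  moreover have "x < y" if "x \<in> {s k..<s (Suc k)}" "y \<in> {s l..<s (Suc l)}" "k < l" for k l x y
  proof -
    have "x < s (Suc k)" "s l \<le> y" using that by auto
    then show ?thesis using mono[of "Suc k" l] that(3) by (meson Suc_leI less_le_trans)
  qed
  ultimately show ?thesis using gap by (intro exI[of _ "\<lambda>k. {s k..<s (Suc k)}"]) blast
qed

text \<open>
The well-order \<open>|S|\<^sup>+\<close> is finite with more than \<open>n\<close> elements, so that \<open>\<theta>\<close> is at least a fourfold
exponential if \<open>n \<ge> 3\<close>. It has to provide the room for \<open>T\<close> in \<open>'o\<close> as well as its bound. For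
infinite \<open>\<mu>\<close> blocks of size between \<open>|S| + \<mu>\<close> and \<open>2\<^bsup>|S| + \<mu>\<^esup>\<close> suffice.
\<close>

lemma uniform_copy_finite:
  fixes S :: "'o::wellorder list set" and \<mu> :: "'m rel" and \<theta> :: "'o rel"
  assumes S: "tree S" and fin: "finite S" and \<mu>: "Card_order \<mu>"
    and \<theta>: "is_beth ( |S| +c \<mu>) (cardSuc |S| ) \<theta>"
  shows "\<exists>T :: 'o list set. tree T \<and>
           (\<forall>c. c \<in> Fpow T \<rightarrow> Field \<mu> \<longrightarrow>
              (\<exists>T'. subtree T' T \<and> tree_isomorphic S T' \<and> end_uniform T' c)) \<and>
           |T| <o \<theta>"
proof -
  define \<alpha> where "\<alpha> = cardSuc |S|"
  define \<kappa> where "\<kappa> = |S| +c \<mu>"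
  define n where "n = card S"
  have wo: "Well_order \<alpha>" unfolding \<alpha>_def by (rule cardSuc_Well_order[OF card_of_Card_order])
  have \<kappa>: "Card_order \<kappa>" unfolding \<kappa>_def by (rule Card_order_csum)
  have fin\<alpha>: "finite (Field \<alpha>)" unfolding \<alpha>_def card_of_cardSuc_finite by (rule fin)
  have ne\<alpha>: "Field \<alpha> \<noteq> {}" unfolding \<alpha>_def by (rule Field_cardSuc_not_empty[OF card_of_Card_order])
  have card\<alpha>: "n < card (Field \<alpha>)"
  proof (rule ccontr)
    assume "\<not> n < card (Field \<alpha>)"
    then obtain f where "inj_on f (Field \<alpha>)" "f ` Field \<alpha> \<subseteq> S"
      using card_le_inj[OF fin\<alpha> fin] unfolding n_def by (auto simp: not_less)
    then have "|Field \<alpha>| \<le>o |S|" unfolding card_of_ordLeq[symmetric] by blast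
    moreover have "|Field \<alpha>| =o \<alpha>"
      unfolding \<alpha>_def by (rule card_of_Field_ordIso[OF cardSuc_Card_order[OF card_of_Card_order]])
    ultimately have "\<alpha> \<le>o |S|" using ordIso_ordLeq_trans[OF ordIso_symmetric] by blast
    then show False
      using cardSuc_greater[OF card_of_Card_order, of S] not_ordLess_ordLeq unfolding \<alpha>_def by blast
  qed
  note \<theta>' = \<theta>[folded \<kappa>_def \<alpha>_def]
  have S\<kappa>: "|S| \<le>o |Field \<kappa>|"
    unfolding \<kappa>_def using ordLeq_ordIso_trans[OF ordLeq_csum1[OF card_of_Card_order]
      ordIso_symmetric[OF card_of_Field_ordIso[OF Card_order_csum]]] .
  show ?thesis
  proof (cases "3 \<le> n")
    case False
    have "\<rho>' = \<rho>''" if "\<rho>' \<in> S" "\<rho>'' \<in> S" "length \<rho>' = length \<rho>''" for \<rho>' \<rho>''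
    proof (rule ccontr)
      assume "\<rho>' \<noteq> \<rho>''"
      then have "card {[], \<rho>', \<rho>''} = 3" using that(3) by (auto simp: card_insert_if)
      moreover have "card {[], \<rho>', \<rho>''} \<le> n"
        unfolding n_def using that tree_Nil[OF S] by (intro card_mono[OF fin]) auto
      ultimately show False using False by simp
    qed
    then have "end_uniform S c" for c :: "'o list set \<Rightarrow> 'm" by (rule end_uniform_trivial)
    moreover have "tree_isomorphic S S"
      unfolding tree_isomorphic_def by (rule exI[of _ id]) (simp add: tree_embedding_def)
    moreover have "|S| <o \<theta>"
    proof -
      have "|Field \<kappa>| <o |Pow (Field \<kappa>)|" by (rule card_of_Pow)
      from ordLess_ordLeq_trans[OF this is_beth_finite(1)[OF \<theta>' wo \<kappa> fin\<alpha> ne\<alpha>]]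
      show ?thesis by (rule ordLeq_ordLess_trans[OF S\<kappa>])
    qed
    ultimately show ?thesis using S unfolding subtree_def by blast
  next
    case n3: True
    have big: "|Pow (Pow (Pow (Pow (Field \<kappa>))))| \<le>o \<theta>"
      by (rule is_beth_finite(2)[OF \<theta>' wo \<kappa> fin\<alpha> ne\<alpha>]) (use n3 card\<alpha> in simp)
    have \<theta>card: "Card_order \<theta>" using \<theta>' unfolding is_beth_def beth_step_def by blast
    have \<theta>Field: "\<theta> =o |Field \<theta>|" by (rule ordIso_symmetric[OF card_of_Field_ordIso[OF \<theta>card]])
    have conclude: ?thesis if "tree T" "arrows |{()}| (Field \<mu>) T S" "|T| <o \<theta>" for T :: "'o list set"
      using that arrows_uniform_subtree[OF S that(1,2) card_of_Card_order] by (auto simp: Field_card_of)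
    show ?thesis
    proof (cases "finite (Field \<mu>)")
      case True
      define K where "K = (card (Field \<mu>) + 1) ^ (n * 2 ^ n)"
      define q where "q = (K + 1) ^ n"
      define P where "P = Pow (Pow (Pow (Pow (Field \<kappa>))))"
      have Field\<kappa>: "Field \<kappa> = Inl ` S \<union> Inr ` Field \<mu>" unfolding \<kappa>_def Field_csum Field_card_of ..
      have card\<kappa>: "finite (Field \<kappa>)" "card (Field \<kappa>) = n + card (Field \<mu>)"
      proof -
        have "card (Inl ` S \<union> Inr ` Field \<mu> :: ('o list + 'm) set) =
            card (Inl ` S :: ('o list + 'm) set) + card (Inr ` Field \<mu> :: ('o list + 'm) set)"
          by (rule card_Un_disjoint) (use fin True in auto)
        then show "card (Field \<kappa>) = n + card (Field \<mu>)" unfolding Field\<kappa> n_def by (simp add: card_image)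
        show "finite (Field \<kappa>)" unfolding Field\<kappa> using fin True by simp
      qed
      have P: "finite P" "card P = 2 ^ 2 ^ 2 ^ 2 ^ (n + card (Field \<mu>))"
        unfolding P_def using card\<kappa> by (simp_all add: card_Pow)
      have bound: "(q + 1) ^ n < card P" unfolding P(2) q_def K_def by (rule block_size_bound[OF n3])
      have "|P| \<le>o |Field \<theta>|" unfolding P_def by (rule ordLeq_ordIso_trans[OF big \<theta>Field])
      then obtain g where g: "inj_on g P" "g ` P \<subseteq> Field \<theta>" unfolding card_of_ordLeq[symmetric] by blast
      have "n * q \<le> (q + 1) ^ n"
      proof -
        have "1 + k * q \<le> (q + 1) ^ k" for k
        proof (induction k)
          case (Suc k)
          have "1 + Suc k * q \<le> (1 + k * q) * (q + 1)" by (simp add: algebra_simps)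
          also have "\<dots> \<le> (q + 1) ^ k * (q + 1)" using Suc by (rule mult_le_mono1)
          finally show ?case by (simp add: mult.commute)
        qed simp
        from this[of n] show ?thesis by simp
      qed
      then have "n * q \<le> card (g ` P)" using bound g(1) by (simp add: card_image)
      then obtain B where B: "\<forall>k<n. finite (B k) \<and> card (B k) = q"
        "\<forall>k l a b. k < l \<longrightarrow> l < n \<longrightarrow> a \<in> B k \<longrightarrow> b \<in> B l \<longrightarrow> a < (b :: 'o)"
        using ex_finite_blocks[of "g ` P" n q] P(1) by auto
      have "card (block_tree B n) < card P" and finT: "finite (block_tree B n)"
        using card_block_tree[of n B q] B(1) bound by auto
      show ?thesis
      proof (rule conclude)
        show "tree (block_tree B n)" by (rule tree_block_tree) (use B(2) in blast)
        show "arrows |{()}| (Field \<mu>) (block_tree B n) S"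
          unfolding n_def
        proof (rule arrows_finite[OF divisible_finite[OF True] block_tree_full S fin])
          show "K = (card (Field \<mu>) + 1) ^ (card S * 2 ^ card S)" unfolding K_def n_def ..
          show "finite (B k) \<and> (K + 1) ^ card S \<le> card (B k)" if "k < card S" for k
            using B(1) that unfolding n_def q_def by simp
        qed
        have "\<not> |P| \<le>o |block_tree B n|"
        proof
          assume "|P| \<le>o |block_tree B n|"
          then obtain f where "inj_on f P" "f ` P \<subseteq> block_tree B n" unfolding card_of_ordLeq[symmetric] by blast
          then have "card P \<le> card (block_tree B n)" using finT by (rule card_inj_on_le)
          then show False using \<open>card (block_tree B n) < card P\<close> by simp
        qed
        then have "|block_tree B n| <o |P|" by (simp add: not_ordLeq_card_of card_of_Card_order)
        then show "|block_tree B n| <o \<theta>" unfolding P_def by (rule ordLess_ordLeq_trans[OF _ big])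
      qed
    next
      case False
      then have \<mu>inf: "Cinfinite \<mu>" using \<mu> by (simp add: cinfinite_def)
      then have \<kappa>inf: "Cinfinite \<kappa>" unfolding \<kappa>_def by (intro Cinfinite_csum) blast
      have \<kappa>2: "Cinfinite (ctwo ^c \<kappa>)" by (rule Cinfinite_ctwo_cexp[OF \<kappa>inf])
      have "ctwo ^c \<kappa> =o ctwo ^c |Field \<kappa>|"
        by (rule ordIso_symmetric[OF cexp_cong2[OF card_of_Field_ordIso[OF \<kappa>] Card_order_ctwo card_of_Card_order]])
      also have "ctwo ^c |Field \<kappa>| =o |Pow (Field \<kappa>)|" by (rule ordIso_symmetric[OF Pow_cexp_ctwo])
      finally have "ctwo ^c \<kappa> \<le>o |Pow (Field \<kappa>)|" by (rule ordIso_imp_ordLeq)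
      from ordLeq_ordIso_trans[OF ctwo_cexp_mono[OF this \<kappa>2] ordIso_symmetric[OF Pow_cexp_ctwo]]
      have "ctwo ^c (ctwo ^c \<kappa>) <o |Pow (Pow (Pow (Field \<kappa>)))|"
        by (rule ordLeq_ordLess_trans[OF _ card_of_Pow])
      then have E2: "ctwo ^c (ctwo ^c \<kappa>) <o \<theta>"
        by (rule ordLess_ordLeq_trans[OF _ ordLeq_transitive[OF ordLess_imp_ordLeq[OF card_of_Pow] big]])
      have "\<theta> \<le>o |UNIV :: 'o set|"
        by (rule ordIso_ordLeq_trans[OF \<theta>Field card_of_mono1]) simp
      from ordLess_ordLeq_trans[OF E2 this]
      have "\<not> |UNIV :: 'o set| \<le>o ctwo ^c (ctwo ^c \<kappa>)" by (simp add: not_ordLeq_card_of Card_order_cexp)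
      then obtain a :: 'o where "first_above (ctwo ^c \<kappa>) a" using ex_first_above[OF \<kappa>2] by blast
      from ex_infinite_blocks[OF \<kappa>inf this]
      obtain B :: "nat \<Rightarrow> 'o set" where B: "\<forall>k. \<not> |B k| \<le>o \<kappa> \<and> |B k| \<le>o ctwo ^c \<kappa>"
        "\<forall>k l. \<forall>x\<in>B k. \<forall>y\<in>B l. k < l \<longrightarrow> x < y" by (elim exE conjE)
      show ?thesis
      proof (rule conclude)
        show "tree (block_tree B n)" by (rule tree_block_tree) (use B(2) in blast)
        have "|Field \<mu>| \<le>o \<kappa>"
          unfolding \<kappa>_def by (rule ordIso_ordLeq_trans[OF card_of_Field_ordIso[OF \<mu>] ordLeq_csum2[OF \<mu>]])
        then show "arrows |{()}| (Field \<mu>) (block_tree B n) S"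
          unfolding n_def
        proof (rule arrows_finite[OF divisible_infinite[OF \<kappa>inf] block_tree_full S fin])
          show "\<not> |B k| \<le>o \<kappa>" for k using B(1) by blast
        qed
        have "|block_tree B n| \<le>o ctwo ^c \<kappa>" using B(1) by (intro card_of_block_tree_ordLeq[OF \<kappa>2]) blast
        then have "|block_tree B n| \<le>o ctwo ^c (ctwo ^c \<kappa>)"
          by (rule ordLeq_transitive[OF _ ordLeq_ctwo_cexp[OF Card_order_cexp]])
        then show "|block_tree B n| <o \<theta>" by (rule ordLeq_ordLess_trans[OF _ E2])
      qed
    qed
  qed
qed

theorem claim16:
  fixes S :: "'o::wellorder list set" and \<mu> :: "'m rel" and \<theta> :: "'o rel"
  assumes "tree S" and "Card_order \<mu>"
    and "is_beth ( |S| +c \<mu>) (cardSuc |S| ) \<theta>"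
  shows "\<exists>T :: 'o list set. tree T \<and>
           (\<forall>c. c \<in> Fpow T \<rightarrow> Field \<mu> \<longrightarrow>
              (\<exists>T'. subtree T' T \<and> tree_isomorphic S T' \<and> end_uniform T' c)) \<and>
           |T| <o \<theta>"
  using uniform_copy_infinite[OF assms(1) _ assms(2,3)] uniform_copy_finite[OF assms(1) _ assms(2,3)]
  by blast

end
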